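(* For any $s\ge0$, Tao's gauge transform $$\mathcal G:H^s_{r,0}\to H^s_{+,0},\qquad u\mapsto\partial_x\Pi\big(e^{-i\partial_x^{-1}u}\big),$$ is a real analytic diffeomorphism onto an open subset of $H^s_{+,0}$, which is proper. In particular, the functions $in\,e^{inx}$, $n\ge1$, do not belong to the range of $\mathcal G$, and the differential of $\mathcal G$ at $u=0$ reads $d_0\mathcal G=-i\Pi$.
   Context: $\mathbb T=\mathbb R/2\pi\mathbb Z$; $\langle f|g\rangle=\frac1{2\pi}\int_0^{2\pi}f\overline g\,dx$; $\widehat f(n)=\langle f|e^{inx}\rangle$; $H^s_{r,0}$ is the space of $v\in H^s(\mathbb T,\mathbb R)$ with $\langle v|1\rangle=0$; $H^s_+=\{f\in H^s(\mathbb T,\mathbb C):\widehat f(n)=0\ \forall n<0\}$; $H^s_{+,0}=\{f\in H^s_+:\langle f|1\rangle=0\}$ (regarded as a real Hilbert space when speaking of real analyticity); $\Pi f=\sum_{n\ge0}\widehat f(n)e^{inx}$; $\partial_x^{-1}f=\sum_{n\ne0}\frac1{in}\widehat f(n)e^{inx}$. *)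

theory Defs
  imports "HOL-Analysis.Analysis"
begin

definition torus_L2_fun :: "(real \<Rightarrow> complex) \<Rightarrow> bool" where
  "torus_L2_fun f \<longleftrightarrow>
     f \<in> borel_measurable borel \<and> (\<forall>x. f (x + 2 * pi) = f x) \<and>
     set_integrable lborel {0..2 * pi} (\<lambda>x. (cmod (f x))\<^sup>2)"

definition torus_inner :: "(real \<Rightarrow> complex) \<Rightarrow> (real \<Rightarrow> complex) \<Rightarrow> complex" where
  "torus_inner f g =
     complex_of_real (1 / (2 * pi)) * (LINT x:{0..2 * pi}|lborel. f x * cnj (g x))"

lemma torus_L2_fun_measurable: "torus_L2_fun f \<Longrightarrow> f \<in> borel_measurable borel"
  by (simp add: torus_L2_fun_def)

lemma torus_L2_fun_zero: "torus_L2_fun (\<lambda>x. 0)"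
  by (simp add: torus_L2_fun_def set_integrable_def)

lemma torus_L2_fun_scale:
  assumes "torus_L2_fun f"
  shows "torus_L2_fun (\<lambda>x. c * f x)"
proof -
  have "set_integrable lborel {0..2 * pi} (\<lambda>x. (cmod c)\<^sup>2 * (cmod (f x))\<^sup>2)"
    using assms by (intro set_integrable_mult_right) (simp add: torus_L2_fun_def)
  then show ?thesis
    using assms by (auto simp: torus_L2_fun_def norm_mult power_mult_distrib)
qed

lemma torus_L2_fun_add:
  assumes f: "torus_L2_fun f" and g: "torus_L2_fun g"
  shows "torus_L2_fun (\<lambda>x. f x + g x)"
proof -
  note [measurable] = torus_L2_fun_measurable[OF f] torus_L2_fun_measurable[OF g]
  have bd: "(cmod (f x + g x))\<^sup>2 \<le> 2 * (cmod (f x))\<^sup>2 + 2 * (cmod (g x))\<^sup>2" for x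
  proof -
    have "(cmod (f x + g x))\<^sup>2 \<le> (cmod (f x) + cmod (g x))\<^sup>2"
      by (intro power_mono norm_triangle_ineq) auto
    also have "\<dots> \<le> 2 * (cmod (f x))\<^sup>2 + 2 * (cmod (g x))\<^sup>2"
      using sum_squares_bound[of "cmod (f x)" "cmod (g x)"] by (simp add: power2_sum)
    finally show ?thesis .
  qed
  have "set_integrable lborel {0..2 * pi} (\<lambda>x. 2 * (cmod (f x))\<^sup>2 + 2 * (cmod (g x))\<^sup>2)"
    using f g by (intro set_integral_add set_integrable_mult_right) (auto simp: torus_L2_fun_def)
  then have "set_integrable lborel {0..2 * pi} (\<lambda>x. (cmod (f x + g x))\<^sup>2)"
    unfolding set_integrable_def
  proof (rule Bochner_Integration.integrable_bound)
    show "AE x in lborel. norm (indicator {0..2 * pi} x *\<^sub>R (cmod (f x + g x))\<^sup>2)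
        \<le> norm (indicator {0..2 * pi} x *\<^sub>R (2 * (cmod (f x))\<^sup>2 + 2 * (cmod (g x))\<^sup>2))"
      using bd by (auto intro!: AE_I2 simp: indicator_def)
  qed measurable
  then show ?thesis
    using f g by (auto simp: torus_L2_fun_def)
qed

lemma torus_L2_fun_bounded:
  assumes "f \<in> borel_measurable borel" "\<And>x. f (x + 2 * pi) = f x"
    and "AE x in lborel. x \<in> {0..2 * pi} \<longrightarrow> cmod (f x) \<le> B"
  shows "torus_L2_fun f"
proof -
  note [measurable] = assms(1)
  have i: "integrable lborel (\<lambda>x. indicator {0..2 * pi} x *\<^sub>R (B\<^sup>2))"
    by (intro integrable_scaleR_left integrable_real_indicator) auto
  have "set_integrable lborel {0..2 * pi} (\<lambda>x. (cmod (f x))\<^sup>2)"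
    unfolding set_integrable_def
    by (rule Bochner_Integration.integrable_bound[OF i], measurable)
       (use assms(3) in \<open>auto simp: indicator_def power_mono\<close>)
  then show ?thesis
    using assms by (auto simp: torus_L2_fun_def)
qed

lemma borel_measurable_cnj_comp:
  "g \<in> borel_measurable M \<Longrightarrow> (\<lambda>x. cnj (g x)) \<in> borel_measurable M"
  by (rule measurable_compose[OF _ borel_measurable_continuous_onI])
     (auto intro: continuous_intros)

lemma torus_prod_integrable:
  assumes f: "torus_L2_fun f" and g: "torus_L2_fun g"
  shows "set_integrable lborel {0..2 * pi} (\<lambda>x. f x * cnj (g x))"
proof -
  note [measurable] = torus_L2_fun_measurable[OF f] torus_L2_fun_measurable[OF g]
  note [measurable] = borel_measurable_cnj_comp[OF torus_L2_fun_measurable[OF g]]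
  have bd: "cmod (f x * cnj (g x)) \<le> (cmod (f x))\<^sup>2 + (cmod (g x))\<^sup>2" for x
  proof -
    have "cmod (f x) * cmod (g x) \<le> 2 * cmod (f x) * cmod (g x)"
      by simp
    also have "\<dots> \<le> (cmod (f x))\<^sup>2 + (cmod (g x))\<^sup>2"
      by (rule sum_squares_bound)
    finally show ?thesis by (simp add: norm_mult)
  qed
  have "set_integrable lborel {0..2 * pi} (\<lambda>x. (cmod (f x))\<^sup>2 + (cmod (g x))\<^sup>2)"
    using f g by (intro set_integral_add) (auto simp: torus_L2_fun_def)
  then show ?thesis
    unfolding set_integrable_def
  proof (rule Bochner_Integration.integrable_bound)
    show "AE x in lborel. norm (indicator {0..2 * pi} x *\<^sub>R (f x * cnj (g x)))
        \<le> norm (indicator {0..2 * pi} x *\<^sub>R ((cmod (f x))\<^sup>2 + (cmod (g x))\<^sup>2))"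
      using bd by (auto intro!: AE_I2 simp: indicator_def)
  qed measurable
qed

definition torus_eq :: "(real \<Rightarrow> complex) \<Rightarrow> (real \<Rightarrow> complex) \<Rightarrow> bool" where
  "torus_eq f g \<longleftrightarrow> torus_L2_fun f \<and> torus_L2_fun g \<and>
     (AE x in lborel. x \<in> {0..2 * pi} \<longrightarrow> f x = g x)"

lemma part_equivp_torus_eq: "part_equivp torus_eq"
proof (rule part_equivpI)
  show "\<exists>f. torus_eq f f"
    using torus_L2_fun_zero by (auto simp: torus_eq_def)
  show "symp torus_eq"
    by (auto simp: symp_def torus_eq_def)
  show "transp torus_eq"
    by (auto simp: transp_def torus_eq_def)
qed

quotient_type torus_L2 = "real \<Rightarrow> complex" / partial: torus_eq
  by (rule part_equivp_torus_eq)

lift_definition L2_cinner :: "torus_L2 \<Rightarrow> torus_L2 \<Rightarrow> complex" is torus_inner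
proof -
  fix f f' g g' assume A: "torus_eq f f'" "torus_eq g g'"
  then have fg: "torus_L2_fun f" "torus_L2_fun f'" "torus_L2_fun g" "torus_L2_fun g'"
    by (auto simp: torus_eq_def)
  note [measurable] = fg[THEN torus_L2_fun_measurable]
    fg[THEN torus_L2_fun_measurable, THEN borel_measurable_cnj_comp]
  have "AE x in lborel. x \<in> {0..2 * pi} \<longrightarrow> f x = f' x"
    "AE x in lborel. x \<in> {0..2 * pi} \<longrightarrow> g x = g' x"
    using A by (auto simp: torus_eq_def)
  then have ae: "AE x in lborel. indicator {0..2 * pi} x *\<^sub>R (f x * cnj (g x))
      = (indicator {0..2 * pi} x *\<^sub>R (f' x * cnj (g' x)) :: complex)"
    by eventually_elim (auto simp: indicator_def)
  have "(LINT x:{0..2 * pi}|lborel. f x * cnj (g x)) = (LINT x:{0..2 * pi}|lborel. f' x * cnj (g' x))"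
    unfolding set_lebesgue_integral_def by (rule integral_cong_AE) (measurable, rule ae)
  then show "torus_inner f g = torus_inner f' g'"
    by (simp add: torus_inner_def)
qed

lift_definition L2_scale :: "complex \<Rightarrow> torus_L2 \<Rightarrow> torus_L2" is "\<lambda>c f x. c * f x"
  by (auto simp: torus_eq_def intro: torus_L2_fun_scale)

text \<open>The real inner product is the real part of the complex one, so both induce the same
  norm.\<close>

instantiation torus_L2 :: real_inner
begin

lift_definition zero_torus_L2 :: torus_L2 is "\<lambda>x. 0"
  by (simp add: torus_eq_def torus_L2_fun_zero)

lift_definition plus_torus_L2 :: "torus_L2 \<Rightarrow> torus_L2 \<Rightarrow> torus_L2" is "\<lambda>f g x. f x + g x"
  by (auto simp: torus_eq_def intro: torus_L2_fun_add)

definition uminus_torus_L2 :: "torus_L2 \<Rightarrow> torus_L2" where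
  "uminus_torus_L2 f = L2_scale (-1) f"

definition minus_torus_L2 :: "torus_L2 \<Rightarrow> torus_L2 \<Rightarrow> torus_L2" where
  "minus_torus_L2 f g = f + L2_scale (-1) g"

definition scaleR_torus_L2 :: "real \<Rightarrow> torus_L2 \<Rightarrow> torus_L2" where
  "scaleR_torus_L2 r f = L2_scale (complex_of_real r) f"

definition inner_torus_L2 :: "torus_L2 \<Rightarrow> torus_L2 \<Rightarrow> real" where
  "inner_torus_L2 f g = Re (L2_cinner f g)"

definition norm_torus_L2 :: "torus_L2 \<Rightarrow> real" where
  "norm_torus_L2 f = sqrt (inner f f)"

definition sgn_torus_L2 :: "torus_L2 \<Rightarrow> torus_L2" where
  "sgn_torus_L2 f = inverse (norm f) *\<^sub>R f"

definition dist_torus_L2 :: "torus_L2 \<Rightarrow> torus_L2 \<Rightarrow> real" where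
  "dist_torus_L2 f g = norm (f - g)"

definition uniformity_torus_L2 :: "(torus_L2 \<times> torus_L2) filter" where
  "uniformity_torus_L2 = (INF e\<in>{0<..}. principal {(x, y). dist x y < e})"

definition open_torus_L2 :: "torus_L2 set \<Rightarrow> bool" where
  "open_torus_L2 U \<longleftrightarrow> (\<forall>x\<in>U. eventually (\<lambda>(x', y). x' = x \<longrightarrow> y \<in> U) uniformity)"

instance
proof
  fix f g h :: torus_L2 and a b r :: real and U :: "torus_L2 set"
  show "f + g + h = f + (g + h)"
    by transfer (auto simp: torus_eq_def add.assoc intro!: torus_L2_fun_add)
  show "f + g = g + f"
    by transfer (auto simp: torus_eq_def add.commute intro!: torus_L2_fun_add)
  show "0 + f = f"
    by transfer (auto simp: torus_eq_def)
  show "- f + f = 0"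
    unfolding uminus_torus_L2_def
    by transfer (use torus_L2_fun_zero in \<open>auto simp: torus_eq_def\<close>)
  show "f - g = f + - g"
    by (simp add: uminus_torus_L2_def minus_torus_L2_def)
  show "a *\<^sub>R (f + g) = a *\<^sub>R f + a *\<^sub>R g"
    unfolding scaleR_torus_L2_def
    by transfer (auto simp: torus_eq_def distrib_left intro!: torus_L2_fun_add torus_L2_fun_scale)
  show "(a + b) *\<^sub>R f = a *\<^sub>R f + b *\<^sub>R f"
    unfolding scaleR_torus_L2_def of_real_add
    by transfer (auto simp: torus_eq_def distrib_right intro!: torus_L2_fun_add torus_L2_fun_scale)
  show "a *\<^sub>R b *\<^sub>R f = (a * b) *\<^sub>R f"
    unfolding scaleR_torus_L2_def of_real_mult
    by transfer (auto simp: torus_eq_def mult.assoc intro!: torus_L2_fun_scale)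
  show "1 *\<^sub>R f = f"
    unfolding scaleR_torus_L2_def of_real_1
    by transfer (auto simp: torus_eq_def)
  show "sgn f = inverse (norm f) *\<^sub>R f"
    by (rule sgn_torus_L2_def)
  show "dist f g = norm (f - g)"
    by (rule dist_torus_L2_def)
  show "(uniformity :: (torus_L2 \<times> torus_L2) filter)
      = (INF e\<in>{0<..}. principal {(x, y). dist x y < e})"
    by (rule uniformity_torus_L2_def)
  show "open U = (\<forall>x\<in>U. \<forall>\<^sub>F (x', y) in uniformity. x' = x \<longrightarrow> y \<in> U)"
    by (rule open_torus_L2_def)
  show "norm f = sqrt (inner f f)"
    by (rule norm_torus_L2_def)
  show "inner f g = inner g f"
    unfolding inner_torus_L2_def
  proof transfer
    fix f g :: "real \<Rightarrow> complex"
    have "(LINT x:{0..2 * pi}|lborel. f x * cnj (g x))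
        = (LINT x|lborel. cnj (indicator {0..2 * pi} x *\<^sub>R (g x * cnj (f x))))"
      unfolding set_lebesgue_integral_def
      by (rule Bochner_Integration.integral_cong) (simp_all add: mult.commute)
    also have "\<dots> = cnj (LINT x:{0..2 * pi}|lborel. g x * cnj (f x))"
      unfolding set_lebesgue_integral_def by (rule Bochner_Integration.integral_cnj)
    finally have "(LINT x:{0..2 * pi}|lborel. f x * cnj (g x))
        = cnj (LINT x:{0..2 * pi}|lborel. g x * cnj (f x))" .
    then show "Re (torus_inner f g) = Re (torus_inner g f)"
      by (simp add: torus_inner_def)
  qed
  show "inner (f + g) h = inner f h + inner g h"
    unfolding inner_torus_L2_def
  proof transfer
    fix f g h assume "torus_eq f f" "torus_eq g g" "torus_eq h h"
    then have "set_integrable lborel {0..2 * pi} (\<lambda>x. f x * cnj (h x))"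
      "set_integrable lborel {0..2 * pi} (\<lambda>x. g x * cnj (h x))"
      by (auto simp: torus_eq_def intro!: torus_prod_integrable)
    then show "Re (torus_inner (\<lambda>x. f x + g x) h) = Re (torus_inner f h) + Re (torus_inner g h)"
      by (simp add: torus_inner_def distrib_left distrib_right set_integral_add add_divide_distrib)
  qed
  show "inner (r *\<^sub>R f) g = r * inner f g"
    unfolding inner_torus_L2_def scaleR_torus_L2_def
    by transfer (simp add: torus_inner_def mult.assoc)
  have *: "torus_inner f f =
      complex_of_real (1 / (2 * pi) * (LINT x:{0..2 * pi}|lborel. (cmod (f x))\<^sup>2))" for f
    unfolding torus_inner_def set_lebesgue_integral_def of_real_mult integral_complex_of_real[symmetric]
    by (intro arg_cong[where f = "\<lambda>z. _ * z"] Bochner_Integration.integral_cong)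
       (auto simp: scaleR_conv_of_real complex_norm_square[symmetric])
  show "0 \<le> inner f f"
    unfolding inner_torus_L2_def
    by transfer (auto simp: * set_lebesgue_integral_def intro!: Bochner_Integration.integral_nonneg)
  show "(inner f f = 0) = (f = 0)"
    unfolding inner_torus_L2_def
  proof transfer
    fix f assume f: "torus_eq f f"
    then have i: "integrable lborel (\<lambda>x. indicator {0..2 * pi} x *\<^sub>R (cmod (f x))\<^sup>2)"
      by (auto simp: torus_eq_def torus_L2_fun_def set_integrable_def)
    have "Re (torus_inner f f) = 0
        \<longleftrightarrow> (LINT x|lborel. indicator {0..2 * pi} x *\<^sub>R (cmod (f x))\<^sup>2) = 0"
      by (simp add: * set_lebesgue_integral_def)
    also have "\<dots> \<longleftrightarrow> (AE x in lborel. indicator {0..2 * pi} x *\<^sub>R (cmod (f x))\<^sup>2 = 0)"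
      by (intro integral_nonneg_eq_0_iff_AE i) auto
    also have "\<dots> \<longleftrightarrow> (AE x in lborel. x \<in> {0..2 * pi} \<longrightarrow> f x = 0)"
      by (intro AE_cong) (auto simp: indicator_def)
    also have "\<dots> \<longleftrightarrow> torus_eq f (\<lambda>x. 0)"
      using f torus_L2_fun_zero by (auto simp: torus_eq_def)
    finally show "Re (torus_inner f f) = 0 \<longleftrightarrow> torus_eq f (\<lambda>x. 0)" .
  qed
qed

end

lift_definition L2_exp :: "int \<Rightarrow> torus_L2" is "\<lambda>n x. cis (of_int n * x)"
proof -
  fix n :: int
  have "cis (of_int n * (x + 2 * pi)) = cis (of_int n * x)" for x
    by (simp add: distrib_left cis_mult[symmetric])
       (metis cis_multiple_2pi Ints_of_int mult.assoc mult.commute mult.right_neutral)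
  then have "torus_L2_fun (\<lambda>x. cis (of_int n * x))"
    by (intro torus_L2_fun_bounded[where B = 1] borel_measurable_continuous_onI)
       (auto intro!: continuous_intros)
  then show "torus_eq (\<lambda>x. cis (of_int n * x)) (\<lambda>x. cis (of_int n * x))"
    by (simp add: torus_eq_def)
qed

lift_definition L2_real_valued :: "torus_L2 \<Rightarrow> bool"
  is "\<lambda>f. AE x in lborel. x \<in> {0..2 * pi} \<longrightarrow> f x \<in> \<real>"
proof -
  fix f g assume "torus_eq f g"
  then have eq: "AE x in lborel. x \<in> {0..2 * pi} \<longrightarrow> f x = g x"
    by (simp add: torus_eq_def)
  have "AE x in lborel. (x \<in> {0..2 * pi} \<longrightarrow> f x \<in> \<real>) \<longleftrightarrow> (x \<in> {0..2 * pi} \<longrightarrow> g x \<in> \<real>)"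
    using eq by eventually_elim auto
  then show "(AE x in lborel. x \<in> {0..2 * pi} \<longrightarrow> f x \<in> \<real>)
      \<longleftrightarrow> (AE x in lborel. x \<in> {0..2 * pi} \<longrightarrow> g x \<in> \<real>)"
    by (rule eventually_subst)
qed

definition fourier :: "torus_L2 \<Rightarrow> int \<Rightarrow> complex" where
  "fourier f n = L2_cinner f (L2_exp n)"

text \<open>The series below are unconditional sums in the L2 norm.  The series defining the
  derivative converges exactly for functions in the Sobolev space of order 1.\<close>

definition szego :: "torus_L2 \<Rightarrow> torus_L2" where
  "szego f = (\<Sum>\<^sub>\<infinity>n\<in>{0..}. L2_scale (fourier f n) (L2_exp n))"

definition L2_deriv :: "torus_L2 \<Rightarrow> torus_L2" where
  "L2_deriv f = (\<Sum>\<^sub>\<infinity>n\<in>UNIV. L2_scale (\<i> * of_int n * fourier f n) (L2_exp n))"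

definition L2_antideriv :: "torus_L2 \<Rightarrow> torus_L2" where
  "L2_antideriv f = (\<Sum>\<^sub>\<infinity>n\<in>-{0}. L2_scale (1 / (\<i> * of_int n) * fourier f n) (L2_exp n))"

definition sobolev :: "real \<Rightarrow> torus_L2 set" where
  "sobolev s = {f. (\<lambda>n. (1 + (real_of_int n)\<^sup>2) powr s * (cmod (fourier f n))\<^sup>2) summable_on UNIV}"

definition sobolev_norm :: "real \<Rightarrow> torus_L2 \<Rightarrow> real" where
  "sobolev_norm s f =
     sqrt (\<Sum>\<^sub>\<infinity>n\<in>UNIV. (1 + (real_of_int n)\<^sup>2) powr s * (cmod (fourier f n))\<^sup>2)"

text \<open>Note that L2_exp 0 is the constant function 1.\<close>

definition sobolev_r0 :: "real \<Rightarrow> torus_L2 set" where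
  "sobolev_r0 s = {v \<in> sobolev s. L2_real_valued v \<and> L2_cinner v (L2_exp 0) = 0}"

definition sobolev_plus :: "real \<Rightarrow> torus_L2 set" where
  "sobolev_plus s = {f \<in> sobolev s. \<forall>n<0. fourier f n = 0}"

definition sobolev_plus0 :: "real \<Rightarrow> torus_L2 set" where
  "sobolev_plus0 s = {f \<in> sobolev_plus s. L2_cinner f (L2_exp 0) = 0}"

text \<open>The exponential is applied to an arbitrary representative; the lemma below shows that the
  choice is immaterial for real-valued functions.\<close>

definition L2_exp_mi :: "torus_L2 \<Rightarrow> torus_L2" where
  "L2_exp_mi f = abs_torus_L2 (\<lambda>x. exp (- \<i> * rep_torus_L2 f x))"

lemma L2_exp_mi_abs:
  assumes f: "torus_L2_fun f" and re: "AE x in lborel. x \<in> {0..2 * pi} \<longrightarrow> f x \<in> \<real>"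
  shows "torus_L2_fun (\<lambda>x. exp (- \<i> * f x))"
    and "L2_exp_mi (abs_torus_L2 f) = abs_torus_L2 (\<lambda>x. exp (- \<i> * f x))"
proof -
  have 1: "torus_L2_fun (\<lambda>x. exp (- \<i> * g x))"
    if g: "torus_L2_fun g" and r: "AE x in lborel. x \<in> {0..2 * pi} \<longrightarrow> g x \<in> \<real>" for g
  proof (rule torus_L2_fun_bounded[where B = 1])
    note [measurable] = torus_L2_fun_measurable[OF g]
    have "(\<lambda>z::complex. exp (- \<i> * z)) \<in> borel_measurable borel"
      by (intro borel_measurable_continuous_onI continuous_intros)
    from measurable_compose[OF torus_L2_fun_measurable[OF g] this]
    show "(\<lambda>x. exp (- \<i> * g x)) \<in> borel_measurable borel" .
    show "exp (- \<i> * g (x + 2 * pi)) = exp (- \<i> * g x)" for x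
      using g by (simp add: torus_L2_fun_def)
    show "AE x in lborel. x \<in> {0..2 * pi} \<longrightarrow> cmod (exp (- \<i> * g x)) \<le> 1"
      using r by eventually_elim (auto simp: complex_is_Real_iff)
  qed
  show *: "torus_L2_fun (\<lambda>x. exp (- \<i> * f x))"
    using f re by (rule 1)
  have "torus_eq f f"
    using f by (simp add: torus_eq_def)
  then have eq: "torus_eq (rep_torus_L2 (abs_torus_L2 f)) f"
    by (rule Quotient3_rep_abs[OF Quotient3_torus_L2])
  then have ae: "AE x in lborel. x \<in> {0..2 * pi} \<longrightarrow> rep_torus_L2 (abs_torus_L2 f) x = f x"
    by (simp add: torus_eq_def)
  have "AE x in lborel. x \<in> {0..2 * pi} \<longrightarrow> rep_torus_L2 (abs_torus_L2 f) x \<in> \<real>"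
    using ae re by eventually_elim auto
  then have "torus_L2_fun (\<lambda>x. exp (- \<i> * rep_torus_L2 (abs_torus_L2 f) x))"
    using eq by (intro 1) (simp_all add: torus_eq_def)
  moreover have "AE x in lborel. x \<in> {0..2 * pi} \<longrightarrow>
      exp (- \<i> * rep_torus_L2 (abs_torus_L2 f) x) = exp (- \<i> * f x)"
    using ae by eventually_elim auto
  ultimately show "L2_exp_mi (abs_torus_L2 f) = abs_torus_L2 (\<lambda>x. exp (- \<i> * f x))"
    unfolding L2_exp_mi_def using *
    by (intro Quotient3_rel_abs[OF Quotient3_torus_L2]) (simp add: torus_eq_def)
qed

definition tao_gauge :: "torus_L2 \<Rightarrow> torus_L2" where
  "tao_gauge u = L2_deriv (szego (L2_exp_mi (L2_antideriv u)))"

text \<open>The Sobolev spaces are linear subspaces of one fixed type, each with its own norm depending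
  on the real parameter s.  So the notions below take a real normed space to be given by a
  subspace E together with a norm function N on E.\<close>

definition norm_topology :: "'a::real_vector set \<Rightarrow> ('a \<Rightarrow> real) \<Rightarrow> 'a topology" where
  "norm_topology E N = Metric_space.mtopology E (\<lambda>x y. N (x - y))"

text \<open>A function A of k arguments in E is represented as a function of a sequence of which only
  the first k entries matter.  The number C bounds its operator norm.\<close>

definition bounded_symmetric_multilinear ::
  "'a::real_vector set \<Rightarrow> ('a \<Rightarrow> real) \<Rightarrow> 'b::real_vector set \<Rightarrow> ('b \<Rightarrow> real) \<Rightarrow>
   nat \<Rightarrow> ((nat \<Rightarrow> 'a) \<Rightarrow> 'b) \<Rightarrow> real \<Rightarrow> bool" where
  "bounded_symmetric_multilinear E NE F NF k A C \<longleftrightarrow>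
     (\<forall>h h'. (\<forall>i<k. h i = h' i) \<longrightarrow> A h = A h') \<and>
     (\<forall>h. (\<forall>i<k. h i \<in> E) \<longrightarrow> A h \<in> F \<and> NF (A h) \<le> C * (\<Prod>i<k. NE (h i))) \<and>
     (\<forall>h i x y a b. (\<forall>j<k. h j \<in> E) \<and> i < k \<and> x \<in> E \<and> y \<in> E \<longrightarrow>
        A (h(i := a *\<^sub>R x + b *\<^sub>R y)) = a *\<^sub>R A (h(i := x)) + b *\<^sub>R A (h(i := y))) \<and>
     (\<forall>h p. (\<forall>i<k. h i \<in> E) \<and> p permutes {..<k} \<longrightarrow> A (h \<circ> p) = A h)"

definition real_analytic_map ::
  "'a::real_vector set \<Rightarrow> ('a \<Rightarrow> real) \<Rightarrow> 'b::real_vector set \<Rightarrow> ('b \<Rightarrow> real) \<Rightarrow>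
   'a set \<Rightarrow> ('a \<Rightarrow> 'b) \<Rightarrow> bool" where
  "real_analytic_map E NE F NF U f \<longleftrightarrow>
     openin (norm_topology E NE) U \<and> f ` U \<subseteq> F \<and>
     (\<forall>u\<in>U. \<exists>A C. \<exists>r>0.
        (\<forall>k. 0 \<le> C k \<and> bounded_symmetric_multilinear E NE F NF k (A k) (C k)) \<and>
        summable (\<lambda>k. C k * r ^ k) \<and>
        (\<forall>h\<in>E. NE h < r \<longrightarrow> u + h \<in> U \<and>
           (\<lambda>m. NF (f (u + h) - (\<Sum>k<m. A k (\<lambda>_. h)))) \<longlonglongrightarrow> 0))"

definition real_analytic_diffeo ::
  "'a::real_vector set \<Rightarrow> ('a \<Rightarrow> real) \<Rightarrow> 'b::real_vector set \<Rightarrow> ('b \<Rightarrow> real) \<Rightarrow>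
   'a set \<Rightarrow> 'b set \<Rightarrow> ('a \<Rightarrow> 'b) \<Rightarrow> bool" where
  "real_analytic_diffeo E NE F NF U V f \<longleftrightarrow>
     bij_betw f U V \<and> real_analytic_map E NE F NF U f \<and>
     real_analytic_map F NF E NE V (inv_into U f)"

definition has_differential_at ::
  "'a::real_vector set \<Rightarrow> ('a \<Rightarrow> real) \<Rightarrow> 'b::real_vector set \<Rightarrow> ('b \<Rightarrow> real) \<Rightarrow>
   ('a \<Rightarrow> 'b) \<Rightarrow> ('a \<Rightarrow> 'b) \<Rightarrow> 'a \<Rightarrow> bool" where
  "has_differential_at E NE F NF f L u \<longleftrightarrow>
     L ` E \<subseteq> F \<and>
     (\<forall>x\<in>E. \<forall>y\<in>E. \<forall>a b. L (a *\<^sub>R x + b *\<^sub>R y) = a *\<^sub>R L x + b *\<^sub>R L y) \<and>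
     (\<exists>C. \<forall>x\<in>E. NF (L x) \<le> C * NE x) \<and>
     (\<forall>\<epsilon>>0. \<exists>\<delta>>0. \<forall>h\<in>E. NE h < \<delta> \<longrightarrow> NF (f (u + h) - f u - L h) \<le> \<epsilon> * NE h)"

end

theory Submission
  imports Defs
begin

text \<open>Differentiation is an isomorphism from the mean-zero functions in
  \<open>H\<^sup>s\<^sup>+\<^sup>1\<close> onto those in \<open>H\<^sup>s\<close>.  With \<open>U\<close> the mean-zero primitive of \<open>u\<close>, the theorem is
  therefore a statement about the map \<open>U \<mapsto> P (exp (- \<i> U))\<close> on the commutative Banach algebra
  \<open>H\<^sup>s\<^sup>+\<^sup>1\<close>, where \<open>P\<close> keeps the frequencies \<open>n > 0\<close>.

  The key point is that this map is inverted by solving a \<^emph>\<open>linear\<close> equation.  Write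
  \<open>U = F + cnj F\<close> with \<open>F = P U\<close> and put \<open>h = exp (- \<i> F)\<close>.  Then \<open>exp (- \<i> U) = h / cnj h\<close>, and
  \<open>h\<close> has only frequencies \<open>n \<ge> 0\<close> and mean 1.  Multiplying \<open>v = P (exp (- \<i> U))\<close> by \<open>cnj h\<close> and
  projecting shows that \<open>f = h - 1\<close> solves \<open>f - K f = v\<close> for the antilinear Hankel operator
  \<open>K f = P (v * cnj f)\<close> (\<open>gauge_equation\<close>); conversely a solution of the form
  \<open>exp (- \<i> F) - 1\<close> gives back \<open>v\<close> (\<open>gauge_of_equation\<close>).

  For \<open>v\<close> in the range, \<open>1 - K\<close> has an explicit inverse on the functions with positive
  frequencies.  With \<open>f = h * a\<close> the equation \<open>f - K f = g\<close> becomes \<open>P (h * b) = g\<close> for the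
  imaginary mean-zero function \<open>b = a - cnj a\<close>, that is, \<open>h * b = g + cnj q\<close> where \<open>q\<close> has only
  frequencies \<open>n \<ge> 0\<close>.  That \<open>b\<close> is imaginary means \<open>Re (q * h) = - Re (g * cnj h)\<close>, and a function
  with frequencies \<open>n \<ge> 0\<close> is determined by its real part up to an imaginary constant.  The constant
  is fixed by the mean of \<open>b\<close>, because the mean of \<open>1 / |h|\<^sup>2\<close> does not vanish
  (\<open>hankel_resolvent\<close>, \<open>hankel_fixed_point\<close>).  Uniqueness for this equation gives injectivity
  (\<open>gauge_inj\<close>).  Near a point \<open>v\<^sub>0\<close> of the range a Neumann series solves the equation with
  analytic dependence on \<open>v\<close>, and the logarithm series recovers \<open>F\<close> from \<open>1 + f\<close>, so the range is
  open and the inverse is analytic (\<open>gauge_local_inverse\<close>).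

  The functions \<open>\<i> n exp (\<i> n x)\<close> are excluded as follows.  If \<open>P (exp (- \<i> U)) = exp (\<i> n x)\<close>, both
  sides have \<open>L\<^sup>2\<close> norm 1 and \<open>exp (- \<i> U)\<close> is unimodular, so the projection discards nothing and
  \<open>exp (- \<i> U) = exp (\<i> n x)\<close> (\<open>gauge_unimodular\<close>).  Then \<open>U + n x\<close> is constant, which contradicts the
  periodicity of \<open>U\<close>.

  Two foundations carry this.  On the side of Fourier analysis, the space \<open>torus_L2\<close> is complete
  and its elements are determined by their Fourier coefficients; hence it is isometric to the
  square-summable sequences, and through a weight it models every Sobolev space at once.  On the side
  of analyticity, maps given by absolutely majorized series of bounded multilinear maps (\<open>ps_on\<close>)
  are closed under bounded linear and bilinear maps and under infinite sums, which covers the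
  exponential, the logarithm and the Neumann series.\<close>

no_notation Infinite_Set_Sum.abs_summable_on (infix "abs'_summable'_on" 50)

section \<open>Completeness of the space of square-integrable functions\<close>

lemma torus_L2_fun_rep: "torus_L2_fun (rep_torus_L2 f)"
  using Quotient3_rep_reflp[OF Quotient3_torus_L2, of f] by (simp add: torus_eq_def)

lemma abs_rep_torus_L2: "abs_torus_L2 (rep_torus_L2 f) = f"
  by (rule Quotient3_abs_rep[OF Quotient3_torus_L2])

lemma torus_eq_refl_iff: "torus_eq f f \<longleftrightarrow> torus_L2_fun f"
  by (auto simp: torus_eq_def)

lemma abs_torus_L2_eqI:
  assumes "torus_L2_fun f" "torus_L2_fun g" "AE x in lborel. x \<in> {0..2 * pi} \<longrightarrow> f x = g x"
  shows "abs_torus_L2 f = abs_torus_L2 g"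
  by (rule Quotient3_rel_abs[OF Quotient3_torus_L2]) (use assms in \<open>simp add: torus_eq_def\<close>)

lemma abs_torus_L2_add:
  "torus_L2_fun f \<Longrightarrow> torus_L2_fun g \<Longrightarrow>
     abs_torus_L2 f + abs_torus_L2 g = abs_torus_L2 (\<lambda>x. f x + g x)"
  by (simp add: plus_torus_L2.abs_eq torus_eq_refl_iff)

lemma abs_torus_L2_scale:
  "torus_L2_fun f \<Longrightarrow> L2_scale c (abs_torus_L2 f) = abs_torus_L2 (\<lambda>x. c * f x)"
  by (simp add: L2_scale.abs_eq torus_eq_refl_iff)

lemma torus_L2_fun_diff:
  assumes "torus_L2_fun f" "torus_L2_fun g"
  shows "torus_L2_fun (\<lambda>x. f x - g x)"
  using torus_L2_fun_add[OF assms(1) torus_L2_fun_scale[OF assms(2), of "-1"]] by simp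

lemma abs_torus_L2_diff:
  assumes "torus_L2_fun f" "torus_L2_fun g"
  shows "abs_torus_L2 f - abs_torus_L2 g = abs_torus_L2 (\<lambda>x. f x - g x)"
  using assms torus_L2_fun_scale[OF assms(2), of "-1"]
  by (simp add: minus_torus_L2_def abs_torus_L2_scale abs_torus_L2_add)

lemma torus_inner_self:
  "torus_inner f f =
      complex_of_real (1 / (2 * pi) * (LINT x:{0..2 * pi}|lborel. (cmod (f x))\<^sup>2))"
  unfolding torus_inner_def set_lebesgue_integral_def of_real_mult integral_complex_of_real[symmetric]
  by (intro arg_cong[where f = "\<lambda>z. _ * z"] Bochner_Integration.integral_cong)
     (auto simp: scaleR_conv_of_real complex_norm_square[symmetric])

lemma norm_abs_torus_L2_square:
  assumes "torus_L2_fun f"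
  shows "(norm (abs_torus_L2 f))\<^sup>2 = 1 / (2 * pi) * (LINT x:{0..2 * pi}|lborel. (cmod (f x))\<^sup>2)"
proof -
  have "(norm (abs_torus_L2 f))\<^sup>2 = inner (abs_torus_L2 f) (abs_torus_L2 f)"
    by (simp add: power2_norm_eq_inner)
  also have "\<dots> = Re (torus_inner f f)"
    using assms by (simp add: inner_torus_L2_def L2_cinner.abs_eq torus_eq_refl_iff)
  finally show ?thesis by (simp add: torus_inner_self)
qed

lemma nn_integral_torus_L2:
  assumes "torus_L2_fun f"
  shows "(\<integral>\<^sup>+x. ennreal ((cmod (f x))\<^sup>2) * indicator {0..2 * pi} x \<partial>lborel)
     = ennreal (2 * pi * (norm (abs_torus_L2 f))\<^sup>2)"
proof -
  have i: "integrable lborel (\<lambda>x. indicator {0..2 * pi} x *\<^sub>R (cmod (f x))\<^sup>2)"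
    using assms by (simp add: torus_L2_fun_def set_integrable_def)
  have "(\<integral>\<^sup>+x. ennreal ((cmod (f x))\<^sup>2) * indicator {0..2 * pi} x \<partial>lborel)
    = (\<integral>\<^sup>+x. ennreal (indicator {0..2 * pi} x *\<^sub>R (cmod (f x))\<^sup>2) \<partial>lborel)"
    by (intro nn_integral_cong) (auto simp: indicator_def)
  also have "\<dots> = ennreal (LINT x|lborel. indicator {0..2 * pi} x *\<^sub>R (cmod (f x))\<^sup>2)"
    by (rule nn_integral_eq_integral[OF i]) auto
  finally show ?thesis
    using assms by (simp add: norm_abs_torus_L2_square set_lebesgue_integral_def)
qed

lemma torus_L2_fun_nnI:
  assumes [measurable]: "f \<in> borel_measurable borel" and "\<And>x. f (x + 2 * pi) = f x"
    and "(\<integral>\<^sup>+x. ennreal ((cmod (f x))\<^sup>2) * indicator {0..2 * pi} x \<partial>lborel) < \<infinity>"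
  shows "torus_L2_fun f"
  unfolding torus_L2_fun_def
proof (intro conjI allI assms(1,2))
  have "integrable lborel (\<lambda>x. indicator {0..2 * pi} x *\<^sub>R (cmod (f x))\<^sup>2)"
  proof (rule integrableI_nonneg)
    have "(\<integral>\<^sup>+x. ennreal (indicator {0..2 * pi} x *\<^sub>R (cmod (f x))\<^sup>2) \<partial>lborel)
      = (\<integral>\<^sup>+x. ennreal ((cmod (f x))\<^sup>2) * indicator {0..2 * pi} x \<partial>lborel)"
      by (intro nn_integral_cong) (auto simp: indicator_def)
    with assms(3) show "(\<integral>\<^sup>+x. ennreal (indicator {0..2 * pi} x *\<^sub>R (cmod (f x))\<^sup>2) \<partial>lborel) < \<infinity>"
      by simp
  qed auto
  then show "set_integrable lborel {0..2 * pi} (\<lambda>x. (cmod (f x))\<^sup>2)"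
    by (simp add: set_integrable_def)
qed

text \<open>Geometric decay in the mean square gives a finite integral of the pointwise sum, because
  \<open>d \<le> 2\<^sup>-\<^sup>k + 2\<^sup>k d\<^sup>2\<close> trades the square for another geometric factor.\<close>

lemma AE_torus_summable:
  fixes d :: "nat \<Rightarrow> real \<Rightarrow> real"
  assumes [measurable]: "\<And>k. d k \<in> borel_measurable borel" and nn: "\<And>k x. 0 \<le> d k x"
    and b: "\<And>k. (\<integral>\<^sup>+x. ennreal ((d k x)\<^sup>2) * indicator {0..2 * pi} x \<partial>lborel) \<le> ennreal (C * (1/4)^k)"
    and C: "0 \<le> C"
  shows "AE x in lborel. x \<in> {0..2 * pi} \<longrightarrow> summable (\<lambda>k. d k x)"
proof -
  let ?I = "indicator {0..2 * pi} :: real \<Rightarrow> ennreal"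
  have one: "(\<integral>\<^sup>+x. ennreal (d k x) * ?I x \<partial>lborel) \<le> ennreal ((2 * pi + C) * (1/2)^k)" for k
  proof -
    have "d k x \<le> (1/2)^k + 2^k * (d k x)\<^sup>2" for x
    proof -
      have "0 \<le> (1/2)^k * (2^k * d k x - 1/2)\<^sup>2" by simp
      also have "\<dots> = 2^k * (d k x)\<^sup>2 - d k x + (1/2)^k / 4"
        by (simp add: power2_eq_square field_simps power_one_over)
      finally have "0 \<le> 2^k * (d k x)\<^sup>2 - d k x + (1/2)^k / 4" .
      moreover have "0 \<le> (1/2::real)^k" by simp
      ultimately show ?thesis by linarith
    qed
    then have "(\<integral>\<^sup>+x. ennreal (d k x) * ?I x \<partial>lborel)
      \<le> (\<integral>\<^sup>+x. ennreal ((1/2)^k) * ?I x + ennreal (2^k) * (ennreal ((d k x)\<^sup>2) * ?I x) \<partial>lborel)"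
      by (intro nn_integral_mono) (auto simp: indicator_def ennreal_mult[symmetric] ennreal_plus[symmetric] simp del: ennreal_plus)
    also have "\<dots> = ennreal ((1/2)^k) * ennreal (2 * pi) + ennreal (2^k) * (\<integral>\<^sup>+x. ennreal ((d k x)\<^sup>2) * ?I x \<partial>lborel)"
      by (subst nn_integral_add, measurable) (simp add: nn_integral_cmult)
    also have "\<dots> \<le> ennreal ((1/2)^k) * ennreal (2 * pi) + ennreal (2^k) * ennreal (C * (1/4)^k)"
      by (intro add_left_mono mult_left_mono b) auto
    also have "\<dots> = ennreal ((2 * pi + C) * (1/2)^k)"
    proof -
      have "(2::real)^k * (1/4)^k = (1/2)^k"
        by (simp add: power_mult_distrib[symmetric])
      then have "(1/2)^k * (2 * pi) + 2^k * (C * (1/4)^k) = (2 * pi + C) * (1/2)^k"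
        by (simp add: algebra_simps)
      then show ?thesis
        using C by (simp add: ennreal_mult[symmetric] ennreal_plus[symmetric] del: ennreal_plus)
    qed
    finally show ?thesis .
  qed
  have "(\<integral>\<^sup>+x. (\<Sum>k. ennreal (d k x) * ?I x) \<partial>lborel) = (\<Sum>k. \<integral>\<^sup>+x. ennreal (d k x) * ?I x \<partial>lborel)"
    by (rule nn_integral_suminf) measurable
  also have "\<dots> \<le> (\<Sum>k. ennreal ((2 * pi + C) * (1/2)^k))"
    by (intro suminf_le one) auto
  also have "\<dots> = ennreal (\<Sum>k. (2 * pi + C) * (1/2)^k)"
    using C by (intro suminf_ennreal2 summable_mult summable_geometric) auto
  also have "\<dots> < \<infinity>" by simp
  finally have "AE x in lborel. (\<Sum>k. ennreal (d k x) * ?I x) \<noteq> \<infinity>"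
    by (intro nn_integral_PInf_AE) auto
  then show ?thesis
  proof eventually_elim
    case (elim x)
    show ?case
    proof
      assume "x \<in> {0..2 * pi}"
      with elim have "(\<Sum>k. ennreal (d k x)) \<noteq> top" by auto
      then show "summable (\<lambda>k. d k x)"
        using nn by (intro summable_suminf_not_top) auto
    qed
  qed
qed

text \<open>The argument of Riesz and Fischer: a rapidly convergent subsequence converges almost
  everywhere, and Fatou's lemma turns the pointwise limit into a limit in the norm.\<close>

lemma torus_L2_Cauchy_convergent:
  fixes X :: "nat \<Rightarrow> torus_L2"
  assumes X: "Cauchy X"
  shows "convergent X"
proof -
  let ?I = "indicator {0..2 * pi} :: real \<Rightarrow> ennreal"
  have "\<forall>k. \<exists>N. \<forall>m\<ge>N. \<forall>n\<ge>N. norm (X m - X n) < (1/2)^k"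
    using X unfolding Cauchy_iff by (metis half_gt_zero_iff zero_less_one zero_less_power)
  then obtain N where N: "\<And>k m n. m \<ge> N k \<Longrightarrow> n \<ge> N k \<Longrightarrow> norm (X m - X n) < (1/2)^k"
    by metis
  define s where "s k = (\<Sum>j\<le>k. N j)" for k
  have sN: "s m \<ge> N k" if "m \<ge> k" for k m
    unfolding s_def using that by (intro member_le_sum) auto
  define f where "f k = rep_torus_L2 (X (s k))" for k
  have f: "torus_L2_fun (f k)" for k
    unfolding f_def by (rule torus_L2_fun_rep)
  have fm [measurable]: "f k \<in> borel_measurable borel" for k
    by (rule torus_L2_fun_measurable[OF f])
  have absf: "abs_torus_L2 (f k) = X (s k)" for k
    unfolding f_def by (rule abs_rep_torus_L2)
  have fd: "(\<integral>\<^sup>+x. ennreal ((cmod (f m x - f k x))\<^sup>2) * ?I x \<partial>lborel) \<le> ennreal (2 * pi * (1/4)^k)"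
    if "m \<ge> k" for m k
  proof -
    have "(norm (X (s m) - X (s k)))\<^sup>2 \<le> ((1/2)^k)\<^sup>2"
      using less_imp_le[OF N[OF sN[OF that] sN[OF order_refl]]] by (intro power_mono) auto
    also have "((1/2::real)^k)\<^sup>2 = (1/4)^k"
      by (simp add: power2_eq_square power_mult_distrib[symmetric])
    finally show ?thesis
      using nn_integral_torus_L2[OF torus_L2_fun_diff[OF f f], of m k] 
      by (simp add: abs_torus_L2_diff[OF f f, symmetric] absf ennreal_leI)
  qed
  have "AE x in lborel. x \<in> {0..2 * pi} \<longrightarrow> summable (\<lambda>k. cmod (f (Suc k) x - f k x))"
  proof (rule AE_torus_summable)
    show "(\<integral>\<^sup>+x. ennreal ((cmod (f (Suc k) x - f k x))\<^sup>2) * ?I x \<partial>lborel) \<le> ennreal (2 * pi * (1/4)^k)" for k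
      by (rule fd) simp
    show "(\<lambda>x. cmod (f (Suc k) x - f k x)) \<in> borel_measurable borel" for k
      using fm[of k] fm[of "Suc k"] by measurable
  qed simp_all
  then have conv: "AE x in lborel. x \<in> {0..2 * pi} \<longrightarrow> (\<lambda>k. f k x) \<longlonglongrightarrow> lim (\<lambda>k. f k x)"
  proof (rule AE_mp, intro AE_I2 impI)
    fix x assume "x \<in> {0..2 * pi} \<longrightarrow> summable (\<lambda>k. cmod (f (Suc k) x - f k x))" "x \<in> {0..2 * pi}"
    then have "summable (\<lambda>k. f (Suc k) x - f k x)"
      by (metis summable_norm_cancel)
    then have "(\<lambda>n. \<Sum>k<n. f (Suc k) x - f k x) \<longlonglongrightarrow> (\<Sum>k. f (Suc k) x - f k x)"
      by (rule summable_LIMSEQ)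
    then have "(\<lambda>n. (\<Sum>k<n. f (Suc k) x - f k x) + f 0 x) \<longlonglongrightarrow> (\<Sum>k. f (Suc k) x - f k x) + f 0 x"
      by (intro tendsto_add tendsto_const)
    then have "(\<lambda>n. f n x) \<longlonglongrightarrow> (\<Sum>k. f (Suc k) x - f k x) + f 0 x"
      by (subst (asm) sum_lessThan_telescope) simp
    then have "convergent (\<lambda>n. f n x)" by (rule convergentI)
    then show "(\<lambda>k. f k x) \<longlonglongrightarrow> lim (\<lambda>k. f k x)"
      by (simp only: convergent_LIMSEQ_iff)
  qed
  \<comment> \<open>The pointwise limit is periodic everywhere, not just almost everywhere, since \<open>lim\<close> is total.\<close>
  define g where "g x = lim (\<lambda>k. f k x)" for x
  have [measurable]: "g \<in> borel_measurable borel"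
    unfolding g_def by measurable
  have per: "g (x + 2 * pi) = g x" for x
    unfolding g_def using f by (simp add: torus_L2_fun_def)
  have gk: "(\<integral>\<^sup>+x. ennreal ((cmod (g x - f k x))\<^sup>2) * ?I x \<partial>lborel) \<le> ennreal (2 * pi * (1/4)^k)" for k
  proof -
    have "(\<integral>\<^sup>+x. ennreal ((cmod (g x - f k x))\<^sup>2) * ?I x \<partial>lborel)
      = (\<integral>\<^sup>+x. liminf (\<lambda>m. ennreal ((cmod (f m x - f k x))\<^sup>2) * ?I x) \<partial>lborel)"
    proof (rule nn_integral_cong_AE)
      show "AE x in lborel. ennreal ((cmod (g x - f k x))\<^sup>2) * ?I x
          = liminf (\<lambda>m. ennreal ((cmod (f m x - f k x))\<^sup>2) * ?I x)"
        using conv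
      proof eventually_elim
        case (elim x)
        show ?case
        proof (cases "x \<in> {0..2 * pi}")
          case True
          with elim have "(\<lambda>m. f m x) \<longlonglongrightarrow> g x" by (simp add: g_def)
          then have "(\<lambda>m. ennreal ((cmod (f m x - f k x))\<^sup>2)) \<longlonglongrightarrow> ennreal ((cmod (g x - f k x))\<^sup>2)"
            by (intro tendsto_intros)
          from lim_imp_Liminf[OF _ this] True show ?thesis by simp
        qed (simp add: Liminf_const)
      qed
    qed
    also have "\<dots> \<le> liminf (\<lambda>m. \<integral>\<^sup>+x. ennreal ((cmod (f m x - f k x))\<^sup>2) * ?I x \<partial>lborel)"
      by (rule nn_integral_liminf) measurable
    also have "\<dots> \<le> liminf (\<lambda>m. ennreal (2 * pi * (1/4)^k))"
      by (rule Liminf_mono) (auto simp: eventually_sequentially intro!: exI[of _ k] fd)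
    finally show ?thesis by (simp add: Liminf_const)
  qed
  have gf: "torus_L2_fun (\<lambda>x. g x - f k x)" for k
  proof (rule torus_L2_fun_nnI)
    show "(\<integral>\<^sup>+x. ennreal ((cmod (g x - f k x))\<^sup>2) * ?I x \<partial>lborel) < \<infinity>"
      using gk[of k] by (simp add: order_le_less_trans)
  qed (use f in \<open>auto simp: per torus_L2_fun_def\<close>)
  have g: "torus_L2_fun g"
    using torus_L2_fun_add[OF gf[of 0] f[of 0]] by simp
  have lim: "norm (abs_torus_L2 g - X (s k)) \<le> (1/2)^k" for k
  proof -
    have "ennreal (2 * pi * (norm (abs_torus_L2 g - X (s k)))\<^sup>2) \<le> ennreal (2 * pi * (1/4)^k)"
      using gk[of k] nn_integral_torus_L2[OF gf[of k]] by (simp add: abs_torus_L2_diff[OF g f, symmetric] absf)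
    then have "(norm (abs_torus_L2 g - X (s k)))\<^sup>2 \<le> (1/4)^k"
      by (simp add: ennreal_le_iff)
    also have "(1/4)^k = ((1/2::real)^k)\<^sup>2"
      by (simp add: power2_eq_square power_mult_distrib[symmetric])
    finally show ?thesis
      by (rule power2_le_imp_le) auto
  qed
  have "X \<longlonglongrightarrow> abs_torus_L2 g"
  proof (rule LIMSEQ_I)
    fix e :: real assume "0 < e"
    then obtain k where k: "(1/2)^k < e / 2"
      using real_arch_pow_inv[of "e / 2" "1/2"] by auto
    have "norm (X n - abs_torus_L2 g) < e" if "n \<ge> s k" for n
    proof -
      have "n \<ge> N k" using that sN[of k k] by simp
      then have "norm (X n - X (s k)) < (1/2)^k"
        by (intro N) (auto simp: sN)
      moreover have "norm (X n - abs_torus_L2 g) = norm ((X n - X (s k)) - (abs_torus_L2 g - X (s k)))"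
        by simp
      ultimately show ?thesis
        using norm_triangle_ineq4[of "X n - X (s k)" "abs_torus_L2 g - X (s k)"] lim[of k] k by linarith
    qed
    then show "\<exists>no. \<forall>n\<ge>no. norm (X n - abs_torus_L2 g) < e" by blast
  qed
  then show ?thesis by (rule convergentI)
qed

instance torus_L2 :: banach
  by standard (rule torus_L2_Cauchy_convergent)

section \<open>Uniqueness of Fourier coefficients\<close>

text \<open>The class of integrable functions without Fourier coefficients.  It is stable under
  multiplication by trigonometric polynomials, hence by restrictions of polynomials to the circle;
  density of the latter forces its elements to vanish.\<close>

definition trig_null :: "(real \<Rightarrow> complex) \<Rightarrow> bool" where
  "trig_null \<phi> \<longleftrightarrow> integrable lborel \<phi> \<and> (\<forall>k::int. (LINT x|lborel. \<phi> x * cis (of_int k * x)) = 0)"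

lemma borel_measurable_cis [measurable]: "(\<lambda>x. cis (c * x)) \<in> borel_measurable borel"
  by (intro borel_measurable_continuous_onI continuous_intros)

lemma integrable_mult_bounded:
  fixes \<phi> g :: "real \<Rightarrow> complex"
  assumes "integrable lborel \<phi>" "g \<in> borel_measurable borel" "\<And>x. cmod (g x) \<le> B"
  shows "integrable lborel (\<lambda>x. \<phi> x * g x)"
proof (rule Bochner_Integration.integrable_bound)
  show "integrable lborel (\<lambda>x. of_real B * \<phi> x)"
    using assms(1) by simp
  show "AE x in lborel. norm (\<phi> x * g x) \<le> norm (of_real B * \<phi> x)"
  proof (rule AE_I2)
    fix x
    have "cmod (g x) \<le> \<bar>B\<bar>" using assms(3)[of x] by linarith
    then show "norm (\<phi> x * g x) \<le> norm (of_real B * \<phi> x)"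
      using mult_right_mono[of "cmod (g x)" "\<bar>B\<bar>" "cmod (\<phi> x)"] by (simp add: norm_mult mult.commute)
  qed
qed (use assms in \<open>auto intro!: borel_measurable_times borel_measurable_integrable\<close>)

lemma trig_null_cis:
  assumes "trig_null \<phi>" shows "trig_null (\<lambda>x. cis (of_int m * x) * \<phi> x)"
  unfolding trig_null_def
proof (intro conjI allI)
  have i: "integrable lborel \<phi>" using assms by (simp add: trig_null_def)
  then show "integrable lborel (\<lambda>x. cis (of_int m * x) * \<phi> x)"
    using integrable_mult_bounded[OF i borel_measurable_cis, of "of_int m" 1]
    by (simp add: mult.commute)
  fix k :: int
  have "(LINT x|lborel. cis (of_int m * x) * \<phi> x * cis (of_int k * x))
    = (LINT x|lborel. \<phi> x * cis (of_int (m + k) * x))"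
    by (intro Bochner_Integration.integral_cong) (auto simp: cis_mult[symmetric] distrib_right)
  also have "\<dots> = 0"
    using assms unfolding trig_null_def by blast
  finally show "(LINT x|lborel. cis (of_int m * x) * \<phi> x * cis (of_int k * x)) = 0" .
qed

lemma trig_null_add:
  assumes "trig_null \<phi>" "trig_null \<psi>" shows "trig_null (\<lambda>x. \<phi> x + \<psi> x)"
  unfolding trig_null_def
proof (intro conjI allI)
  have i: "integrable lborel \<phi>" "integrable lborel \<psi>" using assms by (simp_all add: trig_null_def)
  then show "integrable lborel (\<lambda>x. \<phi> x + \<psi> x)" by simp
  fix k :: int
  have "integrable lborel (\<lambda>x. \<phi> x * cis (of_int k * x))" "integrable lborel (\<lambda>x. \<psi> x * cis (of_int k * x))"
    by (auto intro!: integrable_mult_bounded[where B = 1] i)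
  then show "(LINT x|lborel. (\<phi> x + \<psi> x) * cis (of_int k * x)) = 0"
    using assms by (simp add: trig_null_def distrib_right)
qed

lemma trig_null_cmult:
  assumes "trig_null \<phi>" shows "trig_null (\<lambda>x. c * \<phi> x)"
  using assms by (auto simp: trig_null_def mult.assoc)

lemma trig_null_polynomial:
  assumes "real_polynomial_function p" "trig_null \<phi>"
  shows "trig_null (\<lambda>x. of_real (p (cis x)) * \<phi> x)"
  using assms
proof (induction arbitrary: \<phi>)
  case (linear f)
  define \<alpha> \<beta> where "\<alpha> = (of_real (f 1) - \<i> * of_real (f \<i>)) / 2" and "\<beta> = (of_real (f 1) + \<i> * of_real (f \<i>)) / 2"
  have eq: "of_real (f (cis x)) = \<alpha> * cis x + \<beta> * cis (- x)" for x
  proof -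
    interpret f: bounded_linear f by (rule linear)
    have "cis x = cos x *\<^sub>R 1 + sin x *\<^sub>R \<i>"
      by (simp add: complex_eq_iff)
    then have "f (cis x) = cos x * f 1 + sin x * f \<i>"
      by (simp only: f.add f.scaleR real_scaleR_def)
    then show ?thesis
      by (simp add: \<alpha>_def \<beta>_def complex_eq_iff field_simps)
  qed
  have "trig_null (\<lambda>x. \<alpha> * (cis (of_int 1 * x) * \<phi> x) + \<beta> * (cis (of_int (-1) * x) * \<phi> x))"
    by (intro trig_null_add trig_null_cmult trig_null_cis linear)
  then show ?case
    by (simp add: eq algebra_simps)
next
  case (const c)
  then show ?case by (rule trig_null_cmult)
next
  case (add f g)
  from trig_null_add[OF add.IH(1)[OF add.prems] add.IH(2)[OF add.prems]]
  show ?case by (simp add: distrib_right)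
next
  case (mult f g)
  from mult.IH(1)[OF mult.IH(2)[OF mult.prems]]
  show ?case by (simp add: mult.assoc)
qed

lemma trig_null_continuous:
  fixes g :: "complex \<Rightarrow> real"
  assumes null: "trig_null \<phi>" and g: "continuous_on UNIV g"
  shows "(LINT x|lborel. of_real (g (cis x)) * \<phi> x) = 0"
proof -
  have i: "integrable lborel \<phi>" using null by (simp add: trig_null_def)
  have gs: "continuous_on (sphere 0 1) g"
    using g by (rule continuous_on_subset) auto
  have gm [measurable]: "(\<lambda>x. complex_of_real (g (cis x))) \<in> borel_measurable borel"
    by (intro borel_measurable_continuous_onI continuous_intros continuous_on_compose2[OF g]) auto
  have "bounded (g ` sphere 0 1)"
    by (intro compact_imp_bounded compact_continuous_image gs) auto
  then obtain B where B: "\<And>z. z \<in> sphere 0 1 \<Longrightarrow> \<bar>g z\<bar> \<le> B"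
    unfolding bounded_iff by (metis image_eqI real_norm_def)
  have ig: "integrable lborel (\<lambda>x. of_real (g (cis x)) * \<phi> x)"
    using integrable_mult_bounded[OF i gm, of B] B by (simp add: mult.commute)
  have small: "cmod (LINT x|lborel. of_real (g (cis x)) * \<phi> x) \<le> e * (LINT x|lborel. cmod (\<phi> x))"
    if e: "e > 0" for e
  proof -
    obtain p where p: "real_polynomial_function p" and pe: "\<And>z. z \<in> sphere 0 1 \<Longrightarrow> \<bar>g z - p z\<bar> < e"
      using Stone_Weierstrass_real_polynomial_function[OF compact_sphere gs e] by metis
    have n: "trig_null (\<lambda>x. of_real (p (cis x)) * \<phi> x)"
      by (rule trig_null_polynomial[OF p null])
    then have ip: "integrable lborel (\<lambda>x. of_real (p (cis x)) * \<phi> x)"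
      by (simp add: trig_null_def)
    have "(LINT x|lborel. of_real (p (cis x)) * \<phi> x * cis (of_int 0 * x)) = 0"
      using n unfolding trig_null_def by blast
    then have "(LINT x|lborel. of_real (g (cis x)) * \<phi> x)
      = (LINT x|lborel. of_real (g (cis x)) * \<phi> x - of_real (p (cis x)) * \<phi> x)"
      using ig ip by simp
    also have "cmod \<dots> \<le> (LINT x|lborel. cmod (of_real (g (cis x)) * \<phi> x - of_real (p (cis x)) * \<phi> x))"
      by (rule integral_norm_bound)
    also have "\<dots> \<le> (LINT x|lborel. e * cmod (\<phi> x))"
    proof (rule integral_mono)
      fix x
      have "cmod (of_real (g (cis x)) * \<phi> x - of_real (p (cis x)) * \<phi> x) = \<bar>g (cis x) - p (cis x)\<bar> * cmod (\<phi> x)"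
        by (simp add: left_diff_distrib[symmetric] norm_mult flip: of_real_diff)
      also have "\<dots> \<le> e * cmod (\<phi> x)"
        by (intro mult_right_mono less_imp_le[OF pe]) auto
      finally show "cmod (of_real (g (cis x)) * \<phi> x - of_real (p (cis x)) * \<phi> x) \<le> e * cmod (\<phi> x)" .
    qed (use i ig ip in auto)
    finally show ?thesis by simp
  qed
  define M where "M = (LINT x|lborel. cmod (\<phi> x))"
  have M: "M \<ge> 0" unfolding M_def by simp
  have "cmod (LINT x|lborel. of_real (g (cis x)) * \<phi> x) \<le> 0"
  proof (rule field_le_epsilon)
    fix e :: real assume "e > 0"
    then have "e / (M + 1) * M \<le> e"
      using M by (simp add: field_simps)
    then show "cmod (LINT x|lborel. of_real (g (cis x)) * \<phi> x) \<le> 0 + e"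
      using small[of "e / (M + 1)"] \<open>e > 0\<close> M by (simp add: M_def[symmetric])
  qed
  then show ?thesis by simp
qed

text \<open>The indicator of a closed set is a pointwise limit of continuous functions of the distance.\<close>

lemma trig_null_closed:
  assumes null: "trig_null \<phi>" and C: "closed C" "C \<noteq> {}"
  shows "(LINT x|lborel. indicator C (cis x) *\<^sub>R \<phi> x) = 0"
proof -
  have i: "integrable lborel \<phi>" using null by (simp add: trig_null_def)
  note [measurable] = borel_measurable_integrable[OF i]
  define g where "g k z = max 0 (1 - real k * infdist z C)" for k and z :: complex
  have gc: "continuous_on UNIV (g k)" for k
    unfolding g_def by (intro continuous_intros)
  have g1: "\<bar>g k z\<bar> \<le> 1" for k z
    unfolding g_def using infdist_nonneg[of z C] by auto
  have lim: "(\<lambda>k. g k z) \<longlonglongrightarrow> indicator C z" for z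
  proof (cases "z \<in> C")
    case True
    then show ?thesis by (simp add: g_def)
  next
    case False
    then have pos: "infdist z C > 0"
      using C by (metis in_closed_iff_infdist_zero infdist_nonneg less_eq_real_def)
    obtain N where N: "1 / infdist z C < real N" using reals_Archimedean2 by blast
    have "g k z = 0" if "k \<ge> N" for k
    proof -
      have "1 / infdist z C < real k" using N that by simp
      then have "1 < real k * infdist z C" using pos by (simp add: field_simps)
      then show ?thesis by (simp add: g_def)
    qed
    then have "eventually (\<lambda>k. g k z = indicator C z) sequentially"
      using False by (auto simp: eventually_sequentially)
    then show ?thesis by (rule tendsto_eventually)
  qed
  have [measurable]: "C \<in> sets borel" using C by simp
  have cm [measurable]: "cis \<in> borel_measurable borel"
    by (intro borel_measurable_continuous_onI continuous_intros)
  have [measurable]: "(\<lambda>x. complex_of_real (g k (cis x))) \<in> borel_measurable borel" for k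
    by (intro borel_measurable_continuous_onI continuous_intros continuous_on_compose2[OF gc]) auto
  have "(\<lambda>k. LINT x|lborel. of_real (g k (cis x)) * \<phi> x) \<longlonglongrightarrow> (LINT x|lborel. indicator C (cis x) *\<^sub>R \<phi> x)"
  proof (rule integral_dominated_convergence[where w = "\<lambda>x. cmod (\<phi> x)"])
    show "AE x in lborel. (\<lambda>k. of_real (g k (cis x)) * \<phi> x) \<longlonglongrightarrow> indicator C (cis x) *\<^sub>R \<phi> x"
      unfolding scaleR_conv_of_real by (intro AE_I2 tendsto_intros lim)
    show "AE x in lborel. norm (of_real (g k (cis x)) * \<phi> x) \<le> cmod (\<phi> x)" for k
      by (intro AE_I2) (auto simp: norm_mult intro!: mult_left_le_one_le g1)
  qed (use i in \<open>measurable; simp\<close>)+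
  moreover have "(LINT x|lborel. of_real (g k (cis x)) * \<phi> x) = 0" for k
    by (rule trig_null_continuous[OF null gc])
  ultimately show ?thesis
    using LIMSEQ_unique tendsto_const by (metis (no_types, lifting) ext)
qed

lemma cis_eq_imp_eq:
  assumes "cis x = cis y" "0 < x" "x < 2 * pi" "0 \<le> y" "y \<le> 2 * pi"
  shows "x = y"
proof -
  have "sin x = sin y \<and> cos x = cos y"
    using assms(1) by (simp add: complex_eq_iff)
  then obtain n where n: "x = y + 2 * pi * of_int n"
    using sin_cos_eq_iff by blast
  have "\<bar>of_int n\<bar> < (1::real)"
  proof (rule ccontr)
    assume "\<not> ?thesis"
    then have "2 * pi * 1 \<le> 2 * pi * \<bar>of_int n\<bar>" by (intro mult_left_mono) auto
    also have "\<dots> = \<bar>x - y\<bar>" using n by (simp add: abs_mult)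
    finally show False using assms by auto
  qed
  then show ?thesis using n by simp
qed

text \<open>On the open period interval, an interval of angles is the preimage of a closed subset of the
  circle, so all integrals over intervals vanish.\<close>

lemma trig_null_AE_zero:
  assumes null: "trig_null \<phi>" and supp: "\<And>x. x \<notin> {0<..<2 * pi} \<Longrightarrow> \<phi> x = 0"
  shows "AE x in lborel. \<phi> x = 0"
proof (rule sigma_finite_measure.density_zero[OF lborel.sigma_finite_measure_axioms])
  show i: "integrable lborel \<phi>" using null by (simp add: trig_null_def)
  have si: "set_integrable lborel A \<phi>" if "A \<in> sets borel" for A
    using i that by (simp add: set_integrable_def integrable_mult_indicator)
  have whole: "(LINT x|lborel. \<phi> x) = 0"
    using trig_null_continuous[OF null, of "\<lambda>z. 1"] by simp
  fix A :: "real set" assume "A \<in> sets lborel"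
  then have "A \<in> sets borel" by simp
  then show "(LINT x:A|lborel. \<phi> x) = 0"
  proof (induction rule: borel_set_induct)
    case empty
    then show ?case by (simp add: set_lebesgue_integral_def)
  next
    case (interval a b)
    define C where "C = cis ` ({a..b} \<inter> {0..2 * pi})"
    have eq: "indicator {a..b} x *\<^sub>R \<phi> x = indicator C (cis x) *\<^sub>R \<phi> x" for x
    proof (cases "x \<in> {0<..<2 * pi}")
      case True
      then have "cis x \<in> C \<longleftrightarrow> x \<in> {a..b}"
        unfolding C_def by (auto dest: cis_eq_imp_eq)
      then show ?thesis by (simp add: indicator_def)
    qed (simp add: supp)
    show ?case
    proof (cases "C = {}")
      case False
      have "closed C"
        unfolding C_def by (intro compact_imp_closed compact_continuous_image continuous_intros compact_Int) auto
      with trig_null_closed[OF null _ False] show ?thesis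
        by (simp add: set_lebesgue_integral_def eq)
    qed (simp add: set_lebesgue_integral_def eq)
  next
    case (compl A)
    have "indicator (- A) x *\<^sub>R \<phi> x = \<phi> x - indicator A x *\<^sub>R \<phi> x" for x
      by (simp add: indicator_def)
    then have "(LINT x:-A|lborel. \<phi> x) = (LINT x|lborel. \<phi> x) - (LINT x:A|lborel. \<phi> x)"
      using i si[OF compl.hyps] by (simp add: set_lebesgue_integral_def set_integrable_def)
    then show ?case using whole compl by simp
  next
    case (union A)
    have "(LINT x:(\<Union>i. A i)|lborel. \<phi> x) = (\<Sum>i. (LINT x:(A i)|lborel. \<phi> x))"
      using union by (intro lebesgue_integral_countable_add si) (auto simp: disjoint_family_on_def)
    then show ?case using union by simp
  qed
qed

section \<open>Fourier series in the mean square\<close>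

lemma L2_scale_scale: "L2_scale c (L2_scale d f) = L2_scale (c * d) f"
  by transfer (auto simp: torus_eq_def mult.assoc intro!: torus_L2_fun_scale)

lemma L2_scale_add_right: "L2_scale c (f + g) = L2_scale c f + L2_scale c g"
  by transfer (auto simp: torus_eq_def distrib_left intro!: torus_L2_fun_add torus_L2_fun_scale)

lemma L2_scale_of_real: "L2_scale (of_real r) f = r *\<^sub>R f"
  by (simp add: scaleR_torus_L2_def)

lemma L2_scale_zero [simp]: "L2_scale 0 f = 0"
  using L2_scale_of_real[of 0 f] by simp

lemma norm_L2_scale: "norm (L2_scale c f) = cmod c * norm f"
proof -
  have f: "torus_L2_fun (rep_torus_L2 f)" by (rule torus_L2_fun_rep)
  have "L2_scale c f = abs_torus_L2 (\<lambda>x. c * rep_torus_L2 f x)"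
    using abs_torus_L2_scale[OF f] by (simp add: abs_rep_torus_L2)
  then have "(norm (L2_scale c f))\<^sup>2 = (cmod c)\<^sup>2 * (norm (abs_torus_L2 (rep_torus_L2 f)))\<^sup>2"
    by (simp add: norm_abs_torus_L2_square f torus_L2_fun_scale norm_mult power_mult_distrib)
  then have "(norm (L2_scale c f))\<^sup>2 = (cmod c * norm f)\<^sup>2"
    by (simp add: abs_rep_torus_L2 power_mult_distrib)
  then show ?thesis by (rule power2_eq_imp_eq) auto
qed

lemma bounded_linear_L2_scale: "bounded_linear (L2_scale c)"
proof (rule bounded_linear_intro)
  show "L2_scale c (r *\<^sub>R f) = r *\<^sub>R L2_scale c f" for r f
    by (simp add: L2_scale_of_real[symmetric] L2_scale_scale mult.commute)
  show "norm (L2_scale c f) \<le> norm f * cmod c" for f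
    by (simp add: norm_L2_scale mult.commute)
qed (rule L2_scale_add_right)

lemma L2_cinner_scale_left: "L2_cinner (L2_scale c f) g = c * L2_cinner f g"
  by transfer (simp add: torus_inner_def mult.assoc)

lemma L2_cinner_scale_right: "L2_cinner f (L2_scale c g) = cnj c * L2_cinner f g"
proof transfer
  fix f g c
  have "(LINT x:{0..2 * pi}|lborel. f x * cnj (c * g x)) = (LINT x:{0..2 * pi}|lborel. cnj c * (f x * cnj (g x)))"
    by (rule arg_cong[where f = "set_lebesgue_integral lborel {0..2 * pi}"]) auto
  then show "torus_inner f (\<lambda>x. c * g x) = cnj c * torus_inner f g"
    by (simp add: torus_inner_def)
qed

lemma Re_L2_cinner: "Re (L2_cinner f g) = inner f g"
  by (simp add: inner_torus_L2_def)

lemma Im_L2_cinner: "Im (L2_cinner f g) = inner f (L2_scale \<i> g)"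
  by (simp add: inner_torus_L2_def L2_cinner_scale_right)

lemma fourier_eq_inner:
  "fourier f n = Complex (inner f (L2_exp n)) (inner f (L2_scale \<i> (L2_exp n)))"
  by (simp add: fourier_def complex_eq_iff Re_L2_cinner Im_L2_cinner)

lemma fourier_add: "fourier (f + g) n = fourier f n + fourier g n"
  by (simp add: fourier_eq_inner complex_eq_iff inner_add_left)

lemma fourier_scaleR: "fourier (r *\<^sub>R f) n = of_real r * fourier f n"
  by (simp add: fourier_eq_inner complex_eq_iff)

lemma fourier_scale: "fourier (L2_scale c f) n = c * fourier f n"
  by (simp add: fourier_def L2_cinner_scale_left)

lemma fourier_zero [simp]: "fourier 0 n = 0"
  by (simp add: fourier_eq_inner complex_eq_iff)

lemma fourier_minus: "fourier (- f) n = - fourier f n"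
  by (simp add: fourier_eq_inner complex_eq_iff)

lemma fourier_diff: "fourier (f - g) n = fourier f n - fourier g n"
  by (simp add: fourier_eq_inner complex_eq_iff inner_diff_left)

lemma fourier_sum: "fourier (\<Sum>i\<in>A. f i) n = (\<Sum>i\<in>A. fourier (f i) n)"
  by (induction A rule: infinite_finite_induct) (auto simp: fourier_add)

lemma exp_mult_over_derivative:
  fixes c :: complex
  assumes "c \<noteq> 0"
  shows "((\<lambda>z. exp (c * z) / c) has_field_derivative exp (c * x)) (at x)"
proof -
  have "((\<lambda>z. exp (c * z)) has_field_derivative exp (c * x) * (c * 1)) (at x)"
    by (rule DERIV_chain2[OF DERIV_exp DERIV_cmult[OF DERIV_ident]])
  from DERIV_cdivide[OF this, of c] show ?thesis using assms by simp
qed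

lemma integral_cis:
  "(LINT x:{0..2 * pi}|lborel. cis (of_int k * x)) = (if k = 0 then of_real (2 * pi) else 0)"
proof (cases "k = 0")
  case True
  have "(LINT x|lborel. indicator {0..2 * pi} x *\<^sub>R (1::complex)) = measure lborel {0..2 * pi} *\<^sub>R 1"
    by simp
  then show ?thesis using True by (simp add: set_lebesgue_integral_def scaleR_conv_of_real)
next
  case False
  let ?F = "\<lambda>x. cis (of_int k * x) / (\<i> * of_int k)"
  have "(LINT x|lborel. indicator {0..2 * pi} x *\<^sub>R cis (of_int k * x)) = ?F (2 * pi) - ?F 0"
  proof (rule integral_FTC_Icc)
    fix x :: real
    have "((\<lambda>z. exp (\<i> * of_int k * z) / (\<i> * of_int k)) has_field_derivative exp (\<i> * of_int k * of_real x)) (at (of_real x))"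
      using False exp_mult_over_derivative[of "\<i> * of_int k" "of_real x"] by simp
    then have "((\<lambda>x. exp (\<i> * of_int k * of_real x) / (\<i> * of_int k)) has_vector_derivative
       exp (\<i> * of_int k * of_real x)) (at x within {0..2 * pi})"
      by (rule has_vector_derivative_real_field)
    then show "(?F has_vector_derivative cis (of_int k * x)) (at x within {0..2 * pi})"
      by (simp add: cis_conv_exp mult.assoc)
  qed (auto intro!: continuous_intros)
  moreover have "cis (of_int k * (2 * pi)) = 1"
    by (metis cis_multiple_2pi Ints_of_int mult.commute)
  ultimately show ?thesis using False by (simp add: set_lebesgue_integral_def)
qed

lemma torus_L2_fun_cis: "torus_L2_fun (\<lambda>x. cis (of_int n * x))"
  using L2_exp.rsp by (auto simp: rel_fun_def torus_eq_def)

lemma L2_exp_abs: "L2_exp n = abs_torus_L2 (\<lambda>x. cis (of_int n * x))"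
  by (rule L2_exp.abs_eq)

lemma fourier_exp: "fourier (L2_exp m) n = (if m = n then 1 else 0)"
proof -
  have "fourier (L2_exp m) n = torus_inner (\<lambda>x. cis (of_int m * x)) (\<lambda>x. cis (of_int n * x))"
    by (simp add: fourier_def L2_exp_abs L2_cinner.abs_eq torus_eq_refl_iff torus_L2_fun_cis)
  also have "\<dots> = of_real (1 / (2 * pi)) * (LINT x:{0..2 * pi}|lborel. cis (of_int (m - n) * x))"
    unfolding torus_inner_def
    by (intro arg_cong[where f = "\<lambda>z. _ * z"] arg_cong[where f = "set_lebesgue_integral lborel {0..2 * pi}"] ext)
       (simp add: cis_cnj cis_mult left_diff_distrib)
  also have "\<dots> = (if m = n then 1 else 0)"
    unfolding integral_cis by simp
  finally show ?thesis .
qed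

lemma norm_L2_exp [simp]: "norm (L2_exp n) = 1"
proof -
  have "inner (L2_exp n) (L2_exp n) = Re (fourier (L2_exp n) n)"
    by (simp add: fourier_def inner_torus_L2_def)
  then show ?thesis by (simp add: fourier_exp norm_eq_sqrt_inner)
qed

lemma Re_Im_square: "Re z * Re z + Im z * Im z = (cmod z)\<^sup>2"
  unfolding cmod_power2 by (simp add: power2_eq_square)

lemma norm_fourier_le: "cmod (fourier f n) \<le> norm f"
proof -
  let ?c = "fourier f n"
  have "(cmod ?c)\<^sup>2 = Re (L2_cinner (L2_scale (cnj ?c) f) (L2_exp n))"
    by (simp only: L2_cinner_scale_left) (simp add: fourier_def[symmetric] Re_Im_square)
  also have "\<dots> \<le> norm (L2_scale (cnj ?c) f) * norm (L2_exp n)"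
    unfolding Re_L2_cinner by (rule norm_cauchy_schwarz)
  finally have "cmod ?c * cmod ?c \<le> cmod ?c * norm f"
    by (simp add: norm_L2_scale power2_eq_square)
  then show ?thesis
    by (cases "?c = 0") auto
qed

lemma bounded_linear_fourier: "bounded_linear (\<lambda>f. fourier f n)"
  by (rule bounded_linear_intro[where K = 1])
     (auto simp: fourier_add fourier_scaleR scaleR_conv_of_real norm_fourier_le)

lemma inner_scale_exp: "inner f (L2_scale c (L2_exp n)) = Re (cnj c * fourier f n)"
  by (simp add: inner_torus_L2_def L2_cinner_scale_right fourier_def)

lemma fourier_trig_sum:
  "finite F \<Longrightarrow> fourier (\<Sum>m\<in>F. L2_scale (a m) (L2_exp m)) n = (if n \<in> F then a n else 0)"
  by (simp add: fourier_sum fourier_scale fourier_exp if_distrib[where f = "\<lambda>x. _ * x"] cong: if_cong)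

lemma norm_trig_sum:
  assumes "finite F"
  shows "(norm (\<Sum>m\<in>F. L2_scale (a m) (L2_exp m)))\<^sup>2 = (\<Sum>m\<in>F. (cmod (a m))\<^sup>2)"
proof -
  let ?S = "\<Sum>m\<in>F. L2_scale (a m) (L2_exp m)"
  have "(norm ?S)\<^sup>2 = (\<Sum>m\<in>F. inner ?S (L2_scale (a m) (L2_exp m)))"
    by (simp add: power2_norm_eq_inner inner_sum_right)
  also have "\<dots> = (\<Sum>m\<in>F. (cmod (a m))\<^sup>2)"
    by (rule sum.cong) (simp_all add: inner_scale_exp fourier_trig_sum assms Re_Im_square)
  finally show ?thesis .
qed

lemma fourier_eq_zero_imp:
  assumes z: "\<And>n. fourier f n = 0"
  shows "f = 0"
proof -
  define g where "g = rep_torus_L2 f"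
  have g: "torus_L2_fun g" unfolding g_def by (rule torus_L2_fun_rep)
  have fg: "f = abs_torus_L2 g" by (simp add: g_def abs_rep_torus_L2)
  define \<phi> where "\<phi> x = indicator {0<..<2 * pi} x *\<^sub>R g x" for x
  have ae: "AE x in lborel. \<phi> x = indicator {0..2 * pi} x *\<^sub>R g x"
    using AE_lborel_singleton[of 0] AE_lborel_singleton[of "2 * pi"]
    by eventually_elim (auto simp: \<phi>_def indicator_def)
  note gm [measurable] = torus_L2_fun_measurable[OF g]
  have [measurable]: "\<phi> \<in> borel_measurable borel" unfolding \<phi>_def by measurable
  have "set_integrable lborel {0..2 * pi} (\<lambda>x. g x * cnj (cis (of_int 0 * x)))"
    by (rule torus_prod_integrable[OF g torus_L2_fun_cis])
  then have ig: "integrable lborel (\<lambda>x. indicator {0..2 * pi} x *\<^sub>R g x)"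
    by (simp add: set_integrable_def)
  have int: "integrable lborel \<phi>"
    by (subst integrable_cong_AE[OF _ _ ae]) (use ig in auto)
  have "trig_null \<phi>"
    unfolding trig_null_def
  proof (intro conjI allI int)
    fix k :: int
    have "(LINT x|lborel. \<phi> x * cis (of_int k * x)) = (LINT x:{0..2 * pi}|lborel. g x * cnj (cis (of_int (-k) * x)))"
      unfolding set_lebesgue_integral_def
    proof (rule integral_cong_AE)
      show "AE x in lborel. \<phi> x * cis (of_int k * x) = indicator {0..2 * pi} x *\<^sub>R (g x * cnj (cis (of_int (-k) * x)))"
        using ae by eventually_elim (simp add: cis_cnj)
      show "(\<lambda>x. indicator {0..2 * pi} x *\<^sub>R (g x * cnj (cis (of_int (-k) * x)))) \<in> borel_measurable lborel"
        using gm borel_measurable_cnj_comp[OF borel_measurable_cis, of "of_int (-k)"] by measurable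
    qed measurable
    also have "\<dots> = of_real (2 * pi) * torus_inner g (\<lambda>x. cis (of_int (-k) * x))"
      by (simp add: torus_inner_def)
    also have "torus_inner g (\<lambda>x. cis (of_int (-k) * x)) = fourier f (-k)"
      using L2_cinner.abs_eq[of g "\<lambda>x. cis (of_int (-k) * x)"] g torus_L2_fun_cis[of "-k"]
      by (simp add: fourier_def L2_exp_abs fg torus_eq_refl_iff)
    finally show "(LINT x|lborel. \<phi> x * cis (of_int k * x)) = 0"
      by (simp add: z)
  qed
  then have "AE x in lborel. \<phi> x = 0"
    by (rule trig_null_AE_zero) (simp add: \<phi>_def)
  then have "AE x in lborel. x \<in> {0..2 * pi} \<longrightarrow> g x = 0"
    using ae by eventually_elim auto
  then have "abs_torus_L2 g = abs_torus_L2 (\<lambda>x. 0)"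
    using g torus_L2_fun_zero by (intro abs_torus_L2_eqI)
  then show ?thesis by (simp add: fg zero_torus_L2_def)
qed

lemma fourier_eqI:
  assumes "\<And>n. fourier f n = fourier g n" shows "f = g"
  using fourier_eq_zero_imp[of "f - g"] assms by (simp add: fourier_diff)

text \<open>Orthogonal series are not absolutely summable, so their convergence has to come from the Cauchy
  criterion.\<close>

lemma summable_on_Cauchy_criterion:
  fixes f :: "'a \<Rightarrow> 'b::banach"
  assumes "\<And>e. e > 0 \<Longrightarrow> \<exists>F0. finite F0 \<and> F0 \<subseteq> A \<and> (\<forall>F. finite F \<and> F \<subseteq> A - F0 \<longrightarrow> norm (sum f F) < e)"
  shows "f summable_on A"
proof -
  have "\<exists>P. eventually P (finite_subsets_at_top A) \<and>
              (\<forall>F F'. P F \<and> P F' \<longrightarrow> dist (sum f F) (sum f F') < e)" if e: "e > 0" for e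
  proof -
    obtain F0 where F0: "finite F0" "F0 \<subseteq> A" "\<And>F. finite F \<Longrightarrow> F \<subseteq> A - F0 \<Longrightarrow> norm (sum f F) < e / 2"
      using assms[of "e / 2"] e by auto
    define P where "P F \<longleftrightarrow> finite F \<and> F0 \<subseteq> F \<and> F \<subseteq> A" for F
    have "eventually P (finite_subsets_at_top A)"
      unfolding eventually_finite_subsets_at_top P_def using F0 by auto
    moreover have "dist (sum f F) (sum f F') < e" if "P F" "P F'" for F F'
    proof -
      have split: "sum f G = sum f (G - F0) + sum f F0" "norm (sum f (G - F0)) < e / 2" if "P G" for G
        using that F0(3)[of "G - F0"] sum.subset_diff[of F0 G f] by (auto simp: P_def)
      have "dist (sum f F) (sum f F') = norm (sum f (F - F0) - sum f (F' - F0))"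
        using split(1)[OF \<open>P F\<close>] split(1)[OF \<open>P F'\<close>] by (simp add: dist_norm)
      also have "\<dots> \<le> norm (sum f (F - F0)) + norm (sum f (F' - F0))"
        by (rule norm_triangle_ineq4)
      finally show ?thesis
        using split(2)[OF \<open>P F\<close>] split(2)[OF \<open>P F'\<close>] by simp
    qed
    ultimately show ?thesis by blast
  qed
  then have "cauchy_filter (filtermap (sum f) (finite_subsets_at_top A))"
    by (simp add: cauchy_filter_metric_filtermap)
  moreover have "complete (UNIV::'b set)"
    by (meson Cauchy_convergent UNIV_I complete_def convergent_def)
  ultimately obtain L' where "(sum f \<longlongrightarrow> L') (finite_subsets_at_top A)"
    using complete_uniform[where S=UNIV] by (force simp add: filterlim_def)
  then show ?thesis
    using summable_on_def has_sum_def by blast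
qed

lemma summable_on_tail_small:
  fixes f :: "'a \<Rightarrow> real"
  assumes f: "f summable_on A" and nn: "\<And>x. x \<in> A \<Longrightarrow> f x \<ge> 0" and e: "e > 0"
  shows "\<exists>F0. finite F0 \<and> F0 \<subseteq> A \<and> (\<forall>F. finite F \<and> F \<subseteq> A - F0 \<longrightarrow> sum f F < e)"
proof -
  obtain F0 where F0: "finite F0" "F0 \<subseteq> A" "dist (sum f F0) (infsum f A) \<le> e / 2"
    using infsum_finite_approximation[OF f, of "e / 2"] e by auto
  have "sum f F < e" if "finite F" "F \<subseteq> A - F0" for F
  proof -
    have "sum f F + sum f F0 = sum f (F \<union> F0)"
      using that F0 by (subst sum.union_disjoint) auto
    also have "\<dots> \<le> infsum f A"
      using that F0 nn by (intro finite_sum_le_infsum f) auto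
    finally have "sum f F + sum f F0 \<le> infsum f A" .
    moreover have "infsum f A - sum f F0 \<le> e / 2"
      using F0(3) unfolding dist_real_def by linarith
    ultimately show ?thesis using e by linarith
  qed
  then show ?thesis using F0 by blast
qed

lemma trig_series_summable:
  assumes "(\<lambda>n. (cmod (a n))\<^sup>2) summable_on A"
  shows "(\<lambda>n. L2_scale (a n) (L2_exp n)) summable_on A"
proof (rule summable_on_Cauchy_criterion)
  fix e :: real assume e: "e > 0"
  then obtain F0 where F0: "finite F0" "F0 \<subseteq> A"
      "\<And>F. finite F \<Longrightarrow> F \<subseteq> A - F0 \<Longrightarrow> (\<Sum>n\<in>F. (cmod (a n))\<^sup>2) < e\<^sup>2"
    using summable_on_tail_small[OF assms, of "e\<^sup>2"] by auto
  have "norm (\<Sum>n\<in>F. L2_scale (a n) (L2_exp n)) < e" if "finite F" "F \<subseteq> A - F0" for F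
    by (rule power2_less_imp_less) (use e F0(3)[OF that] that in \<open>auto simp: norm_trig_sum\<close>)
  then show "\<exists>F0. finite F0 \<and> F0 \<subseteq> A \<and>
      (\<forall>F. finite F \<and> F \<subseteq> A - F0 \<longrightarrow> norm (\<Sum>n\<in>F. L2_scale (a n) (L2_exp n)) < e)"
    using F0 by blast
qed

lemma fourier_trig_series:
  assumes "(\<lambda>n. (cmod (a n))\<^sup>2) summable_on A"
  shows "fourier (\<Sum>\<^sub>\<infinity>n\<in>A. L2_scale (a n) (L2_exp n)) k = (if k \<in> A then a k else 0)"
proof -
  have "((\<lambda>n. fourier (L2_scale (a n) (L2_exp n)) k) has_sum
      fourier (\<Sum>\<^sub>\<infinity>n\<in>A. L2_scale (a n) (L2_exp n)) k) A"
    by (intro has_sum_bounded_linear[OF bounded_linear_fourier] has_sum_infsum trig_series_summable assms)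
  moreover have "((\<lambda>n. fourier (L2_scale (a n) (L2_exp n)) k) has_sum (if k \<in> A then a k else 0)) A"
    by (rule has_sum_finite_neutralI[where B = "A \<inter> {k}"]) (auto simp: fourier_scale fourier_exp)
  ultimately show ?thesis by (rule has_sum_unique)
qed

text \<open>The inverse of the map that takes a function to its Fourier coefficients.\<close>

definition l2_of :: "(int \<Rightarrow> complex) \<Rightarrow> torus_L2" where
  "l2_of a = (\<Sum>\<^sub>\<infinity>n. L2_scale (a n) (L2_exp n))"

lemma fourier_l2_of:
  "(\<lambda>n. (cmod (a n))\<^sup>2) summable_on UNIV \<Longrightarrow> fourier (l2_of a) n = a n"
  by (simp add: l2_of_def fourier_trig_series)

lemma fourier_summable: "(\<lambda>n. (cmod (fourier f n))\<^sup>2) summable_on A"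
proof (rule nonneg_bdd_above_summable_on)
  have "(\<Sum>n\<in>F. (cmod (fourier f n))\<^sup>2) \<le> (norm f)\<^sup>2" if "finite F" for F
  proof -
    let ?S = "\<Sum>n\<in>F. L2_scale (fourier f n) (L2_exp n)"
    have "inner f ?S = (\<Sum>m\<in>F. (cmod (fourier f m))\<^sup>2)"
      unfolding inner_sum_right
      by (rule sum.cong) (simp_all add: inner_scale_exp Re_Im_square)
    moreover have "0 \<le> (norm (f - ?S))\<^sup>2" by simp
    moreover have "(norm (f - ?S))\<^sup>2 = (norm f)\<^sup>2 - 2 * inner f ?S + (norm ?S)\<^sup>2"
      by (simp add: power2_norm_eq_inner inner_diff_left inner_diff_right inner_commute[of ?S f])
    ultimately show ?thesis
      using norm_trig_sum[OF that, of "fourier f"] by simp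
  qed
  then show "bdd_above (sum (\<lambda>n. (cmod (fourier f n))\<^sup>2) ` {F. F \<subseteq> A \<and> finite F})"
    by (intro bdd_aboveI2[where M = "(norm f)\<^sup>2"]) auto
qed auto

lemma l2_of_fourier: "l2_of (fourier f) = f"
  by (rule fourier_eqI) (simp add: fourier_l2_of fourier_summable)

lemma parseval: "((\<lambda>n. (cmod (fourier f n))\<^sup>2) has_sum (norm f)\<^sup>2) UNIV"
proof -
  have "((\<lambda>n. L2_scale (fourier f n) (L2_exp n)) has_sum f) UNIV"
    using has_sum_infsum[OF trig_series_summable[OF fourier_summable[of f UNIV]]] l2_of_fourier[of f]
    by (simp add: l2_of_def)
  then have "((\<lambda>F. (norm (\<Sum>n\<in>F. L2_scale (fourier f n) (L2_exp n)))\<^sup>2) \<longlongrightarrow> (norm f)\<^sup>2) (finite_subsets_at_top UNIV)"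
    unfolding has_sum_def by (intro tendsto_intros)
  moreover have "eventually (\<lambda>F. (norm (\<Sum>n\<in>F. L2_scale (fourier f n) (L2_exp n)))\<^sup>2 = (\<Sum>n\<in>F. (cmod (fourier f n))\<^sup>2))
     (finite_subsets_at_top UNIV)"
    by (auto simp: eventually_finite_subsets_at_top norm_trig_sum)
  ultimately show ?thesis
    unfolding has_sum_def by (rule Lim_transform_eventually)
qed

text \<open>The reindexing \<open>\<pi>\<close> lets one lemma serve both Fourier multipliers and complex conjugation, which
  reverses the frequencies.\<close>

lemma norm_le_fourier:
  assumes \<pi>: "bij \<pi>" and K: "K \<ge> 0" and le: "\<And>n. cmod (fourier g n) \<le> K * cmod (fourier f (\<pi> n))"
  shows "norm g \<le> K * norm f"
proof (rule power2_le_imp_le)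
  have "((\<lambda>n. (cmod (fourier f (\<pi> n)))\<^sup>2) has_sum (norm f)\<^sup>2) UNIV"
    using parseval[of f] has_sum_reindex_bij_betw[of \<pi> UNIV UNIV "\<lambda>n. (cmod (fourier f n))\<^sup>2"] \<pi>
    by (simp add: bij_def bij_betw_def)
  then have "((\<lambda>n. K\<^sup>2 * (cmod (fourier f (\<pi> n)))\<^sup>2) has_sum K\<^sup>2 * (norm f)\<^sup>2) UNIV"
    by (rule has_sum_cmult_right)
  from has_sum_mono[OF parseval this] show "(norm g)\<^sup>2 \<le> (K * norm f)\<^sup>2"
    using power_mono[OF le, of _ 2] by (simp add: power_mult_distrib)
qed (use K in auto)

lemma multiplier_summable:
  assumes "bij \<pi>" "\<And>n. cmod (m n) \<le> K * cmod (fourier f (\<pi> n))"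
  shows "(\<lambda>n. (cmod (m n))\<^sup>2) summable_on UNIV"
proof (rule summable_on_comparison_test)
  have "(\<lambda>n. (cmod (fourier f (\<pi> n)))\<^sup>2) summable_on UNIV"
    using summable_on_reindex_bij_betw[of \<pi> UNIV UNIV "\<lambda>n. (cmod (fourier f n))\<^sup>2"] assms(1) fourier_summable
    by (simp add: bij_def bij_betw_def)
  then show "(\<lambda>n. K\<^sup>2 * (cmod (fourier f (\<pi> n)))\<^sup>2) summable_on UNIV"
    by (rule summable_on_cmult_right)
  show "(cmod (m n))\<^sup>2 \<le> K\<^sup>2 * (cmod (fourier f (\<pi> n)))\<^sup>2" for n
    using power_mono[OF assms(2)[of n], of 2] by (simp add: power_mult_distrib)
qed auto

section \<open>Absolutely convergent Fourier series\<close>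

definition trig_series :: "(int \<Rightarrow> complex) \<Rightarrow> real \<Rightarrow> complex" where
  "trig_series c x = (\<Sum>\<^sub>\<infinity>n. c n * cis (of_int n * x))"

lemma trig_series_has_sum:
  assumes "c abs_summable_on UNIV"
  shows "((\<lambda>n. c n * cis (of_int n * x)) has_sum trig_series c x) UNIV"
  unfolding trig_series_def
proof (rule has_sum_infsum, rule abs_summable_summable)
  show "(\<lambda>n. c n * cis (of_int n * x)) abs_summable_on UNIV"
    using assms by (simp add: norm_mult)
qed

lemma trig_series_continuous:
  assumes "c abs_summable_on UNIV"
  shows "continuous_on UNIV (trig_series c)"
proof (rule uniform_limit_theorem)
  show "uniform_limit UNIV (\<lambda>X y. \<Sum>n\<in>X. c n * cis (of_int n * y)) (trig_series c) (finite_subsets_at_top UNIV)"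
    unfolding trig_series_def
    by (rule Weierstrass_m_test_general[where M = "\<lambda>n. cmod (c n)"]) (use assms in \<open>auto simp: norm_mult\<close>)
  show "\<forall>\<^sub>F X in finite_subsets_at_top UNIV. continuous_on UNIV (\<lambda>y. \<Sum>n\<in>X. c n * cis (of_int n * y))"
    by (intro always_eventually allI continuous_intros)
qed auto

lemma cis_int_periodic: "cis (of_int n * (x + 2 * pi)) = cis (of_int n * x)"
  by (simp add: distrib_left cis_mult[symmetric])
     (metis cis_multiple_2pi Ints_of_int mult.assoc mult.commute mult.right_neutral)

lemma trig_series_periodic: "trig_series c (x + 2 * pi) = trig_series c x"
  unfolding trig_series_def cis_int_periodic ..

lemma trig_series_bound:
  assumes "c abs_summable_on UNIV"
  shows "cmod (trig_series c x) \<le> (\<Sum>\<^sub>\<infinity>n. cmod (c n))"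
  using assms by (intro norm_infsum_le[OF trig_series_has_sum has_sum_infsum]) (auto simp: norm_mult)

lemma torus_L2_fun_trig_series:
  assumes "c abs_summable_on UNIV"
  shows "torus_L2_fun (trig_series c)"
  by (rule torus_L2_fun_bounded[where B = "\<Sum>\<^sub>\<infinity>n. cmod (c n)"])
     (use assms in \<open>auto intro!: borel_measurable_continuous_onI trig_series_continuous trig_series_bound simp: trig_series_periodic\<close>)

lemma norm_abs_torus_L2_le:
  assumes f: "torus_L2_fun f" and B: "\<And>x. cmod (f x) \<le> B"
  shows "norm (abs_torus_L2 f) \<le> B"
proof (rule power2_le_imp_le)
  show B0: "0 \<le> B" using B[of 0] norm_ge_zero order_trans by blast
  have i: "integrable lborel (\<lambda>x. indicator {0..2 * pi} x *\<^sub>R (B\<^sup>2))"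
    by (intro integrable_scaleR_left integrable_real_indicator) auto
  have "(LINT x:{0..2 * pi}|lborel. (cmod (f x))\<^sup>2) \<le> (LINT x|lborel. indicator {0..2 * pi} x *\<^sub>R (B\<^sup>2))"
    unfolding set_lebesgue_integral_def
  proof (rule integral_mono)
    show "integrable lborel (\<lambda>x. indicator {0..2 * pi} x *\<^sub>R (cmod (f x))\<^sup>2)"
      using f by (simp add: torus_L2_fun_def set_integrable_def)
    show "indicator {0..2 * pi} x *\<^sub>R (cmod (f x))\<^sup>2 \<le> indicator {0..2 * pi} x *\<^sub>R (B\<^sup>2)" for x
      using power_mono[OF B, of x 2] by (simp add: indicator_def)
  qed (rule i)
  also have "\<dots> = 2 * pi * B\<^sup>2" by simp
  finally show "(norm (abs_torus_L2 f))\<^sup>2 \<le> B\<^sup>2"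
    by (simp add: norm_abs_torus_L2_square f field_simps)
qed

lemma abs_torus_L2_trig_sum:
  assumes "finite F"
  shows "torus_L2_fun (\<lambda>x. \<Sum>n\<in>F. c n * cis (of_int n * x)) \<and>
    abs_torus_L2 (\<lambda>x. \<Sum>n\<in>F. c n * cis (of_int n * x)) = (\<Sum>n\<in>F. L2_scale (c n) (L2_exp n))"
  using assms
proof (induction F)
  case empty
  then show ?case by (simp add: torus_L2_fun_zero zero_torus_L2_def)
next
  case (insert n F)
  then show ?case
    by (simp add: torus_L2_fun_add torus_L2_fun_scale torus_L2_fun_cis abs_torus_L2_add[symmetric]
        L2_exp_abs abs_torus_L2_scale)
qed

text \<open>The partial sums converge uniformly, hence in the mean, to the continuous function.\<close>

lemma fourier_trig_series_fun:
  assumes c: "c abs_summable_on UNIV"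
  shows "fourier (abs_torus_L2 (trig_series c)) k = c k"
proof -
  have "cmod (fourier (abs_torus_L2 (trig_series c)) k - c k) \<le> 0"
  proof (rule field_le_epsilon)
    fix e :: real assume e: "e > 0"
    obtain F0 where F0: "finite F0" "dist (\<Sum>n\<in>F0. cmod (c n)) (\<Sum>\<^sub>\<infinity>n. cmod (c n)) \<le> e"
      using infsum_finite_approximation[OF c e] by auto
    define F where "F = insert k F0"
    have F: "finite F" "k \<in> F" using F0 by (auto simp: F_def)
    have "(\<Sum>n\<in>F0. cmod (c n)) \<le> (\<Sum>n\<in>F. cmod (c n))"
      using F by (intro sum_mono2) (auto simp: F_def)
    then have tail: "(\<Sum>\<^sub>\<infinity>n. cmod (c n)) - (\<Sum>n\<in>F. cmod (c n)) \<le> e"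
      using F0(2) by (simp add: dist_real_def)
    let ?S = "\<lambda>x. \<Sum>n\<in>F. c n * cis (of_int n * x)"
    have bd: "cmod (trig_series c x - ?S x) \<le> e" for x
    proof -
      have "((\<lambda>n. c n * cis (of_int n * x)) has_sum (trig_series c x - ?S x)) (UNIV - F)"
        by (intro has_sum_Diff trig_series_has_sum c has_sum_finite F) auto
      moreover have "((\<lambda>n. cmod (c n)) has_sum ((\<Sum>\<^sub>\<infinity>n. cmod (c n)) - (\<Sum>n\<in>F. cmod (c n)))) (UNIV - F)"
        by (intro has_sum_Diff has_sum_infsum c has_sum_finite F) auto
      ultimately have "cmod (trig_series c x - ?S x) \<le> (\<Sum>\<^sub>\<infinity>n. cmod (c n)) - (\<Sum>n\<in>F. cmod (c n))"
        by (rule norm_infsum_le) (simp add: norm_mult)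
      with tail show ?thesis by linarith
    qed
    note S = abs_torus_L2_trig_sum[OF F(1), of c]
    have "c k = fourier (abs_torus_L2 ?S) k"
      using S F fourier_trig_sum[OF F(1), of c k] by simp
    then have "fourier (abs_torus_L2 (trig_series c)) k - c k = fourier (abs_torus_L2 (\<lambda>x. trig_series c x - ?S x)) k"
      using S abs_torus_L2_diff[OF torus_L2_fun_trig_series[OF c] conjunct1[OF S]] by (simp add: fourier_diff[symmetric])
    also have "cmod \<dots> \<le> norm (abs_torus_L2 (\<lambda>x. trig_series c x - ?S x))"
      by (rule norm_fourier_le)
    also have "\<dots> \<le> e"
      using S torus_L2_fun_trig_series[OF c] by (intro norm_abs_torus_L2_le torus_L2_fun_diff bd) auto
    finally show "cmod (fourier (abs_torus_L2 (trig_series c)) k - c k) \<le> 0 + e" by simp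
  qed
  then show ?thesis by simp
qed

section \<open>A calculus of power series between Banach spaces\<close>

text \<open>Symmetry is left out here, since products of symmetric forms are not symmetric; it is restored
  once at the end by \<open>symmetrized\<close>.\<close>

definition multilin :: "nat \<Rightarrow> real \<Rightarrow> ((nat \<Rightarrow> 'e::real_normed_vector) \<Rightarrow> 'x::real_normed_vector) \<Rightarrow> bool" where
  "multilin k C A \<longleftrightarrow> 0 \<le> C \<and>
     (\<forall>h h'. (\<forall>i<k. h i = h' i) \<longrightarrow> A h = A h') \<and>
     (\<forall>h. norm (A h) \<le> C * (\<Prod>i<k. norm (h i))) \<and>
     (\<forall>h i x y a b. i < k \<longrightarrow>
        A (h(i := a *\<^sub>R x + b *\<^sub>R y)) = a *\<^sub>R A (h(i := x)) + b *\<^sub>R A (h(i := y)))"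

lemma multilinI:
  assumes "0 \<le> C" "\<And>h h'. (\<And>i. i < k \<Longrightarrow> h i = h' i) \<Longrightarrow> A h = A h'"
    "\<And>h. norm (A h) \<le> C * (\<Prod>i<k. norm (h i))"
    "\<And>h i x y a b. i < k \<Longrightarrow>
        A (h(i := a *\<^sub>R x + b *\<^sub>R y)) = a *\<^sub>R A (h(i := x)) + b *\<^sub>R A (h(i := y))"
  shows "multilin k C A"
  unfolding multilin_def using assms by blast

lemma multilinD:
  assumes "multilin k C A"
  shows "0 \<le> C" "(\<And>i. i < k \<Longrightarrow> h i = h' i) \<Longrightarrow> A h = A h'"
    "norm (A h) \<le> C * (\<Prod>i<k. norm (h i))"
    "i < k \<Longrightarrow> A (h(i := a *\<^sub>R x + b *\<^sub>R y)) = a *\<^sub>R A (h(i := x)) + b *\<^sub>R A (h(i := y))"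
  using assms unfolding multilin_def by blast+

lemma multilin_diag_le:
  assumes "multilin k C A" "norm h \<le> r"
  shows "norm (A (\<lambda>_. h)) \<le> C * r ^ k"
proof -
  have "norm (A (\<lambda>_. h)) \<le> C * norm h ^ k"
    using multilinD(3)[OF assms(1), of "\<lambda>_. h"] by simp
  also have "\<dots> \<le> C * r ^ k"
    using assms multilinD(1)[OF assms(1)] by (intro mult_left_mono power_mono) auto
  finally show ?thesis .
qed

text \<open>A map given on the ball of radius \<open>r\<close> by a series of homogeneous terms whose majorants sum to at
  most \<open>M\<close>.  The terms need not be sorted by degree: several may have the same degree, which makes
  the closure properties plain statements on unconditional sums.\<close>

definition ps_on :: "real \<Rightarrow> real \<Rightarrow> ('e::real_normed_vector \<Rightarrow> 'x::banach) \<Rightarrow> bool" where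
  "ps_on r M g \<longleftrightarrow> (\<exists>(T :: nat \<Rightarrow> (nat \<Rightarrow> 'e) \<Rightarrow> 'x) d c S. (\<forall>j. multilin (d j) (c j) (T j)) \<and>
     ((\<lambda>j. c j * r ^ d j) has_sum S) UNIV \<and> S \<le> M \<and>
     (\<forall>h. norm h < r \<longrightarrow> ((\<lambda>j. T j (\<lambda>_. h)) has_sum g h) UNIV))"

lemma has_sum_to_nat:
  fixes f :: "'i::countable \<Rightarrow> 'b::{comm_monoid_add,topological_space}"
  assumes "(f has_sum S) UNIV"
  shows "((\<lambda>n. if n \<in> range (to_nat :: 'i \<Rightarrow> nat) then f (from_nat n) else 0) has_sum S) UNIV"
proof -
  have "((\<lambda>n. f (from_nat n)) has_sum S) (range (to_nat :: 'i \<Rightarrow> nat))"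
    by (subst has_sum_reindex) (use assms in \<open>simp_all add: o_def\<close>)
  moreover have "((\<lambda>n. f (from_nat n)) has_sum S) (range (to_nat :: 'i \<Rightarrow> nat)) \<longleftrightarrow>
      ((\<lambda>n. if n \<in> range (to_nat :: 'i \<Rightarrow> nat) then f (from_nat n) else 0) has_sum S) UNIV"
    by (rule has_sum_cong_neutral) auto
  ultimately show ?thesis by blast
qed

lemma multilin_zero: "multilin 0 0 (\<lambda>_. 0)"
  by (rule multilinI) auto

text \<open>Any countable index set may replace the natural numbers.\<close>

lemma ps_onI:
  fixes T :: "'i::countable \<Rightarrow> (nat \<Rightarrow> 'e::real_normed_vector) \<Rightarrow> 'x::banach"
  assumes T: "\<And>j. multilin (d j) (c j) (T j)"
    and S: "((\<lambda>j. c j * r ^ d j) has_sum S) UNIV" "S \<le> M"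
    and g: "\<And>h. norm h < r \<Longrightarrow> ((\<lambda>j. T j (\<lambda>_. h)) has_sum g h) UNIV"
  shows "ps_on r M g"
proof -
  let ?R = "range (to_nat :: 'i \<Rightarrow> nat)"
  define T' where "T' n = (if n \<in> ?R then T (from_nat n) else (\<lambda>_. 0))" for n
  define d' where "d' n = (if n \<in> ?R then d (from_nat n) else 0)" for n
  define c' where "c' n = (if n \<in> ?R then c (from_nat n) else 0)" for n
  have "multilin (d' n) (c' n) (T' n)" for n
    unfolding T'_def d'_def c'_def by (cases "n \<in> ?R") (simp_all only: if_True if_False T multilin_zero)
  moreover have "(\<lambda>n. c' n * r ^ d' n) = (\<lambda>n. if n \<in> ?R then c (from_nat n) * r ^ d (from_nat n) else 0)"
    by (auto simp: c'_def d'_def)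
  then have "((\<lambda>n. c' n * r ^ d' n) has_sum S) UNIV"
    using has_sum_to_nat[OF S(1)] by simp
  moreover have "((\<lambda>n. T' n (\<lambda>_. h)) has_sum g h) UNIV" if "norm h < r" for h
  proof -
    have "(\<lambda>n. T' n (\<lambda>_. h)) = (\<lambda>n. if n \<in> ?R then T (from_nat n) (\<lambda>_. h) else 0)"
      by (auto simp: T'_def)
    then show ?thesis using has_sum_to_nat[OF g[OF that]] by simp
  qed
  ultimately show ?thesis
    unfolding ps_on_def using S(2) by blast
qed

lemma ps_onE:
  fixes g :: "'e::real_normed_vector \<Rightarrow> 'x::banach"
  assumes "ps_on r M g"
  obtains T :: "nat \<Rightarrow> (nat \<Rightarrow> 'e) \<Rightarrow> 'x" and d c S where "\<And>j. multilin (d j) (c j) (T j)"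
     "((\<lambda>j. c j * r ^ d j) has_sum S) UNIV" "S \<le> M"
     "\<And>h. norm h < r \<Longrightarrow> ((\<lambda>j. T j (\<lambda>_. h)) has_sum g h) UNIV"
  using assms unfolding ps_on_def by blast

lemma ps_on_bound:
  fixes g :: "'e::real_normed_vector \<Rightarrow> 'x::banach"
  assumes "ps_on r M g" "norm h < r"
  shows "norm (g h) \<le> M"
proof -
  obtain T :: "nat \<Rightarrow> (nat \<Rightarrow> 'e) \<Rightarrow> 'x" and d c S where T: "\<And>j. multilin (d j) (c j) (T j)"
     and S: "((\<lambda>j. c j * r ^ d j) has_sum S) UNIV" "S \<le> M"
     and s: "\<And>h. norm h < r \<Longrightarrow> ((\<lambda>j. T j (\<lambda>_. h)) has_sum g h) UNIV"
    using assms(1) by (rule ps_onE) (rule that)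
  have "norm (g h) \<le> S"
    by (rule norm_infsum_le[OF s[OF assms(2)] S(1)]) (use multilin_diag_le[OF T, of h r] assms(2) in simp)
  with S(2) show ?thesis by simp
qed

lemma ps_on_const: "ps_on r (norm x) (\<lambda>_. x)"
proof (rule ps_onI[where T = "\<lambda>(_::unit) _. x" and d = "\<lambda>_. 0" and c = "\<lambda>_. norm x" and S = "norm x"])
  show "multilin 0 (norm x) (\<lambda>_. x)" by (rule multilinI) auto
qed (auto simp: has_sum_finite_iff UNIV_unit)

lemma ps_on_linear:
  assumes L: "bounded_linear L" and K: "\<And>h. norm (L h) \<le> K * norm h" and "0 \<le> K"
  shows "ps_on r (K * r) L"
proof (rule ps_onI[where T = "\<lambda>(_::unit) h. L (h 0)" and d = "\<lambda>_. 1" and c = "\<lambda>_. K" and S = "K * r"])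
  interpret bounded_linear L by (rule L)
  show "multilin 1 K (\<lambda>h. L (h 0))"
    by (rule multilinI) (use assms in \<open>auto simp: add scaleR\<close>)
qed (auto simp: has_sum_finite_iff UNIV_unit)

lemma ps_on_compose_linear:
  fixes g :: "'e::real_normed_vector \<Rightarrow> 'x::banach" and L :: "'x \<Rightarrow> 'z::banach"
  assumes g: "ps_on r M g" and L: "bounded_linear L" and K: "\<And>x. norm (L x) \<le> K * norm x" and K0: "0 \<le> K"
  shows "ps_on r (K * M) (\<lambda>h. L (g h))"
proof -
  interpret bounded_linear L by (rule L)
  obtain T :: "nat \<Rightarrow> (nat \<Rightarrow> 'e) \<Rightarrow> 'x" and d c S where T: "\<And>j. multilin (d j) (c j) (T j)"
     and S: "((\<lambda>j. c j * r ^ d j) has_sum S) UNIV" "S \<le> M"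
     and s: "\<And>h. norm h < r \<Longrightarrow> ((\<lambda>j. T j (\<lambda>_. h)) has_sum g h) UNIV"
    using g by (rule ps_onE) (rule that)
  show ?thesis
  proof (rule ps_onI[where T = "\<lambda>j h. L (T j h)" and d = d and c = "\<lambda>j. K * c j"])
    fix j
    show "multilin (d j) (K * c j) (\<lambda>h. L (T j h))"
    proof (rule multilinI)
      show "0 \<le> K * c j" using K0 multilinD(1)[OF T] by simp
      show "L (T j h) = L (T j h')" if "\<And>i. i < d j \<Longrightarrow> h i = h' i" for h h'
        using multilinD(2)[OF T that] by simp
      show "norm (L (T j h)) \<le> K * c j * (\<Prod>i<d j. norm (h i))" for h
        using K[of "T j h"] mult_left_mono[OF multilinD(3)[OF T, of j h] K0] by (simp add: mult.assoc)
      show "L (T j (h(i := a *\<^sub>R x + b *\<^sub>R y))) = a *\<^sub>R L (T j (h(i := x))) + b *\<^sub>R L (T j (h(i := y)))"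
        if "i < d j" for h i x y a b
        by (simp add: multilinD(4)[OF T that] add scaleR)
    qed
  next
    show "((\<lambda>j. K * c j * r ^ d j) has_sum K * S) UNIV"
      using has_sum_cmult_right[OF S(1), of K] by (simp add: mult.assoc)
    show "K * S \<le> K * M" using S(2) K0 by (rule mult_left_mono)
    show "((\<lambda>j. L (T j (\<lambda>_. h))) has_sum L (g h)) UNIV" if "norm h < r" for h
      by (rule has_sum_bounded_linear[OF L s[OF that]])
  qed
qed

lemma has_sum_product_real:
  fixes f :: "'a \<Rightarrow> real" and g :: "'b \<Rightarrow> real"
  assumes "(f has_sum S) A" "(g has_sum T) B" "\<And>x. 0 \<le> f x" "\<And>y. 0 \<le> g y"
  shows "((\<lambda>(x,y). f x * g y) has_sum (S * T)) (A \<times> B)"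
proof -
  have inner: "((\<lambda>y. f x * g y) has_sum (f x * T)) B" for x
    by (rule has_sum_cmult_right[OF assms(2)])
  have outer: "((\<lambda>x. f x * T) has_sum (S * T)) A"
    by (rule has_sum_cmult_left[OF assms(1)])
  have sm: "(\<lambda>(x,y). f x * g y) summable_on (A \<times> B)"
  proof -
    have "(\<lambda>z. (\<lambda>(x,y). f x * g y) z) abs_summable_on (A \<times> B)"
    proof (rule Infinite_Sum.abs_summable_on_Sigma_iff[THEN iffD2], intro conjI ballI)
      show "(\<lambda>y. norm ((\<lambda>(x,y). f x * g y) (x, y))) summable_on B" for x
        using has_sum_imp_summable[OF inner[of x]] assms by simp
      have "(\<Sum>\<^sub>\<infinity>y\<in>B. norm ((\<lambda>(x,y). f x * g y) (x, y))) = f x * T" for x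
        using infsumI[OF inner[of x]] assms by simp
      then show "(\<lambda>x. norm (\<Sum>\<^sub>\<infinity>y\<in>B. norm ((\<lambda>(x,y). f x * g y) (x, y)))) summable_on A"
        using has_sum_imp_summable[OF outer] has_sum_nonneg[OF assms(2)] assms by simp
    qed
    then show ?thesis by (rule abs_summable_summable)
  qed
  then obtain X where X: "((\<lambda>(x,y). f x * g y) has_sum X) (A \<times> B)"
    by (auto simp: summable_on_def)
  have "((\<lambda>x. f x * T) has_sum X) A"
    using has_sum_SigmaD[OF X] inner by auto
  then have "X = S * T" using outer has_sum_unique by blast
  with X show ?thesis by simp
qed

lemma prod_lessThan_add:
  "(\<Prod>l<m + (n::nat). f l) = (\<Prod>l<m. f l) * (\<Prod>l<n. f (l + m) :: 'a::comm_monoid_mult)"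
  by (induction n) (simp_all add: add.commute mult_ac)

lemma has_sum_comparison:
  fixes f :: "'a \<Rightarrow> 'b::banach"
  assumes "(g has_sum T) A" "\<And>x. x \<in> A \<Longrightarrow> norm (f x) \<le> g x"
  shows "f abs_summable_on A"
proof (rule summable_on_comparison_test)
  show "g summable_on A" using assms(1) by (rule has_sum_imp_summable)
qed (use assms in auto)

lemma has_sum_Sigma_abs:
  fixes f :: "'a \<times> 'b \<Rightarrow> 'c::banach"
  assumes "f abs_summable_on (Sigma A B)"
    and "\<And>x. x \<in> A \<Longrightarrow> ((\<lambda>y. f (x, y)) has_sum g x) (B x)" "(g has_sum S) A"
  shows "(f has_sum S) (Sigma A B)"
proof -
  obtain X where X: "(f has_sum X) (Sigma A B)"
    using abs_summable_summable[OF assms(1)] by (auto simp: summable_on_def)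
  then have "(g has_sum X) A" using assms(2) by (rule has_sum_SigmaD)
  then have "X = S" using assms(3) has_sum_unique by blast
  with X show ?thesis by simp
qed

text \<open>The terms of the product are indexed by pairs; the second factor takes the arguments that the
  first one leaves over.\<close>

lemma ps_on_bilinear:
  fixes g1 :: "'e::real_normed_vector \<Rightarrow> 'x::banach" and g2 :: "'e \<Rightarrow> 'y::banach" and B :: "'x \<Rightarrow> 'y \<Rightarrow> 'z::banach"
  assumes g1: "ps_on r M1 g1" and g2: "ps_on r M2 g2" and B: "bounded_bilinear B"
    and K: "\<And>x y. norm (B x y) \<le> K * (norm x * norm y)" and K0: "0 \<le> K" and r: "0 \<le> r"
  shows "ps_on r (K * (M1 * M2)) (\<lambda>h. B (g1 h) (g2 h))"
proof -
  interpret bounded_bilinear B by (rule B)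
  obtain T1 :: "nat \<Rightarrow> (nat \<Rightarrow> 'e) \<Rightarrow> 'x" and d1 c1 S1 where T1: "\<And>j. multilin (d1 j) (c1 j) (T1 j)"
     and S1: "((\<lambda>j. c1 j * r ^ d1 j) has_sum S1) UNIV" "S1 \<le> M1"
     and s1: "\<And>h. norm h < r \<Longrightarrow> ((\<lambda>j. T1 j (\<lambda>_. h)) has_sum g1 h) UNIV"
    using g1 by (rule ps_onE) (rule that)
  obtain T2 :: "nat \<Rightarrow> (nat \<Rightarrow> 'e) \<Rightarrow> 'y" and d2 c2 S2 where T2: "\<And>j. multilin (d2 j) (c2 j) (T2 j)"
     and S2: "((\<lambda>j. c2 j * r ^ d2 j) has_sum S2) UNIV" "S2 \<le> M2"
     and s2: "\<And>h. norm h < r \<Longrightarrow> ((\<lambda>j. T2 j (\<lambda>_. h)) has_sum g2 h) UNIV"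
    using g2 by (rule ps_onE) (rule that)
  note c1 = multilinD(1)[OF T1] and c2 = multilinD(1)[OF T2]
  have S0: "0 \<le> S1" "0 \<le> S2"
    using has_sum_nonneg[OF S1(1)] has_sum_nonneg[OF S2(1)] c1 c2 r by auto
  have sumc: "((\<lambda>(i,j). (c1 i * r ^ d1 i) * (c2 j * r ^ d2 j)) has_sum S1 * S2) UNIV"
    using has_sum_product_real[OF S1(1) S2(1)] c1 c2 r by simp
  show ?thesis
  proof (rule ps_onI[where T = "\<lambda>(i,j) h. B (T1 i h) (T2 j (\<lambda>m. h (m + d1 i)))"
        and d = "\<lambda>(i,j). d1 i + d2 j" and c = "\<lambda>(i,j). K * (c1 i * c2 j)" and S = "K * (S1 * S2)"])
    fix ij :: "nat \<times> nat"
    obtain i j where [simp]: "ij = (i, j)" by (cases ij)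
    have "multilin (d1 i + d2 j) (K * (c1 i * c2 j)) (\<lambda>h. B (T1 i h) (T2 j (\<lambda>m. h (m + d1 i))))"
    proof (rule multilinI)
      show "0 \<le> K * (c1 i * c2 j)" using K0 c1 c2 by simp
      show "B (T1 i h) (T2 j (\<lambda>m. h (m + d1 i))) = B (T1 i h') (T2 j (\<lambda>m. h' (m + d1 i)))"
        if "\<And>l. l < d1 i + d2 j \<Longrightarrow> h l = h' l" for h h'
        using multilinD(2)[OF T1, of i h h'] multilinD(2)[OF T2, of j "\<lambda>m. h (m + d1 i)" "\<lambda>m. h' (m + d1 i)"] that
        by simp
      show "norm (B (T1 i h) (T2 j (\<lambda>m. h (m + d1 i)))) \<le> K * (c1 i * c2 j) * (\<Prod>l<d1 i + d2 j. norm (h l))" for h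
      proof -
        have pr: "(\<Prod>l<d1 i + d2 j. norm (h l)) = (\<Prod>l<d1 i. norm (h l)) * (\<Prod>m<d2 j. norm (h (m + d1 i)))"
          by (rule prod_lessThan_add)
        have "norm (B (T1 i h) (T2 j (\<lambda>m. h (m + d1 i))))
            \<le> K * (norm (T1 i h) * norm (T2 j (\<lambda>m. h (m + d1 i))))" by (rule K)
        also have "\<dots> \<le> K * ((c1 i * (\<Prod>l<d1 i. norm (h l))) * (c2 j * (\<Prod>m<d2 j. norm (h (m + d1 i)))))"
          by (intro mult_left_mono mult_mono multilinD(3)[OF T1] multilinD(3)[OF T2] K0 mult_nonneg_nonneg prod_nonneg c1) auto
        finally show ?thesis by (simp add: pr mult_ac)
      qed
      show "B (T1 i (h(l := a *\<^sub>R x + b *\<^sub>R y))) (T2 j (\<lambda>m. (h(l := a *\<^sub>R x + b *\<^sub>R y)) (m + d1 i)))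
        = a *\<^sub>R B (T1 i (h(l := x))) (T2 j (\<lambda>m. (h(l := x)) (m + d1 i)))
        + b *\<^sub>R B (T1 i (h(l := y))) (T2 j (\<lambda>m. (h(l := y)) (m + d1 i)))"
        if l: "l < d1 i + d2 j" for h l x y a b
      proof (cases "l < d1 i")
        case True
        then have "(\<lambda>m. (h(l := z)) (m + d1 i)) = (\<lambda>m. h (m + d1 i))" for z
          by auto
        then show ?thesis
          by (simp only: multilinD(4)[OF T1 True] add_left scaleR_left)
      next
        case False
        have 1: "T1 i (h(l := z)) = T1 i h" for z
          by (rule multilinD(2)[OF T1]) (use False in auto)
        have 2: "(\<lambda>m. (h(l := z)) (m + d1 i)) = (\<lambda>m. h (m + d1 i))(l - d1 i := z)" for z
          using False by (auto simp: fun_eq_iff)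
        have 3: "l - d1 i < d2 j" using False l by linarith
        show ?thesis
          by (simp only: 1 2 multilinD(4)[OF T2 3] add_right scaleR_right)
      qed
    qed
    then show "multilin (case ij of (i, j) \<Rightarrow> d1 i + d2 j) (case ij of (i, j) \<Rightarrow> K * (c1 i * c2 j))
      (case ij of (i, j) \<Rightarrow> \<lambda>h. B (T1 i h) (T2 j (\<lambda>m. h (m + d1 i))))" by simp
  next
    have "(\<lambda>ij. (case ij of (i, j) \<Rightarrow> K * (c1 i * c2 j)) * r ^ (case ij of (i, j) \<Rightarrow> d1 i + d2 j))
      = (\<lambda>ij. K * (case ij of (i,j) \<Rightarrow> (c1 i * r ^ d1 i) * (c2 j * r ^ d2 j)))"
      by (auto simp: power_add)
    then show "((\<lambda>ij. (case ij of (i, j) \<Rightarrow> K * (c1 i * c2 j)) * r ^ (case ij of (i, j) \<Rightarrow> d1 i + d2 j))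
        has_sum K * (S1 * S2)) UNIV"
      using has_sum_cmult_right[OF sumc, of K] by simp
    show "K * (S1 * S2) \<le> K * (M1 * M2)"
      using S0 S1(2) S2(2) K0 by (intro mult_left_mono mult_mono) auto
    fix h :: 'e assume h: "norm h < r"
    define F where "F = (\<lambda>(i,j). B (T1 i (\<lambda>_. h)) (T2 j (\<lambda>_. h)))"
    have "(F has_sum B (g1 h) (g2 h)) (UNIV \<times> UNIV)"
    proof (rule has_sum_Sigma_abs)
      have le: "norm (F ij) \<le> K * (case ij of (i,j) \<Rightarrow> (c1 i * r ^ d1 i) * (c2 j * r ^ d2 j))" for ij
      proof (cases ij)
        case (Pair i j)
        have "norm (B (T1 i (\<lambda>_. h)) (T2 j (\<lambda>_. h))) \<le> K * (norm (T1 i (\<lambda>_. h)) * norm (T2 j (\<lambda>_. h)))"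
          by (rule K)
        also have "\<dots> \<le> K * ((c1 i * r ^ d1 i) * (c2 j * r ^ d2 j))"
          using h r by (intro mult_left_mono mult_mono multilin_diag_le[OF T1] multilin_diag_le[OF T2] K0) (auto simp: c1 c2)
        finally show ?thesis by (simp add: Pair F_def)
      qed
      then show "F abs_summable_on UNIV \<times> UNIV"
        using has_sum_comparison[OF has_sum_cmult_right[OF sumc, of K], where f = F] by simp
      show "((\<lambda>j. F (i, j)) has_sum B (T1 i (\<lambda>_. h)) (g2 h)) UNIV" for i
        unfolding F_def using has_sum_bounded_linear[OF bounded_linear_right s2[OF h]] by simp
      show "((\<lambda>i. B (T1 i (\<lambda>_. h)) (g2 h)) has_sum B (g1 h) (g2 h)) UNIV"
        by (rule has_sum_bounded_linear[OF bounded_linear_left s1[OF h]])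
    qed
    moreover have "F = (\<lambda>ij. (case ij of (i, j) \<Rightarrow> \<lambda>h. B (T1 i h) (T2 j (\<lambda>m. h (m + d1 i)))) (\<lambda>_. h))"
      by (auto simp: F_def)
    ultimately show "((\<lambda>ij. (case ij of (i, j) \<Rightarrow> \<lambda>h. B (T1 i h) (T2 j (\<lambda>m. h (m + d1 i)))) (\<lambda>_. h))
        has_sum B (g1 h) (g2 h)) UNIV" by simp
  qed
qed

text \<open>Summable majorants make the double family of terms absolutely summable.\<close>

lemma ps_on_suminf:
  fixes g :: "nat \<Rightarrow> 'e::real_normed_vector \<Rightarrow> 'x::banach"
  assumes g: "\<And>n. ps_on r (M n) (g n)" and M: "M sums N" and r: "0 \<le> r"
    and G: "\<And>h. norm h < r \<Longrightarrow> (\<lambda>n. g n h) sums G h"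
  shows "ps_on r N G"
proof -
  define Q where "Q n p \<longleftrightarrow> (\<forall>j. multilin (fst (snd p) j) (fst (snd (snd p)) j) (fst p j)) \<and>
     ((\<lambda>j. fst (snd (snd p)) j * r ^ fst (snd p) j) has_sum snd (snd (snd p))) UNIV \<and> snd (snd (snd p)) \<le> M n \<and>
     (\<forall>h. norm h < r \<longrightarrow> ((\<lambda>j. fst p j (\<lambda>_. h)) has_sum g n h) UNIV)"
    for n and p :: "(nat \<Rightarrow> (nat \<Rightarrow> 'e) \<Rightarrow> 'x) \<times> (nat \<Rightarrow> nat) \<times> (nat \<Rightarrow> real) \<times> real"
  have "\<exists>p. Q n p" for n
  proof -
    obtain T :: "nat \<Rightarrow> (nat \<Rightarrow> 'e) \<Rightarrow> 'x" and d c S where "\<And>j. multilin (d j) (c j) (T j)"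
     "((\<lambda>j. c j * r ^ d j) has_sum S) UNIV" "S \<le> M n"
     "\<And>h. norm h < r \<Longrightarrow> ((\<lambda>j. T j (\<lambda>_. h)) has_sum g n h) UNIV"
      using g[of n] by (rule ps_onE) (rule that)
    then have "Q n (T, d, c, S)" by (simp add: Q_def)
    then show ?thesis by blast
  qed
  then obtain p where p: "\<And>n. Q n (p n)" by metis
  define T d c S where "T n = fst (p n)" and "d n = fst (snd (p n))" and "c n = fst (snd (snd (p n)))"
    and "S n = snd (snd (snd (p n)))" for n
  have T: "multilin (d n j) (c n j) (T n j)"
     and S: "((\<lambda>j. c n j * r ^ d n j) has_sum S n) UNIV" "S n \<le> M n"
     and s: "norm h < r \<Longrightarrow> ((\<lambda>j. T n j (\<lambda>_. h)) has_sum g n h) UNIV" for n j h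
    using p[of n] by (simp_all add: Q_def T_def d_def c_def S_def)
  have c0: "0 \<le> c n j * r ^ d n j" for n j using multilinD(1)[OF T] r by simp
  have S0: "0 \<le> S n" for n by (rule has_sum_nonneg[OF S(1)]) (rule c0)
  have "summable S"
    by (rule summable_comparison_test'[OF sums_summable[OF M]]) (use S0 S(2) in auto)
  then have Ssums: "S sums suminf S" by (rule summable_sums)
  have SN: "suminf S \<le> N"
    using sums_le[OF S(2) Ssums M] .
  have Shs: "(S has_sum suminf S) UNIV"
    by (rule sums_nonneg_imp_has_sum[OF Ssums S0])
  let ?C = "\<lambda>(n,j). c n j * r ^ d n j"
  have Chs: "(?C has_sum suminf S) (UNIV \<times> UNIV)"
  proof (rule has_sum_Sigma_abs)
    show "?C abs_summable_on UNIV \<times> UNIV"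
    proof (rule Infinite_Sum.abs_summable_on_Sigma_iff[THEN iffD2], intro conjI ballI)
      show "(\<lambda>y. norm (?C (n, y))) summable_on UNIV" for n
        using has_sum_imp_summable[OF S(1)[of n]] c0 by simp
      have "(\<Sum>\<^sub>\<infinity>y. norm (?C (n, y))) = S n" for n
        using infsumI[OF S(1)[of n]] c0 by simp
      then show "(\<lambda>n. norm (\<Sum>\<^sub>\<infinity>y. norm (?C (n, y)))) summable_on UNIV"
        using has_sum_imp_summable[OF Shs] S0 by simp
    qed
  qed (use S Shs in auto)
  show ?thesis
  proof (rule ps_onI[where T = "\<lambda>(n,j). T n j" and d = "\<lambda>(n,j). d n j" and c = "\<lambda>(n,j). c n j" and S = "suminf S"])
    show "multilin (case p of (n, j) \<Rightarrow> d n j) (case p of (n, j) \<Rightarrow> c n j) (case p of (n, j) \<Rightarrow> T n j)" for p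
      using T by (cases p) simp
    show "((\<lambda>p. (case p of (n, j) \<Rightarrow> c n j) * r ^ (case p of (n, j) \<Rightarrow> d n j)) has_sum suminf S) UNIV"
      using Chs by (simp add: case_prod_unfold)
    show "suminf S \<le> N" by (rule SN)
    fix h :: 'e assume h: "norm h < r"
    let ?F = "\<lambda>p. (case p of (n, j) \<Rightarrow> T n j) (\<lambda>_. h)"
    have le: "norm (?F p) \<le> ?C p" for p
      using multilin_diag_le[OF T, of h r] h by (cases p) simp
    have gn: "norm (g n h) \<le> S n" for n
      by (rule norm_infsum_le[OF s[OF h] S(1)]) (use multilin_diag_le[OF T, of h r] h in simp)
    have "summable (\<lambda>n. norm (g n h))"
      by (rule summable_comparison_test'[OF \<open>summable S\<close>]) (use gn in auto)
    then have Ghs: "((\<lambda>n. g n h) has_sum G h) UNIV"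
      using G[OF h] by (rule norm_summable_imp_has_sum)
    have "(?F has_sum G h) (UNIV \<times> UNIV)"
    proof (rule has_sum_Sigma_abs[OF _ _ Ghs])
      show "?F abs_summable_on UNIV \<times> UNIV"
        by (rule has_sum_comparison[OF Chs]) (rule le)
    qed (use s[OF h] in simp)
    then show "(?F has_sum G h) UNIV" by simp
  qed
qed

definition symmetrized :: "nat \<Rightarrow> ((nat \<Rightarrow> 'e) \<Rightarrow> 'x::real_vector) \<Rightarrow> (nat \<Rightarrow> 'e) \<Rightarrow> 'x" where
  "symmetrized k A h = (1 / fact k) *\<^sub>R (\<Sum>p | p permutes {..<k}. A (h \<circ> p))"

lemma symmetrized_diag: "symmetrized k A (\<lambda>_. h) = A (\<lambda>_. h)"
  by (simp add: symmetrized_def o_def card_permutations scaleR_conv_of_real[symmetric] sum_constant_scaleR)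

lemma symmetrized_symmetric:
  assumes "q permutes {..<k}"
  shows "symmetrized k A (h \<circ> q) = symmetrized k A h"
proof -
  have "(\<Sum>p | p permutes {..<k}. A (h \<circ> p)) = (\<Sum>p | p permutes {..<k}. A (h \<circ> (q \<circ> p)))"
    using setum_permutations_compose_left[OF assms, of "\<lambda>p. A (h \<circ> p)"] .
  then show ?thesis by (simp add: symmetrized_def o_assoc)
qed

lemma multilin_symmetrized:
  assumes A: "multilin k C A"
  shows "multilin k C (symmetrized k A)"
proof (rule multilinI)
  let ?P = "{p. p permutes {..<k}}"
  have card: "card ?P = fact k" by (simp add: card_permutations)
  show "0 \<le> C" by (rule multilinD(1)[OF A])
  show "symmetrized k A h = symmetrized k A h'" if eq: "\<And>i. i < k \<Longrightarrow> h i = h' i" for h h'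
  proof -
    have "A (h \<circ> p) = A (h' \<circ> p)" if "p permutes {..<k}" for p
    proof (rule multilinD(2)[OF A])
      fix i assume "i < k"
      then have "p i < k" using permutes_in_image[OF that, of i] by simp
      then show "(h \<circ> p) i = (h' \<circ> p) i" by (simp add: eq)
    qed
    then show ?thesis by (simp add: symmetrized_def)
  qed
  show "norm (symmetrized k A h) \<le> C * (\<Prod>i<k. norm (h i))" for h
  proof -
    have "norm (A (h \<circ> p)) \<le> C * (\<Prod>i<k. norm (h i))" if "p permutes {..<k}" for p
      using multilinD(3)[OF A, of "h \<circ> p"] prod.permute[OF that, of "\<lambda>i. norm (h i)"] by (simp add: o_def)
    then have "norm (\<Sum>p\<in>?P. A (h \<circ> p)) \<le> of_nat (card ?P) * (C * (\<Prod>i<k. norm (h i)))"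
      by (intro sum_norm_bound) auto
    then show ?thesis by (simp add: symmetrized_def card divide_simps mult_ac)
  qed
  show "symmetrized k A (h(i := a *\<^sub>R x + b *\<^sub>R y))
      = a *\<^sub>R symmetrized k A (h(i := x)) + b *\<^sub>R symmetrized k A (h(i := y))" if i: "i < k" for h i x y a b
  proof -
    have "A (h(i := a *\<^sub>R x + b *\<^sub>R y) \<circ> p) = a *\<^sub>R A (h(i := x) \<circ> p) + b *\<^sub>R A (h(i := y) \<circ> p)"
      if p: "p permutes {..<k}" for p
    proof -
      have upd: "h(i := z) \<circ> p = (h \<circ> p)(inv p i := z)" for z
        using permutes_inverses[OF p] by (auto simp: fun_eq_iff)
      have "inv p i < k" using permutes_in_image[OF permutes_inv[OF p], of i] i by simp
      then show ?thesis unfolding upd by (rule multilinD(4)[OF A])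
    qed
    then show ?thesis
      by (simp add: symmetrized_def sum.distrib scaleR_sum_right[symmetric] scaleR_add_right mult.commute)
  qed
qed

text \<open>Collecting the terms of equal degree and averaging over permutations gives a power series in the
  usual sense, with one symmetric form in each degree.\<close>

lemma ps_on_homogeneous_expansion:
  fixes g :: "'e::real_normed_vector \<Rightarrow> 'x::banach"
  assumes g: "ps_on r M g" and r: "0 < r"
  obtains A C where "\<And>k. multilin k (C k) (A k)" "\<And>k h p. p permutes {..<k} \<Longrightarrow> A k (h \<circ> p) = A k h"
    "summable (\<lambda>k. C k * r ^ k)" "\<And>h. norm h < r \<Longrightarrow> (\<lambda>k. A k (\<lambda>_. h)) sums g h"
proof -
  obtain T :: "nat \<Rightarrow> (nat \<Rightarrow> 'e) \<Rightarrow> 'x" and d c S where T: "\<And>j. multilin (d j) (c j) (T j)"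
     and S: "((\<lambda>j. c j * r ^ d j) has_sum S) UNIV" "S \<le> M"
     and s: "\<And>h. norm h < r \<Longrightarrow> ((\<lambda>j. T j (\<lambda>_. h)) has_sum g h) UNIV"
    using g by (rule ps_onE) (rule that)
  note c0 = multilinD(1)[OF T]
  define I where "I k = {j. d j = k}" for k
  have csum: "c summable_on I k" for k
  proof -
    have "(\<lambda>j. c j * r ^ d j) summable_on I k"
      using summable_on_subset[OF has_sum_imp_summable[OF S(1)]] by simp
    then have "(\<lambda>j. c j * r ^ k) summable_on I k"
      by (rule summable_on_cong[THEN iffD1, rotated]) (simp add: I_def)
    then show ?thesis using r by (subst (asm) summable_on_cmult_left') auto
  qed
  define C where "C k = (\<Sum>\<^sub>\<infinity>j\<in>I k. c j)" for k
  define A where "A k h = (\<Sum>\<^sub>\<infinity>j\<in>I k. T j h)" for k h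
  have Tb: "norm (T j h) \<le> c j * (\<Prod>i<k. norm (h i))" if "j \<in> I k" for j k h
    using multilinD(3)[OF T, of j h] that by (simp add: I_def)
  have csum': "((\<lambda>j. c j * (\<Prod>i<k. norm (h i))) has_sum C k * (\<Prod>i<k. norm (h i))) (I k)" for k h
    unfolding C_def by (intro has_sum_cmult_left has_sum_infsum csum)
  have Ths: "((\<lambda>j. T j h) has_sum A k h) (I k)" for k h
  proof -
    have "(\<lambda>j. T j h) abs_summable_on I k"
      by (rule has_sum_comparison[OF csum' Tb])
    then show ?thesis
      unfolding A_def by (rule has_sum_infsum[OF abs_summable_summable])
  qed
  have mA: "multilin k (C k) (A k)" for k
  proof (rule multilinI)
    show "0 \<le> C k" unfolding C_def by (rule infsum_nonneg) (rule c0)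
    show "A k h = A k h'" if "\<And>i. i < k \<Longrightarrow> h i = h' i" for h h'
      unfolding A_def by (rule infsum_cong, rule multilinD(2)[OF T]) (use that in \<open>auto simp: I_def\<close>)
    show "norm (A k h) \<le> C k * (\<Prod>i<k. norm (h i))" for h
      by (rule norm_infsum_le[OF Ths csum' Tb])
    show "A k (h(i := a *\<^sub>R x + b *\<^sub>R y)) = a *\<^sub>R A k (h(i := x)) + b *\<^sub>R A k (h(i := y))" if "i < k" for h i x y a b
    proof (rule has_sum_unique[OF Ths])
      have "((\<lambda>j. a *\<^sub>R T j (h(i := x)) + b *\<^sub>R T j (h(i := y))) has_sum a *\<^sub>R A k (h(i := x)) + b *\<^sub>R A k (h(i := y))) (I k)"
        by (intro has_sum_add has_sum_scaleR Ths)
      then show "((\<lambda>j. T j (h(i := a *\<^sub>R x + b *\<^sub>R y))) has_sum a *\<^sub>R A k (h(i := x)) + b *\<^sub>R A k (h(i := y))) (I k)"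
        by (rule has_sum_cong[THEN iffD1, rotated]) (use that in \<open>auto simp: I_def multilinD(4)[OF T]\<close>)
    qed
  qed
  have bij: "bij_betw (\<lambda>j. (d j, j)) UNIV (Sigma UNIV I)"
    by (auto simp: bij_betw_def inj_on_def I_def)
  have "((\<lambda>(k, j). c j * r ^ k) has_sum S) (Sigma UNIV I)"
    using has_sum_reindex_bij_betw[OF bij, of "\<lambda>(k, j). c j * r ^ k" S] S(1) by simp
  then have "((\<lambda>k. C k * r ^ k) has_sum S) UNIV"
    by (rule has_sum_SigmaD) (auto intro!: has_sum_cmult_left has_sum_infsum csum simp: C_def)
  then have sumC: "summable (\<lambda>k. C k * r ^ k)"
    by (intro sums_summable[OF has_sum_imp_sums])
  have "(\<lambda>k. A k (\<lambda>_. h)) sums g h" if h: "norm h < r" for h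
  proof (rule has_sum_imp_sums)
    have "((\<lambda>(k, j). T j (\<lambda>_. h)) has_sum g h) (Sigma UNIV I)"
      using has_sum_reindex_bij_betw[OF bij, of "\<lambda>(k, j). T j (\<lambda>_. h)" "g h"] s[OF h] by simp
    then show "((\<lambda>k. A k (\<lambda>_. h)) has_sum g h) UNIV"
      by (rule has_sum_SigmaD) (use Ths in simp)
  qed
  then show thesis
    using that[where A = "\<lambda>k. symmetrized k (A k)" and C = C] mA sumC
    by (simp add: multilin_symmetrized symmetrized_diag symmetrized_symmetric)
qed

text \<open>Real analyticity between normed subspaces can be checked in Banach spaces: a chart \<open>J\<close> encodes the
  arguments and a linear map \<open>D\<close> decodes the values.\<close>

lemma real_analytic_mapI:
  fixes J :: "'a::real_vector \<Rightarrow> 'e::real_normed_vector" and D :: "'x::banach \<Rightarrow> 'b::real_vector"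
  assumes U: "openin (norm_topology E NE) U" and fU: "f ` U \<subseteq> F"
    and J: "\<And>x y a b. x \<in> E \<Longrightarrow> y \<in> E \<Longrightarrow> J (a *\<^sub>R x + b *\<^sub>R y) = a *\<^sub>R J x + b *\<^sub>R J y"
    and Jb: "\<And>x. x \<in> E \<Longrightarrow> norm (J x) \<le> c * NE x" and c: "0 < c"
    and D: "\<And>x y a b. D (a *\<^sub>R x + b *\<^sub>R y) = a *\<^sub>R D x + b *\<^sub>R D y"
    and DF: "\<And>x. D x \<in> F" and Db: "\<And>x. NF (D x) \<le> K * norm x" and K: "0 \<le> K"
    and NF: "\<And>y. y \<in> F \<Longrightarrow> 0 \<le> NF y"
    and loc: "\<And>u. u \<in> U \<Longrightarrow> \<exists>r>0. \<exists>M g. ps_on r M g \<and>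
        (\<forall>h\<in>E. norm (J h) < r \<longrightarrow> u + h \<in> U \<and> f (u + h) = D (g (J h)))"
  shows "real_analytic_map E NE F NF U f"
  unfolding real_analytic_map_def
proof (intro conjI ballI U fU)
  fix u assume u: "u \<in> U"
  obtain r M g where r: "r > 0" and g: "ps_on r M g"
    and fg: "\<And>h. h \<in> E \<Longrightarrow> norm (J h) < r \<Longrightarrow> u + h \<in> U \<and> f (u + h) = D (g (J h))"
    using loc[OF u] by blast
  obtain A C where A: "\<And>k. multilin k (C k) (A k)" "\<And>k h p. p permutes {..<k} \<Longrightarrow> A k (h \<circ> p) = A k h"
    and C: "summable (\<lambda>k. C k * r ^ k)" and s: "\<And>h. norm h < r \<Longrightarrow> (\<lambda>k. A k (\<lambda>_. h)) sums g h"
    by (rule ps_on_homogeneous_expansion[OF g r]) (rule that)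
  define A' where "A' k h = D (A k (\<lambda>i. J (h i)))" for k h
  define C' where "C' k = K * C k * c ^ k" for k
  have C0: "0 \<le> C k" for k by (rule multilinD(1)[OF A(1)])
  have D0: "D 0 = 0" using D[of 0 0 0 0] by simp
  have Dadd: "D (x + y) = D x + D y" for x y using D[of 1 x 1 y] by simp
  have Ddiff: "D (x - y) = D x - D y" for x y using D[of 1 x "-1" y] by simp
  have Dsum: "D (\<Sum>k<m. X k) = (\<Sum>k<m. D (X k))" for m :: nat and X
    by (induction m) (simp_all add: D0 Dadd)
  have Ab: "bounded_symmetric_multilinear E NE F NF k (A' k) (C' k)" for k
    unfolding bounded_symmetric_multilinear_def
  proof (intro conjI allI impI)
    show "A' k h = A' k h'" if "\<forall>i<k. h i = h' i" for h h'
      unfolding A'_def by (rule arg_cong[where f = D], rule multilinD(2)[OF A(1)]) (use that in auto)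
    show "A' k h \<in> F" for h unfolding A'_def by (rule DF)
    show "NF (A' k h) \<le> C' k * (\<Prod>i<k. NE (h i))" if hE: "\<forall>i<k. h i \<in> E" for h
    proof -
      have "NF (A' k h) \<le> K * norm (A k (\<lambda>i. J (h i)))"
        unfolding A'_def by (rule Db)
      also have "\<dots> \<le> K * (C k * (\<Prod>i<k. norm (J (h i))))"
        by (intro mult_left_mono multilinD(3)[OF A(1)] K)
      also have "\<dots> \<le> K * (C k * (\<Prod>i<k. c * NE (h i)))"
        using hE by (intro mult_left_mono K C0 prod_mono) (auto intro: Jb)
      finally show ?thesis by (simp add: C'_def prod.distrib mult_ac)
    qed
    show "A' k (h(i := a *\<^sub>R x + b *\<^sub>R y)) = a *\<^sub>R A' k (h(i := x)) + b *\<^sub>R A' k (h(i := y))"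
      if "(\<forall>j<k. h j \<in> E) \<and> i < k \<and> x \<in> E \<and> y \<in> E" for h i x y a b
    proof -
      have upd: "(\<lambda>j. J ((h(i := z)) j)) = (\<lambda>j. J (h j))(i := J z)" for z by auto
      show ?thesis
        using that unfolding A'_def upd by (simp only: J multilinD(4)[OF A(1)] D)
    qed
    show "A' k (h \<circ> p) = A' k h" if "(\<forall>i<k. h i \<in> E) \<and> p permutes {..<k}" for h p
      using A(2)[of p k "\<lambda>i. J (h i)"] that by (simp add: A'_def o_def)
  qed
  show "\<exists>A C. \<exists>r>0. (\<forall>k. 0 \<le> C k \<and> bounded_symmetric_multilinear E NE F NF k (A k) (C k)) \<and>
        summable (\<lambda>k. C k * r ^ k) \<and>
        (\<forall>h\<in>E. NE h < r \<longrightarrow> u + h \<in> U \<and> (\<lambda>m. NF (f (u + h) - (\<Sum>k<m. A k (\<lambda>_. h)))) \<longlonglongrightarrow> 0)"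
  proof (rule exI[of _ A'], rule exI[of _ C'], rule exI[of _ "r / c"], intro conjI allI ballI impI)
    show "0 < r / c" using r c by simp
    show "0 \<le> C' k" for k using K c C0 by (simp add: C'_def)
    show "bounded_symmetric_multilinear E NE F NF k (A' k) (C' k)" for k by (rule Ab)
    have "(\<lambda>k. C' k * (r / c) ^ k) = (\<lambda>k. K * (C k * r ^ k))"
      using c by (auto simp: C'_def power_divide)
    then show "summable (\<lambda>k. C' k * (r / c) ^ k)"
      using C by (simp add: summable_mult)
    fix h assume h: "h \<in> E" "NE h < r / c"
    then have Jh: "norm (J h) < r"
      using Jb[OF h(1)] c by (simp add: field_simps)
    show "u + h \<in> U" using fg[OF h(1) Jh] by blast
    have eq: "f (u + h) - (\<Sum>k<m. A' k (\<lambda>_. h)) = D (g (J h) - (\<Sum>k<m. A k (\<lambda>_. J h)))" for m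
      using fg[OF h(1) Jh] by (simp add: A'_def Dsum Ddiff)
    have "(\<lambda>m. (\<Sum>k<m. A k (\<lambda>_. J h))) \<longlonglongrightarrow> g (J h)"
      using s[OF Jh] by (simp add: sums_def)
    then have "(\<lambda>m. K * norm (g (J h) - (\<Sum>k<m. A k (\<lambda>_. J h)))) \<longlonglongrightarrow> K * norm (g (J h) - g (J h))"
      by (intro tendsto_intros)
    then have lim: "(\<lambda>m. K * norm (g (J h) - (\<Sum>k<m. A k (\<lambda>_. J h)))) \<longlonglongrightarrow> 0" by simp
    show "(\<lambda>m. NF (f (u + h) - (\<Sum>k<m. A' k (\<lambda>_. h)))) \<longlonglongrightarrow> 0"
      unfolding eq
      by (rule tendsto_sandwich[OF _ _ tendsto_const lim]) (auto intro!: always_eventually NF DF Db)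
  qed
qed

section \<open>Hardy algebras and the gauge map\<close>

text \<open>A Banach algebra of continuous functions with a conjugation \<open>cj\<close>, the mean and
  the projection \<open>P\<close> onto positive frequencies.  Elements are separated by the evaluations \<open>ev\<close>, so
  algebraic identities are verified pointwise.\<close>

locale hardy_algebra =
  fixes ev :: "'x::banach \<Rightarrow> real \<Rightarrow> complex"
    and mul :: "'x \<Rightarrow> 'x \<Rightarrow> 'x" and one :: 'x and cs :: "complex \<Rightarrow> 'x \<Rightarrow> 'x"
    and cj :: "'x \<Rightarrow> 'x" and mean :: "'x \<Rightarrow> complex" and P :: "'x \<Rightarrow> 'x"
  assumes ev_eqI: "(\<And>t. ev a t = ev b t) \<Longrightarrow> a = b"
    and bl_ev: "bounded_linear (\<lambda>a. ev a t)"
    and ev_cont: "continuous_on UNIV (ev a)"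
    and bb_mul: "bounded_bilinear mul" and ev_mul: "ev (mul a b) t = ev a t * ev b t"
    and ev_one: "ev one t = 1"
    and bl_cs: "bounded_linear (cs c)" and ev_cs: "ev (cs c a) t = c * ev a t"
    and bl_cj: "bounded_linear cj" and ev_cj: "ev (cj a) t = cnj (ev a t)"
    and bl_mean: "bounded_linear mean" and mean_one: "mean one = 1"
    and mean_cs: "mean (cs c a) = c * mean a" and mean_cj: "mean (cj a) = cnj (mean a)"
    and mean_definite: "mean (mul a (cj a)) = 0 \<Longrightarrow> a = 0"
    and bl_P: "bounded_linear P" and P_P: "P (P a) = P a" and P_cs: "P (cs c a) = cs c (P a)"
    and P_one: "P one = 0" and mean_P: "mean (P a) = 0" and P_cj_P: "P (cj (P a)) = 0"
    and decomp: "a = P a + cs (mean a) one + cj (P (cj a))"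
    and P_mul_P: "P (mul (P a) (P b)) = mul (P a) (P b)"
begin

sublocale ev: bounded_linear "\<lambda>a. ev a t" for t by (rule bl_ev)
sublocale mul: bounded_bilinear mul by (rule bb_mul)
sublocale cs: bounded_linear "cs c" for c by (rule bl_cs)
sublocale cj: bounded_linear cj by (rule bl_cj)
sublocale mean: bounded_linear mean by (rule bl_mean)
sublocale P: bounded_linear P by (rule bl_P)

lemmas ev_simps = ev_mul ev_one ev_cs ev_cj ev.add ev.diff ev.neg ev.zero ev.scaleR

lemma mul_commute: "mul a b = mul b a"
  by (rule ev_eqI) (simp add: ev_simps)

lemma cj_cj: "cj (cj a) = a"
  by (rule ev_eqI) (simp add: ev_simps)

lemma cj_one: "cj one = one"
  by (rule ev_eqI) (simp add: ev_simps)

lemma cj_mul: "cj (mul a b) = mul (cj a) (cj b)"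
  by (rule ev_eqI) (simp add: ev_simps)

lemma cj_cs: "cj (cs c a) = cs (cnj c) (cj a)"
  by (rule ev_eqI) (simp add: ev_simps)

lemma mul_one: "mul one a = a" "mul a one = a"
  by (rule ev_eqI, simp add: ev_simps)+

lemma cs_zero [simp]: "cs 0 a = 0"
  by (rule ev_eqI) (simp add: ev_simps)

text \<open>Functions without negative frequencies; \<open>hardy0\<close> excludes the frequency 0 as well.\<close>

definition hardy :: "'x \<Rightarrow> bool" where "hardy a \<longleftrightarrow> P (cj a) = 0"
definition hardy0 :: "'x \<Rightarrow> bool" where "hardy0 a \<longleftrightarrow> P a = a"

lemma hardy0_P: "hardy0 (P a)" by (simp add: hardy0_def P_P)
lemma hardy0_hardy: "hardy0 a \<Longrightarrow> hardy a" unfolding hardy_def hardy0_def by (metis P_cj_P)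
lemma hardy0_mean: "hardy0 a \<Longrightarrow> mean a = 0" unfolding hardy0_def by (metis mean_P)
lemma hardy_one: "hardy one" by (simp add: hardy_def cj_one P_one)
lemma hardy_add: "hardy a \<Longrightarrow> hardy b \<Longrightarrow> hardy (a + b)" by (simp add: hardy_def cj.add P.add)
lemma hardy_diff: "hardy a \<Longrightarrow> hardy b \<Longrightarrow> hardy (a - b)" by (simp add: hardy_def cj.diff P.diff)
lemma hardy_cs: "hardy a \<Longrightarrow> hardy (cs c a)" by (simp add: hardy_def cj_cs P_cs cs.zero)
lemma hardy0_add: "hardy0 a \<Longrightarrow> hardy0 b \<Longrightarrow> hardy0 (a + b)" by (simp add: hardy0_def P.add)
lemma hardy0_diff: "hardy0 a \<Longrightarrow> hardy0 b \<Longrightarrow> hardy0 (a - b)" by (simp add: hardy0_def P.diff)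
lemma hardy0_cs: "hardy0 a \<Longrightarrow> hardy0 (cs c a)" by (simp add: hardy0_def P_cs)
lemma hardy_decomp: "hardy a \<Longrightarrow> a = P a + cs (mean a) one"
  using decomp[of a] by (simp add: hardy_def cj.zero)

lemma hardy_zero_mean: "hardy a \<Longrightarrow> mean a = 0 \<Longrightarrow> hardy0 a"
  using hardy_decomp[of a] by (simp add: hardy0_def)

lemma mul_hardy_eq:
  assumes "hardy a" "hardy b"
  shows "mul a b = mul (P a) (P b) + cs (mean a) (P b) + cs (mean b) (P a) + cs (mean a * mean b) one"
proof -
  have "mul a b = mul (P a + cs (mean a) one) (P b + cs (mean b) one)"
    using hardy_decomp assms by simp
  also have "\<dots> = mul (P a) (P b) + cs (mean a) (P b) + cs (mean b) (P a) + cs (mean a * mean b) one"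
    by (rule ev_eqI) (simp add: ev_simps algebra_simps)
  finally show ?thesis .
qed

lemma hardy0_mul_P: "hardy0 (mul (P a) (P b))"
  by (simp add: hardy0_def P_mul_P)

lemma hardy_mul: "hardy a \<Longrightarrow> hardy b \<Longrightarrow> hardy (mul a b)"
  by (subst mul_hardy_eq)
     (assumption+, intro hardy_add hardy_cs hardy_one hardy0_hardy[OF hardy0_P] hardy0_hardy[OF hardy0_mul_P])

lemma mean_mul: "hardy a \<Longrightarrow> hardy b \<Longrightarrow> mean (mul a b) = mean a * mean b"
  by (subst mul_hardy_eq) (simp_all add: mean.add mean_cs mean_P mean_one hardy0_mean[OF hardy0_mul_P])

lemma hardy0_mul: "hardy0 a \<Longrightarrow> hardy b \<Longrightarrow> hardy0 (mul a b)"
  by (intro hardy_zero_mean hardy_mul) (simp_all add: mean_mul hardy0_mean hardy0_hardy)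

lemma hardy0_mul': "hardy a \<Longrightarrow> hardy0 b \<Longrightarrow> hardy0 (mul a b)"
  by (subst mul_commute) (rule hardy0_mul)

lemma P_cj_hardy: "hardy a \<Longrightarrow> P (cj a) = 0"
  by (simp add: hardy_def)

text \<open>Replacing \<open>b\<close> by \<open>P b\<close> changes the product by the conjugate of a Hardy function, which the
  projection annihilates.\<close>

lemma P_mul_P_cj:
  assumes "hardy a" shows "P (mul (P b) (cj a)) = P (mul b (cj a))"
proof -
  define q where "q = cs (cnj (mean b)) one + P (cj b)"
  have q: "hardy q"
    unfolding q_def by (intro hardy_add hardy_cs hardy_one hardy0_hardy hardy0_P)
  have "b = P b + cj q"
    using decomp[of b] by (simp add: q_def cj.add cj_cs cj_one add.assoc)
  then have "mul b (cj a) = mul (P b) (cj a) + cj (mul q a)"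
    by (metis mul.add_left cj_mul)
  then show ?thesis
    using P_cj_hardy[OF hardy_mul[OF q assms]] by (simp add: P.add)
qed

lemma real_decomp:
  assumes "cj a = a" "mean a = 0" shows "a = P a + cj (P a)"
  using decomp[of a] assms by simp

definition Km :: real where "Km = (SOME K. 0 < K \<and> (\<forall>a b. norm (mul a b) \<le> norm a * norm b * K))"

lemma Km: "0 < Km" "norm (mul a b) \<le> Km * (norm a * norm b)"
proof -
  have "\<exists>K. 0 < K \<and> (\<forall>a b. norm (mul a b) \<le> norm a * norm b * K)"
    using mul.pos_bounded by blast
  from someI_ex[OF this] have *: "0 < Km \<and> (\<forall>a b. norm (mul a b) \<le> norm a * norm b * Km)"
    unfolding Km_def .
  then show "0 < Km" by blast
  show "norm (mul a b) \<le> Km * (norm a * norm b)"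
    using * by (simp add: mult.commute)
qed

primrec pw :: "'x \<Rightarrow> nat \<Rightarrow> 'x" where
  "pw a 0 = one" | "pw a (Suc n) = mul a (pw a n)"

lemma ev_pw: "ev (pw a n) t = ev a t ^ n"
  by (induction n) (simp_all add: ev_simps)

lemma norm_pw: "norm (pw a n) \<le> norm one * (Km * norm a) ^ n"
proof (induction n)
  case (Suc n)
  have "norm (pw a (Suc n)) \<le> Km * (norm a * norm (pw a n))"
    using Km(2)[of a "pw a n"] by simp
  also have "\<dots> \<le> Km * (norm a * (norm one * (Km * norm a) ^ n))"
    using Suc Km(1) by (intro mult_left_mono) auto
  finally show ?case by (simp add: mult_ac)
qed simp

lemma hardy0_pw: "hardy0 a \<Longrightarrow> hardy0 (pw a (Suc n))"
  by (induction n) (auto simp: mul_one intro: hardy0_mul hardy0_hardy)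

text \<open>The series is formed in the algebra; its value at a point is the scalar series of the value.\<close>

definition pser :: "(nat \<Rightarrow> real) \<Rightarrow> 'x \<Rightarrow> 'x" where
  "pser c a = (\<Sum>n. c n *\<^sub>R pw a n)"

lemma pser_summable:
  assumes "summable (\<lambda>n. \<bar>c n\<bar> * (Km * norm a) ^ n)"
  shows "summable (\<lambda>n. norm (c n *\<^sub>R pw a n))"
proof (rule summable_comparison_test')
  show "summable (\<lambda>n. norm one * (\<bar>c n\<bar> * (Km * norm a) ^ n))"
    using assms by (rule summable_mult)
  show "norm (norm (c n *\<^sub>R pw a n)) \<le> norm one * (\<bar>c n\<bar> * (Km * norm a) ^ n)" for n
    using mult_left_mono[OF norm_pw, of "\<bar>c n\<bar>" a n] by (simp add: mult_ac)
qed

lemma pser_sums: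
  assumes "summable (\<lambda>n. \<bar>c n\<bar> * (Km * norm a) ^ n)"
  shows "(\<lambda>n. c n *\<^sub>R pw a n) sums pser c a"
  unfolding pser_def by (rule summable_sums[OF summable_norm_cancel[OF pser_summable[OF assms]]])

lemma ev_pser_sums:
  assumes "summable (\<lambda>n. \<bar>c n\<bar> * (Km * norm a) ^ n)"
  shows "(\<lambda>n. of_real (c n) * ev a t ^ n) sums ev (pser c a) t"
  using ev.sums[OF pser_sums[OF assms], of t] by (simp add: ev_simps ev_pw scaleR_conv_of_real)

lemma hardy0_suminf:
  assumes "X sums S" "\<And>n. hardy0 (X n)" shows "hardy0 S"
proof -
  have "(\<lambda>n. P (X n)) sums P S" by (rule P.sums[OF assms(1)])
  then have "X sums P S" using assms(2) by (simp add: hardy0_def)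
  then show ?thesis using assms(1) sums_unique2 unfolding hardy0_def by blast
qed

lemma hardy0_pser:
  assumes "summable (\<lambda>n. \<bar>c n\<bar> * (Km * norm a) ^ n)" "hardy0 a" "c 0 = 0"
  shows "hardy0 (pser c a)"
proof (rule hardy0_suminf[OF pser_sums[OF assms(1)]])
  show "hardy0 (c n *\<^sub>R pw a n)" for n
    using hardy0_pw[OF assms(2)] assms(3) by (cases n) (auto simp: hardy0_def P.scaleR P.zero)
qed

definition EXP :: "'x \<Rightarrow> 'x" where "EXP = pser (\<lambda>n. 1 / fact n)"

lemma EXP_summable: "summable (\<lambda>n. \<bar>1 / fact n\<bar> * (x::real) ^ n)"
  using summable_exp[of x] by (simp add: field_simps)

lemma ev_EXP: "ev (EXP a) t = exp (ev a t)"
proof -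
  have "(\<lambda>n. of_real (1 / fact n) * ev a t ^ n) sums ev (EXP a) t"
    unfolding EXP_def by (rule ev_pser_sums[OF EXP_summable])
  moreover have "(\<lambda>n. of_real (1 / fact n) * ev a t ^ n) sums exp (ev a t)"
    using exp_converges[of "ev a t"] by (simp add: scaleR_conv_of_real field_simps)
  ultimately show ?thesis by (rule sums_unique2)
qed

lemma hardy0_EXP: assumes "hardy0 a" shows "hardy0 (EXP a - one)"
proof -
  define c :: "nat \<Rightarrow> real" where "c n = (if n = 0 then 0 else 1 / fact n)" for n
  have s: "summable (\<lambda>n. \<bar>c n\<bar> * (Km * norm a) ^ n)"
    by (rule summable_comparison_test'[OF EXP_summable[of "Km * norm a"]]) (use Km(1) in \<open>auto simp: c_def\<close>)
  have "EXP a - one = pser c a"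
  proof (rule ev_eqI)
    fix t
    have "(\<lambda>n. of_real (c n) * ev a t ^ n) sums ev (pser c a) t"
      by (rule ev_pser_sums[OF s])
    moreover have "(\<lambda>n. of_real (1 / fact n) * ev a t ^ n - (if n = 0 then 1 else 0)) sums (ev (EXP a) t - 1)"
      unfolding EXP_def by (intro sums_diff ev_pser_sums[OF EXP_summable] sums_single)
    moreover have "(\<lambda>n. of_real (1 / fact n) * ev a t ^ n - (if n = 0 then 1 else 0)) = (\<lambda>n. of_real (c n) * ev a t ^ n)"
      by (auto simp: c_def)
    ultimately show "ev (EXP a - one) t = ev (pser c a) t"
      using sums_unique2 by (fastforce simp: ev_simps)
  qed
  moreover have "hardy0 (pser c a)"
    by (rule hardy0_pser[OF s assms]) (simp add: c_def)
  ultimately show ?thesis by simp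
qed

lemma hardy_EXP: "hardy0 a \<Longrightarrow> hardy (EXP a)"
  using hardy_add[OF hardy0_hardy[OF hardy0_EXP] hardy_one, of a] by simp

definition LOG :: "'x \<Rightarrow> 'x" where "LOG = pser (\<lambda>n. (-1) ^ Suc n / real n)"

lemma LOG_summable:
  assumes "0 \<le> x" "x < 1" shows "summable (\<lambda>n. \<bar>(-1) ^ Suc n / real n\<bar> * (x::real) ^ n)"
proof (rule summable_comparison_test'[OF summable_geometric])
  show "norm (\<bar>(-1) ^ Suc n / real n\<bar> * x ^ n) \<le> x ^ n" if "n \<ge> 0" for n
  proof (cases n)
    case (Suc m)
    have "inverse (real n) * x ^ n \<le> 1 * x ^ n"
      using assms Suc by (intro mult_right_mono) (auto simp: field_simps)
    then show ?thesis using assms by (simp add: abs_mult field_simps)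
  qed (use assms in simp)
qed (use assms in simp)

text \<open>Convergence of the geometric series of \<open>a\<close> in the algebra forces \<open>|a| < 1\<close> at every point.\<close>

lemma exp_LOG:
  assumes "Km * norm a < 1"
  shows "exp (ev (LOG a) t) = 1 + ev a t"
proof -
  have K0: "0 \<le> Km * norm a" using Km(1) by simp
  have "summable (\<lambda>n. \<bar>1::real\<bar> * (Km * norm a) ^ n)"
    using assms K0 by (simp add: summable_geometric_iff)
  from ev_pser_sums[OF this, of t] have "summable (\<lambda>n. ev a t ^ n)"
    by (simp add: sums_iff)
  then have lt: "cmod (ev a t) < 1" by (simp add: summable_geometric_iff)
  have "(\<lambda>n. of_real ((-1) ^ Suc n / real n) * ev a t ^ n) sums ev (LOG a) t"
    unfolding LOG_def by (rule ev_pser_sums[OF LOG_summable[OF K0 assms]])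
  moreover have "(\<lambda>n. (-1) ^ Suc n / of_nat n * ev a t ^ n) sums Ln (1 + ev a t)"
    by (rule Ln_series[OF lt])
  ultimately have "ev (LOG a) t = Ln (1 + ev a t)"
    using sums_unique2 by fastforce
  moreover have "1 + ev a t \<noteq> 0" using lt by (metis add.commute add_eq_0_iff norm_minus_cancel norm_one less_irrefl)
  ultimately show ?thesis by simp
qed

lemma hardy0_LOG: "Km * norm a < 1 \<Longrightarrow> hardy0 a \<Longrightarrow> hardy0 (LOG a)"
  unfolding LOG_def using Km(1) by (intro hardy0_pser LOG_summable) auto

text \<open>Real-valued functions of mean zero.\<close>

definition real0 :: "'x \<Rightarrow> bool" where "real0 U \<longleftrightarrow> cj U = U \<and> mean U = 0"

definition gauge :: "'x \<Rightarrow> 'x" where "gauge U = P (EXP (cs (- \<i>) U))"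

definition hankel :: "'x \<Rightarrow> 'x \<Rightarrow> 'x" where "hankel v f = P (mul v (cj f))"

text \<open>For \<open>F = P U\<close>, the function \<open>exp (- \<i> U)\<close> is the quotient of this Hardy function by its
  conjugate.  The inverse is again an exponential, hence again a Hardy function.\<close>

definition outer :: "'x \<Rightarrow> 'x" where "outer F = EXP (cs (- \<i>) F)"
definition outer_inv :: "'x \<Rightarrow> 'x" where "outer_inv F = EXP (cs \<i> F)"

lemma ev_outer: "ev (outer F) t = exp (- \<i> * ev F t)" "ev (outer_inv F) t = exp (\<i> * ev F t)"
  by (simp_all add: outer_def outer_inv_def ev_EXP ev_simps)

lemma outer_outer_inv: "ev (outer F) t * ev (outer_inv F) t = 1"
  by (simp add: ev_outer exp_minus)

lemma hardy_outer: "hardy0 F \<Longrightarrow> hardy (outer F)" "hardy0 F \<Longrightarrow> hardy (outer_inv F)"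
  by (simp_all add: outer_def outer_inv_def hardy_EXP hardy0_cs)

lemma hardy0_outer: "hardy0 F \<Longrightarrow> hardy0 (outer F - one)"
  by (simp add: outer_def hardy0_EXP hardy0_cs)

lemma EXP_factor: "EXP (cs (- \<i>) (F + cj F)) = mul (outer F) (cj (outer_inv F))"
  by (rule ev_eqI) (simp add: ev_EXP ev_simps ev_outer exp_cnj mult_exp_exp algebra_simps)

lemma real0_sum: "hardy0 F \<Longrightarrow> real0 (F + cj F)"
  by (simp add: real0_def cj.add cj_cj add.commute mean.add mean_cj hardy0_mean)

lemma gauge_outer: "gauge (F + cj F) = P (mul (outer F) (cj (outer_inv F)))"
  by (simp add: gauge_def EXP_factor)

lemma hankel_gauge:
  assumes "hardy f" shows "hankel (gauge (F + cj F)) f = P (mul (outer F) (cj (mul (outer_inv F) f)))"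
proof -
  have "mul (mul (outer F) (cj (outer_inv F))) (cj f) = mul (outer F) (cj (mul (outer_inv F) f))"
    by (rule ev_eqI) (simp add: ev_simps)
  then show ?thesis
    unfolding hankel_def gauge_outer by (simp add: P_mul_P_cj[OF assms])
qed

text \<open>Multiply \<open>P (h / cnj h)\<close> by \<open>cnj h\<close> and project: the part of \<open>h / cnj h\<close> that the inner projection
  drops contributes nothing.\<close>

lemma gauge_equation:
  assumes F: "hardy0 F"
  shows "outer F - one - hankel (gauge (F + cj F)) (outer F - one) = gauge (F + cj F)"
proof -
  have h: "hardy (outer F - one)" by (rule hardy0_hardy[OF hardy0_outer[OF F]])
  have "mul (outer_inv F) (outer F - one) = one - outer_inv F"
    by (rule ev_eqI) (use outer_outer_inv in \<open>simp add: ev_simps algebra_simps\<close>)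
  then have "mul (outer F) (cj (mul (outer_inv F) (outer F - one))) = outer F - mul (outer F) (cj (outer_inv F))"
    by (simp add: cj.diff cj_one mul.diff_right mul_one)
  then have "P (mul (outer F) (cj (mul (outer_inv F) (outer F - one)))) = P (outer F) - gauge (F + cj F)"
    by (simp add: P.diff gauge_outer)
  then have "hankel (gauge (F + cj F)) (outer F - one) = P (outer F) - gauge (F + cj F)"
    by (simp only: hankel_gauge[OF h])
  moreover have "P (outer F) = outer F - one"
    using hardy0_outer[OF F] by (simp add: hardy0_def P.diff P_one)
  ultimately show ?thesis by simp
qed

text \<open>The equation says that \<open>v * cnj h\<close> differs from \<open>h\<close> by the conjugate of a Hardy function.
  Division by \<open>cnj h\<close> preserves this and turns \<open>h\<close> into \<open>h / cnj h\<close>.\<close>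

lemma gauge_of_equation:
  assumes F: "hardy0 F" and v: "hardy0 v"
    and eq: "outer F - one - hankel v (outer F - one) = v"
  shows "gauge (F + cj F) = v"
proof -
  let ?h = "outer F" and ?H = "outer_inv F"
  have Ph: "P ?h = ?h - one"
    using hardy0_outer[OF F] by (simp add: hardy0_def P.diff P_one)
  have "P (mul v (cj ?h)) = hankel v (?h - one) + P v"
    by (simp add: hankel_def cj.diff cj_one mul.diff_right mul_one P.diff)
  also have "\<dots> = ?h - one" using eq v by (simp add: hardy0_def algebra_simps)
  finally have Pv: "P (mul v (cj ?h)) = ?h - one" .
  define q where "q = cj (mul v (cj ?h) - ?h)"
  have q: "hardy q" by (simp add: hardy_def q_def cj_cj P.diff Pv Ph)
  have "v = mul ?h (cj ?H) + cj (mul q ?H)"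
  proof (rule ev_eqI)
    fix t
    have "cnj (ev ?h t) * cnj (ev ?H t) = 1"
      using outer_outer_inv[of F t] by (metis complex_cnj_mult complex_cnj_one)
    then show "ev v t = ev (mul ?h (cj ?H) + cj (mul q ?H)) t"
      by (simp add: ev_simps q_def algebra_simps)
  qed
  then have "P v = gauge (F + cj F) + P (cj (mul q ?H))"
    by (metis P.add gauge_outer)
  then show ?thesis
    using v P_cj_hardy[OF hardy_mul[OF q hardy_outer(2)[OF F]]] by (simp add: hardy0_def)
qed

text \<open>The function \<open>1 / |h|\<^sup>2\<close>, whose imaginary multiples are the imaginary solutions \<open>b\<close> of
  \<open>P (h * b) = 0\<close>; its mean decides whether any of them has mean zero.\<close>

definition kernel :: "'x \<Rightarrow> 'x" where "kernel F = mul (outer_inv F) (cj (outer_inv F))"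

lemma mean_kernel: "mean (kernel F) \<noteq> 0"
proof
  assume "mean (kernel F) = 0"
  then have "outer_inv F = 0" unfolding kernel_def by (rule mean_definite)
  then show False using outer_outer_inv[of F 0] by (simp add: ev.zero)
qed

text \<open>With \<open>a = f / h\<close> the function \<open>b = a - cnj a\<close> has \<open>h * b\<close> equal to the conjugate of a Hardy function
  \<open>q\<close>.  Then \<open>q * h\<close> is a Hardy function equal to minus its conjugate, hence constant, and \<open>b\<close> is a
  multiple of \<open>1 / |h|\<^sup>2\<close> of mean zero.\<close>

lemma hankel_fixed_point:
  assumes F: "hardy0 F" and f: "hardy0 f" and eq: "hankel (gauge (F + cj F)) f = f"
  shows "f = 0"
proof -
  let ?h = "outer F" and ?H = "outer_inv F"
  define a where "a = mul ?H f"
  have a: "hardy0 a" unfolding a_def by (rule hardy0_mul'[OF hardy_outer(2)[OF F] f])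
  have fa: "f = mul ?h a"
    by (rule ev_eqI) (use outer_outer_inv in \<open>simp add: a_def ev_simps mult.assoc[symmetric]\<close>)
  define b where "b = a - cj a"
  have "P (mul ?h b) = P (mul ?h a) - P (mul ?h (cj a))"
    by (simp add: b_def mul.diff_right P.diff)
  also have "P (mul ?h a) = f" using f fa by (simp add: hardy0_def)
  also have "P (mul ?h (cj a)) = f"
    using eq hankel_gauge[OF hardy0_hardy[OF f], of F] by (simp add: a_def)
  also have "f - f = 0" by simp
  finally have Phb: "P (mul ?h b) = 0" .
  define q where "q = cj (mul ?h b)"
  have q: "hardy q" by (simp add: hardy_def q_def cj_cj Phb)
  define p where "p = mul q ?h"
  have p: "hardy p" unfolding p_def by (rule hardy_mul[OF q hardy_outer(1)[OF F]])
  have "p = - cj p"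
    by (rule ev_eqI) (simp add: p_def q_def b_def ev_simps algebra_simps)
  then have "P p = 0" using P_cj_hardy[OF p] by (metis P.neg minus_zero)
  then have pm: "p = cs (mean p) one" using hardy_decomp[OF p] by simp
  have b_eq: "b = cs (cnj (mean p)) (kernel F)"
  proof (rule ev_eqI)
    fix t
    have 1: "ev ?h t * ev ?H t = 1" by (rule outer_outer_inv)
    then have 2: "cnj (ev ?h t) * cnj (ev ?H t) = 1"
      by (metis complex_cnj_mult complex_cnj_one)
    have "ev (cj p) t = cnj (mean p)" by (subst pm) (simp add: ev_simps)
    moreover have "ev (cj p) t = cnj (ev ?h t) * ev ?h t * ev b t"
      by (simp add: p_def q_def ev_simps)
    ultimately have 3: "cnj (ev ?h t) * ev ?h t * ev b t = cnj (mean p)" by simp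
    have "ev b t = ev b t * (ev ?h t * ev ?H t) * (cnj (ev ?h t) * cnj (ev ?H t))"
      by (simp only: 1 2 mult_1_right)
    also have "\<dots> = (cnj (ev ?h t) * ev ?h t * ev b t) * (ev ?H t * cnj (ev ?H t))"
      by (simp only: mult_ac)
    finally show "ev b t = ev (cs (cnj (mean p)) (kernel F)) t"
      unfolding 3 by (simp add: kernel_def ev_simps)
  qed
  have "mean b = 0" by (simp add: b_def mean.diff mean_cj hardy0_mean[OF a])
  then have "mean p = 0" using mean_kernel[of F] by (simp add: b_eq mean_cs)
  then have "b = 0" by (simp add: b_eq)
  then have "a = cj a" by (simp add: b_def)
  then have "a = 0"
    using a P_cj_hardy[OF hardy0_hardy[OF a]] by (simp add: hardy0_def)
  then show ?thesis by (simp add: fa mul.zero_right)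
qed

lemma cs_conv: "cs c a = Re c *\<^sub>R a + Im c *\<^sub>R cs \<i> a"
  by (rule ev_eqI) (simp add: ev_simps scaleR_conv_of_real complex_eq_iff algebra_simps)

lemma bl_cs_left: "bounded_linear (\<lambda>c. cs c a)"
proof -
  have "(\<lambda>c. cs c a) = (\<lambda>c. Re c *\<^sub>R a + Im c *\<^sub>R cs \<i> a)"
    by (rule ext) (rule cs_conv)
  moreover have "bounded_linear \<dots>"
    by (intro bounded_linear_add bounded_linear_compose[OF bounded_linear_scaleR_left] bounded_linear_Re bounded_linear_Im)
  ultimately show ?thesis by simp
qed

text \<open>The solution of \<open>f - K f = g\<close>.  Here \<open>r\<close> is \<open>2 Re (g * cnj h)\<close>, \<open>2 * P r + mean r\<close> is the Hardy function
  with real part \<open>r\<close> and real mean, and the multiple of the kernel corrects the mean of \<open>b\<close>.\<close>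

definition hankel_resolvent :: "'x \<Rightarrow> 'x \<Rightarrow> 'x" where
  "hankel_resolvent F g =
    (let r = mul g (cj (outer F)) + mul (cj g) (outer F);
         q = cs (-1/2) (mul (outer_inv F) (2 *\<^sub>R P r + cs (mean r) one));
         b = mul (g + cj q) (outer_inv F)
     in mul (outer F) (P (b - cs (mean b / mean (kernel F)) (kernel F))))"

lemma bl_hankel_resolvent: "bounded_linear (hankel_resolvent F)"
proof -
  define r where "r g = mul g (cj (outer F)) + mul (cj g) (outer F)" for g
  define q where "q g = cs (-1/2) (mul (outer_inv F) (2 *\<^sub>R P (r g) + cs (mean (r g)) one))" for g
  define b where "b g = mul (g + cj (q g)) (outer_inv F)" for g
  have r: "bounded_linear r"
    unfolding r_def
    by (intro bounded_linear_add mul.bounded_linear_left bounded_linear_compose[OF mul.bounded_linear_left bl_cj])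
  have q: "bounded_linear q"
    unfolding q_def
    by (intro bounded_linear_compose[OF bl_cs] bounded_linear_compose[OF mul.bounded_linear_right]
        bounded_linear_add bounded_linear_compose[OF bounded_linear_scaleR_right]
        bounded_linear_compose[OF bl_P r] bounded_linear_compose[OF bl_cs_left] bounded_linear_compose[OF bl_mean r])
  have b: "bounded_linear b"
    unfolding b_def
    by (intro bounded_linear_compose[OF mul.bounded_linear_left] bounded_linear_add bounded_linear_ident
        bounded_linear_compose[OF bl_cj q])
  have "hankel_resolvent F = (\<lambda>g. mul (outer F) (P (b g - cs (mean (b g) / mean (kernel F)) (kernel F))))"
    by (simp add: hankel_resolvent_def Let_def r_def q_def b_def fun_eq_iff)
  moreover have "bounded_linear \<dots>"
    by (intro bounded_linear_compose[OF mul.bounded_linear_right] bounded_linear_compose[OF bl_P]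
        bounded_linear_sub b bounded_linear_compose[OF bl_cs_left]
        bounded_linear_compose[OF bounded_linear_divide] bounded_linear_compose[OF bl_mean b])
  ultimately show ?thesis by simp
qed

lemma hardy0_hankel_resolvent: "hardy0 F \<Longrightarrow> hardy0 (hankel_resolvent F g)"
  unfolding hankel_resolvent_def Let_def by (intro hardy0_mul' hardy_outer hardy0_P)

lemma hankel_resolvent:
  assumes F: "hardy0 F" and g: "hardy0 g"
  defines "f \<equiv> hankel_resolvent F g"
  shows "f - hankel (gauge (F + cj F)) f = g"
proof -
  let ?h = "outer F" and ?H = "outer_inv F"
  have hH: "ev ?h t * ev ?H t = 1" for t by (rule outer_outer_inv)
  have hH': "cnj (ev ?h t) * cnj (ev ?H t) = 1" for t
    using hH by (metis complex_cnj_mult complex_cnj_one)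
  define r where "r = mul g (cj ?h) + mul (cj g) ?h"
  define \<rho> where "\<rho> = 2 *\<^sub>R P r + cs (mean r) one"
  define q0 where "q0 = cs (-1/2) (mul ?H \<rho>)"
  define b0 where "b0 = mul (g + cj q0) ?H"
  define c where "c = mean b0 / mean (kernel F)"
  define b where "b = b0 - cs c (kernel F)"
  have f: "f = mul ?h (P b)"
    by (simp add: f_def hankel_resolvent_def Let_def r_def \<rho>_def q0_def b0_def c_def b_def)
  have cjr: "cj r = r" by (rule ev_eqI) (simp add: r_def ev_simps)
  have cjk: "cj (kernel F) = kernel F" by (rule ev_eqI) (simp add: kernel_def ev_simps)
  have mr: "cnj (mean r) = mean r" using mean_cj[of r] cjr by simp
  have "r = P r + cs (mean r) one + cj (P r)" using decomp[of r] cjr by simp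
  then have evr: "ev r t = ev (P r) t + mean r + cnj (ev (P r) t)" for t
    by (metis ev.add ev_cs ev_one ev_cj mult.right_neutral)
  have \<rho>r: "ev \<rho> t + cnj (ev \<rho> t) = 2 * ev r t" for t
    by (simp add: \<rho>_def ev_simps mr evr[of t] algebra_simps scaleR_conv_of_real)
  \<comment> \<open>This is where the choice of \<open>q0\<close> enters: \<open>2 Re (q0 * h) = - r\<close>.\<close>
  have im0: "cj b0 = - b0"
  proof (rule ev_eqI)
    fix t
    define G h H R where "G = ev g t" and "h = ev ?h t" and "H = ev ?H t" and "R = ev \<rho> t"
    have R: "R + cnj R = 2 * (G * cnj h + cnj G * h)"
      using \<rho>r[of t] by (simp add: R_def G_def h_def r_def ev_simps)
    have 1: "h * H = 1" "cnj h * cnj H = 1" using hH[of t] hH'[of t] by (simp_all add: h_def H_def)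
    have "ev b0 t + cnj (ev b0 t) = G * H + cnj G * cnj H - H * cnj H * (R + cnj R) / 2"
      by (simp add: b0_def q0_def ev_simps G_def H_def R_def algebra_simps)
    also have "\<dots> = G * H + cnj G * cnj H - (G * H * (cnj h * cnj H) + cnj G * cnj H * (h * H))"
      unfolding R by (simp add: algebra_simps)
    also have "\<dots> = 0" by (simp add: 1)
    finally show "ev (cj b0) t = ev (- b0) t"
      by (simp add: ev_simps eq_neg_iff_add_eq_0 add.commute)
  qed
  have mb: "mean b = 0" using mean_kernel[of F] by (simp add: b_def c_def mean.diff mean_cs)
  \<comment> \<open>Subtracting a multiple of the kernel keeps \<open>b\<close> imaginary: its real part is a multiple of the
    kernel with mean zero.\<close>
  have cjb: "cj b = - b"
  proof -
    have e: "b + cj b = cs (- (c + cnj c)) (kernel F)"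
      by (rule ev_eqI) (use im0 cjk in \<open>simp add: b_def cj.diff cj_cs ev_simps algebra_simps\<close>)
    have "mean (b + cj b) = 0" by (simp add: mean.add mean_cj mb)
    then have "- (c + cnj c) = 0" using mean_kernel[of F] by (simp only: e mean_cs mult_eq_0_iff) blast
    then have "b + cj b = 0" unfolding e by simp
    then show ?thesis by (simp add: eq_neg_iff_add_eq_0 add.commute)
  qed
  have bP: "b = P b - cj (P b)"
    using decomp[of b] by (simp add: mb cjb P.neg cj.neg)
  define q where "q = q0 - cs (cnj c) ?H"
  have "hardy \<rho>"
    unfolding \<rho>_def using hardy_add[OF hardy0_hardy[OF hardy0_P] hardy_cs[OF hardy_one]]
    by (metis P.scaleR)
  then have q: "hardy q"
    unfolding q_def q0_def by (intro hardy_diff hardy_cs hardy_mul hardy_outer F)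
  have hb: "mul ?h b = g + cj q"
  proof (rule ev_eqI)
    fix t
    have "ev (mul ?h b) t = (ev ?h t * ev ?H t) * (ev g t + cnj (ev q0 t) - c * cnj (ev ?H t))"
      by (simp add: b_def b0_def kernel_def ev_simps algebra_simps)
    then show "ev (mul ?h b) t = ev (g + cj q) t"
      by (simp add: hH q_def ev_simps)
  qed
  have ff: "hardy0 f" unfolding f_def by (rule hardy0_hankel_resolvent[OF F])
  have "mul ?H f = P b"
    by (rule ev_eqI) (use hH in \<open>simp add: f ev_simps mult.assoc[symmetric] mult.commute[of "ev ?H _"]\<close>)
  then have "hankel (gauge (F + cj F)) f = P (mul ?h (cj (P b)))"
    by (simp add: hankel_gauge[OF hardy0_hardy[OF ff]])
  moreover have "f = P (mul ?h (P b))" using ff by (simp add: f hardy0_def)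
  ultimately have "f - hankel (gauge (F + cj F)) f = P (mul ?h (P b - cj (P b)))"
    by (simp add: P.diff mul.diff_right)
  also have "\<dots> = P g + P (cj q)" using bP hb by (simp add: P.add)
  finally show ?thesis using g P_cj_hardy[OF q] by (simp add: hardy0_def)
qed

end

lemma ps_on_add:
  fixes g1 g2 :: "'e::real_normed_vector \<Rightarrow> 'x::banach"
  assumes "ps_on r M1 g1" "ps_on r M2 g2" "0 \<le> r"
  shows "ps_on r (M1 + M2) (\<lambda>h. g1 h + g2 h)"
proof -
  define g where "g n = (if n = 0 then g1 else if n = 1 then g2 else (\<lambda>_. 0))" for n :: nat
  define M where "M n = (if n = 0 then M1 else if n = 1 then M2 else 0)" for n :: nat
  have z: "ps_on r 0 (\<lambda>_::'e. 0 :: 'x)" using ps_on_const[of r "0::'x"] by simp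
  have "ps_on r (M n) (g n)" for n using assms z by (simp add: g_def M_def)
  moreover have "M sums (M1 + M2)"
    using sums_finite[of "{0,1}" M] by (simp add: M_def)
  moreover have "(\<lambda>n. g n h) sums (g1 h + g2 h)" for h
    using sums_finite[of "{0,1}" "\<lambda>n. g n h"] by (simp add: g_def)
  ultimately show ?thesis using assms(3) by (intro ps_on_suminf[of r M g "M1 + M2"])
qed

lemma bounded_bilinear_compose_linear:
  assumes b: "bounded_bilinear b" and T: "bounded_linear T"
  shows "bounded_bilinear (\<lambda>x y. T (b x y))"
proof -
  interpret b: bounded_bilinear b by (rule b)
  interpret T: bounded_linear T by (rule T)
  obtain K where K: "\<And>x y. norm (b x y) \<le> norm x * norm y * K"
    using b.bounded by blast
  obtain L where L: "0 \<le> L" "\<And>x. norm (T x) \<le> norm x * L"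
    using T.nonneg_bounded by blast
  show ?thesis
  proof
    show "\<exists>K. \<forall>x y. norm (T (b x y)) \<le> norm x * norm y * K"
    proof (intro exI allI)
      fix x y
      have "norm (T (b x y)) \<le> norm (b x y) * L" by (rule L(2))
      also have "\<dots> \<le> (norm x * norm y * K) * L" by (intro mult_right_mono K L(1))
      finally show "norm (T (b x y)) \<le> norm x * norm y * (K * L)" by (simp add: mult.assoc)
    qed
  qed (simp_all add: b.add_left b.add_right b.scaleR_left b.scaleR_right T.add T.scaleR)
qed

text \<open>The argument takes values in a discrete set.\<close>

lemma exp_eq_one_imp_constant:
  fixes f :: "real \<Rightarrow> complex"
  assumes "continuous_on UNIV f" "\<And>t. exp (f t) = 1"
  shows "f constant_on UNIV"
proof (rule continuous_discrete_range_constant)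
  show "connected (UNIV :: real set)" by simp
  show "continuous_on UNIV f" by (rule assms(1))
  have d: "\<exists>n::int. f t = of_int n * (2 * pi * \<i>)" for t
  proof -
    obtain n :: int where "f t = 0 + (of_int (2 * n) * pi) * \<i>"
      using assms(2)[of t] exp_eq[of "f t" 0] by auto
    then show ?thesis by (intro exI[of _ n]) (simp add: algebra_simps)
  qed
  fix t :: real
  have "2 * pi \<le> norm (f s - f t)" if ne: "f s \<noteq> f t" for s
  proof -
    obtain m n :: int where mn: "f s = of_int m * (2 * pi * \<i>)" "f t = of_int n * (2 * pi * \<i>)"
      using d by metis
    then have "m \<noteq> n" using ne by auto
    then have "1 \<le> \<bar>real_of_int (m - n)\<bar>" by linarith
    moreover have "f s - f t = of_int (m - n) * (2 * pi * \<i>)"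
      by (simp add: mn algebra_simps)
    then have "norm (f s - f t) = \<bar>real_of_int (m - n)\<bar> * (2 * pi)"
      by (simp only: norm_mult norm_of_int) (simp add: norm_mult)
    ultimately show ?thesis using mult_right_mono[of 1 "\<bar>real_of_int (m - n)\<bar>" "2 * pi"] by simp
  qed
  then show "\<exists>e>0. \<forall>y. y \<in> UNIV \<and> f y \<noteq> f t \<longrightarrow> e \<le> norm (f y - f t)"
    by (intro exI[of _ "2 * pi"]) auto
qed

context hardy_algebra
begin

lemma ps_on_pw:
  assumes g: "ps_on r M g" and r: "0 < r"
  shows "ps_on r (norm one * (Km * M) ^ n) (\<lambda>h. pw (g h) n)"
proof (induction n)
  case 0
  then show ?case using ps_on_const[of r one] by simp
next
  case (Suc n)
  have "ps_on r (Km * (M * (norm one * (Km * M) ^ n))) (\<lambda>h. mul (g h) (pw (g h) n))"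
    by (rule ps_on_bilinear[OF g Suc bb_mul]) (use Km r in auto)
  then show ?case by (simp add: mult_ac)
qed

lemma ps_on_pser:
  fixes g :: "'e::real_normed_vector \<Rightarrow> 'x"
  assumes g: "ps_on r M g" and r: "0 < r" and s: "summable (\<lambda>n. \<bar>c n\<bar> * (Km * M) ^ n)"
  shows "\<exists>N. ps_on r N (\<lambda>h. pser c (g h))"
proof -
  have gM: "norm (g h) \<le> M" if "norm h < r" for h by (rule ps_on_bound[OF g that])
  have summand: "ps_on r (\<bar>c n\<bar> * (norm one * (Km * M) ^ n)) (\<lambda>h. c n *\<^sub>R pw (g h) n)" for n
    by (rule ps_on_compose_linear[OF ps_on_pw[OF g r] bounded_linear_scaleR_right]) auto
  have "summable (\<lambda>n. norm one * (\<bar>c n\<bar> * (Km * M) ^ n))"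
    using s by (rule summable_mult)
  then have "summable (\<lambda>n. \<bar>c n\<bar> * (norm one * (Km * M) ^ n))"
    by (simp add: mult_ac)
  then have "ps_on r (\<Sum>n. \<bar>c n\<bar> * (norm one * (Km * M) ^ n)) (\<lambda>h. pser c (g h))"
  proof (intro ps_on_suminf[OF summand] summable_sums)
    fix h :: 'e assume h: "norm h < r"
    have "summable (\<lambda>n. \<bar>c n\<bar> * (Km * norm (g h)) ^ n)"
    proof (rule summable_comparison_test'[OF s])
      show "norm (\<bar>c n\<bar> * (Km * norm (g h)) ^ n) \<le> \<bar>c n\<bar> * (Km * M) ^ n" for n
        using gM[OF h] Km(1) by (auto intro!: mult_left_mono power_mono simp: abs_mult)
    qed
    then show "(\<lambda>n. c n *\<^sub>R pw (g h) n) sums pser c (g h)" by (rule pser_sums)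
  qed (use r in auto)
  then show ?thesis by blast
qed

lemma gauge_ps_on:
  "\<exists>M g. ps_on 1 M g \<and> (\<forall>\<delta>. gauge (U + \<delta>) = g \<delta>)"
proof -
  obtain K where K: "0 \<le> K" "\<And>x. norm (cs (- \<i>) x) \<le> norm x * K"
    using cs.nonneg_bounded by blast
  obtain L where L: "0 \<le> L" "\<And>x. norm (P x) \<le> norm x * L"
    using P.nonneg_bounded by blast
  have "ps_on 1 (K * 1) (cs (- \<i>))"
    by (rule ps_on_linear[OF bl_cs]) (use K in \<open>simp_all add: mult.commute\<close>)
  from ps_on_pser[OF this _ EXP_summable] obtain N where "ps_on 1 N (\<lambda>\<delta>. EXP (cs (- \<i>) \<delta>))"
    unfolding EXP_def by auto
  from ps_on_bilinear[OF ps_on_const this bb_mul, of Km "EXP (cs (- \<i>) U)"]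
  have "ps_on 1 (Km * (norm (EXP (cs (- \<i>) U)) * N)) (\<lambda>\<delta>. mul (EXP (cs (- \<i>) U)) (EXP (cs (- \<i>) \<delta>)))"
    using Km by simp
  from ps_on_compose_linear[OF this bl_P, of L]
  have "ps_on 1 (L * (Km * (norm (EXP (cs (- \<i>) U)) * N))) (\<lambda>\<delta>. P (mul (EXP (cs (- \<i>) U)) (EXP (cs (- \<i>) \<delta>))))"
    using L by (simp add: mult.commute)
  moreover have "gauge (U + \<delta>) = P (mul (EXP (cs (- \<i>) U)) (EXP (cs (- \<i>) \<delta>)))" for \<delta>
  proof -
    have "EXP (cs (- \<i>) (U + \<delta>)) = mul (EXP (cs (- \<i>) U)) (EXP (cs (- \<i>) \<delta>))"
      by (rule ev_eqI) (simp add: ev_EXP ev_simps mult_exp_exp algebra_simps)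
    then show ?thesis by (simp add: gauge_def)
  qed
  ultimately show ?thesis by blast
qed

lemma real0_eq: "real0 U \<Longrightarrow> U = P U + cj (P U)"
  unfolding real0_def using real_decomp by blast

text \<open>Around \<open>v\<^sub>0 = gauge U0\<close>, with \<open>f0 = h0 - 1\<close> and \<open>B\<close> the resolvent, the solution \<open>f0 + z\<close> of the
  equation for \<open>v\<^sub>0 + \<delta>\<close> satisfies \<open>z = B (\<delta> + K\<^sub>\<delta> f0) + B (K\<^sub>\<delta> z)\<close>, where \<open>K\<^sub>\<delta>\<close> is the Hankel operator
  of \<open>\<delta>\<close>.  Iteration gives a series in \<open>\<delta>\<close>.  Since \<open>1 + f0 + z = h0 * (1 + z / h0)\<close>, the logarithm series
  exhibits the solution as \<open>exp (- \<i> F) - 1\<close>, so it comes from the gauge.\<close>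

lemma gauge_local_inverse:
  assumes U0: "real0 U0"
  shows "\<exists>r>0. \<exists>M G. ps_on r M G \<and>
    (\<forall>\<delta>. hardy0 \<delta> \<longrightarrow> norm \<delta> < r \<longrightarrow> real0 (G \<delta>) \<and> gauge (G \<delta>) = gauge U0 + \<delta>)"
proof -
  define F0 where "F0 = P U0"
  have F0: "hardy0 F0" by (simp add: F0_def hardy0_P)
  have U0F: "U0 = F0 + cj F0" using real0_eq[OF U0] by (simp add: F0_def)
  define v0 f0 where "v0 = gauge (F0 + cj F0)" and "f0 = outer F0 - one"
  have f0: "f0 - hankel v0 f0 = v0" unfolding f0_def v0_def by (rule gauge_equation[OF F0])
  have v0: "hardy0 v0" unfolding v0_def gauge_def by (rule hardy0_P)
  let ?B = "hankel_resolvent F0" and ?H = "outer_inv F0"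
  interpret B: bounded_linear ?B by (rule bl_hankel_resolvent)
  have bb_hankel: "bounded_bilinear hankel"
    unfolding hankel_def
    by (rule bounded_bilinear_compose_linear[OF bounded_bilinear.comp[OF bb_mul bounded_linear_ident bl_cj] bl_P])
  interpret hankel: bounded_bilinear hankel by (rule bb_hankel)
  define t where "t \<delta> = ?B (P \<delta> + hankel \<delta> f0)" for \<delta>
  define \<beta> where "\<beta> \<delta> x = ?B (hankel \<delta> x)" for \<delta> x
  have bl_t: "bounded_linear t"
    unfolding t_def
    by (intro bounded_linear_compose[OF bl_hankel_resolvent] bounded_linear_add bl_P hankel.bounded_linear_left)
  have bb_\<beta>: "bounded_bilinear \<beta>"
    unfolding \<beta>_def by (rule bounded_bilinear_compose_linear[OF bb_hankel bl_hankel_resolvent])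
  interpret \<beta>: bounded_bilinear \<beta> by (rule bb_\<beta>)
  obtain \<tau> where \<tau>: "0 \<le> \<tau>" "\<And>\<delta>. norm (t \<delta>) \<le> \<tau> * norm \<delta>"
    using bounded_linear.nonneg_bounded[OF bl_t] by (metis mult.commute)
  obtain \<kappa> where \<kappa>: "0 < \<kappa>" "\<And>\<delta> x. norm (\<beta> \<delta> x) \<le> \<kappa> * (norm \<delta> * norm x)"
    using \<beta>.pos_bounded by (metis mult.commute)
  define \<Lambda> where "\<Lambda> = Km * norm ?H"
  have \<Lambda>: "0 \<le> \<Lambda>" "norm (mul ?H x) \<le> \<Lambda> * norm x" for x
    using Km(1) Km(2)[of ?H x] by (simp_all add: \<Lambda>_def mult.assoc)
  \<comment> \<open>The first bound makes the Neumann series converge with ratio at most 1/2, the second one puts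
    \<open>z / h0\<close> in the domain of the logarithm series.\<close>
  define r where "r = min (1 / (2 * \<kappa>)) (1 / (2 * (Km * \<Lambda> * (2 * \<tau>) + 1)))"
  have D: "0 < Km * \<Lambda> * (2 * \<tau>) + 1" using Km(1) \<Lambda>(1) \<tau>(1) by (simp add: add_nonneg_pos)
  have r: "0 < r" using \<kappa>(1) D by (simp add: r_def)
  have kr: "\<kappa> * r \<le> 1 / 2"
    using mult_left_mono[of r "1 / (2 * \<kappa>)" \<kappa>] \<kappa>(1) by (simp add: r_def)
  define N where "N = \<tau> * r * (1 / (1 - \<kappa> * r))"
  have Nle: "N \<le> 2 * \<tau> * r"
  proof -
    have "1 / (1 - \<kappa> * r) \<le> 2" using kr by (simp add: field_simps)
    from mult_left_mono[OF this, of "\<tau> * r"] show ?thesis using \<tau>(1) r by (simp add: N_def)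
  qed
  have small: "Km * (\<Lambda> * N) < 1"
  proof -
    have "Km * (\<Lambda> * N) \<le> Km * (\<Lambda> * (2 * \<tau> * r))"
      using Km(1) \<Lambda>(1) by (intro mult_left_mono Nle) auto
    also have "\<dots> = Km * \<Lambda> * (2 * \<tau>) * r" by (simp add: mult_ac)
    also have "\<dots> \<le> (Km * \<Lambda> * (2 * \<tau>) + 1) * r"
      using r by (intro mult_right_mono) auto
    also have "\<dots> \<le> (Km * \<Lambda> * (2 * \<tau>) + 1) * (1 / (2 * (Km * \<Lambda> * (2 * \<tau>) + 1)))"
      using D by (intro mult_left_mono) (auto simp: r_def)
    also have "\<dots> = 1 / 2" using D by simp
    finally show ?thesis by simp
  qed
  define X where "X n \<delta> = ((\<beta> \<delta>) ^^ n) (t \<delta>)" for n \<delta>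
  have X0: "X 0 \<delta> = t \<delta>" and XSuc: "X (Suc n) \<delta> = \<beta> \<delta> (X n \<delta>)" for n \<delta>
    by (simp_all add: X_def)
  have psX: "ps_on r (\<tau> * r * (\<kappa> * r) ^ n) (X n)" for n
  proof (induction n)
    case 0
    have "ps_on r (\<tau> * r) t" by (rule ps_on_linear[OF bl_t \<tau>(2) \<tau>(1)])
    then show ?case by (simp add: X0[abs_def])
  next
    case (Suc n)
    have "ps_on r (1 * r) (\<lambda>\<delta>::'x. \<delta>)" by (rule ps_on_linear[OF bounded_linear_ident]) auto
    then have i: "ps_on r r (\<lambda>\<delta>::'x. \<delta>)" by simp
    have "ps_on r (\<kappa> * (r * (\<tau> * r * (\<kappa> * r) ^ n))) (\<lambda>\<delta>. \<beta> \<delta> (X n \<delta>))"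
      by (rule ps_on_bilinear[OF i Suc bb_\<beta>]) (use \<kappa> r in auto)
    then show ?case by (simp add: XSuc[abs_def] mult_ac)
  qed
  have sumsN: "(\<lambda>n. \<tau> * r * (\<kappa> * r) ^ n) sums N"
    unfolding N_def by (intro sums_mult geometric_sums) (use kr \<kappa>(1) r in simp)
  define z where "z \<delta> = (\<Sum>n. X n \<delta>)" for \<delta>
  have zsums: "(\<lambda>n. X n \<delta>) sums z \<delta>" if "norm \<delta> < r" for \<delta>
  proof -
    have "summable (\<lambda>n. norm (X n \<delta>))"
      by (rule summable_comparison_test'[OF sums_summable[OF sumsN]]) (use ps_on_bound[OF psX that] in simp)
    then show ?thesis unfolding z_def by (rule summable_sums[OF summable_norm_cancel])
  qed
  have psz: "ps_on r N z"
    by (rule ps_on_suminf[OF psX sumsN _ zsums]) (use r in auto)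
  define y where "y \<delta> = mul ?H (z \<delta>)" for \<delta>
  have psy: "ps_on r (\<Lambda> * N) y"
    unfolding y_def by (rule ps_on_compose_linear[OF psz mul.bounded_linear_right \<Lambda>(2) \<Lambda>(1)])
  have N0: "0 \<le> N" using ps_on_bound[OF psz, of 0] r norm_ge_zero order_trans by (metis norm_zero)
  obtain N1 where N1: "ps_on r N1 (\<lambda>\<delta>. LOG (y \<delta>))"
    using ps_on_pser[OF psy r LOG_summable[OF _ small]] Km(1) \<Lambda>(1) N0 unfolding LOG_def by auto
  obtain K where K: "0 \<le> K" "\<And>x. norm (cs \<i> x) \<le> K * norm x"
    using cs.nonneg_bounded by (metis mult.commute)
  obtain K' where K': "0 \<le> K'" "\<And>x. norm (x + cj x) \<le> K' * norm x"
    using bounded_linear.nonneg_bounded[OF bounded_linear_add[OF bounded_linear_ident bl_cj]]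
    by (metis mult.commute)
  define F where "F \<delta> = F0 + cs \<i> (LOG (y \<delta>))" for \<delta>
  have "ps_on r (norm F0 + K * N1) F"
    unfolding F_def by (intro ps_on_add ps_on_const ps_on_compose_linear[OF N1 bl_cs K(2) K(1)]) (use r in simp)
  then have psG: "ps_on r (K' * (norm F0 + K * N1)) (\<lambda>\<delta>. F \<delta> + cj (F \<delta>))"
    by (rule ps_on_compose_linear[OF _ bounded_linear_add[OF bounded_linear_ident bl_cj] K'(2) K'(1)])
  have "real0 (F \<delta> + cj (F \<delta>)) \<and> gauge (F \<delta> + cj (F \<delta>)) = gauge U0 + \<delta>"
    if \<delta>: "hardy0 \<delta>" "norm \<delta> < r" for \<delta>
  proof -
    have "(\<lambda>n. X (Suc n) \<delta>) sums \<beta> \<delta> (z \<delta>)"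
      unfolding XSuc by (rule bounded_linear.sums[OF \<beta>.bounded_linear_right zsums[OF \<delta>(2)]])
    moreover have "(\<lambda>n. X (Suc n) \<delta>) sums (z \<delta> - X 0 \<delta>)"
      using zsums[OF \<delta>(2)] by (subst sums_Suc_iff) simp
    ultimately have "z \<delta> = t \<delta> + \<beta> \<delta> (z \<delta>)"
      using sums_unique2[of "\<lambda>n. X (Suc n) \<delta>"] by (fastforce simp: X0)
    then have zB: "z \<delta> = ?B (P \<delta> + hankel \<delta> f0 + hankel \<delta> (z \<delta>))"
      by (simp add: t_def \<beta>_def B.add)
    have hh: "hardy0 (hankel a b)" for a b by (simp add: hankel_def hardy0_P)
    have arg: "hardy0 (P \<delta> + hankel \<delta> f0 + hankel \<delta> (z \<delta>))"
      by (intro hardy0_add hardy0_P hh)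
    have zeq: "z \<delta> - hankel v0 (z \<delta>) = \<delta> + hankel \<delta> f0 + hankel \<delta> (z \<delta>)"
      using hankel_resolvent[OF F0 arg] zB \<delta>(1) by (simp add: v0_def hardy0_def)
    have hz: "hardy0 (z \<delta>)" by (subst zB) (rule hardy0_hankel_resolvent[OF F0])
    have hy: "hardy0 (y \<delta>)" unfolding y_def by (rule hardy0_mul'[OF hardy_outer(2)[OF F0] hz])
    have "Km * norm (y \<delta>) \<le> Km * (\<Lambda> * N)"
      using ps_on_bound[OF psy \<delta>(2)] Km(1) by simp
    then have ysm: "Km * norm (y \<delta>) < 1" using small by simp
    have hF: "hardy0 (F \<delta>)"
      unfolding F_def by (intro hardy0_add F0 hardy0_cs hardy0_LOG ysm hy)
    have oF: "outer (F \<delta>) = outer F0 + z \<delta>"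
    proof (rule ev_eqI)
      fix s
      have "ev (outer (F \<delta>)) s = ev (outer F0) s * exp (ev (LOG (y \<delta>)) s)"
        by (simp add: ev_outer F_def ev_simps mult_exp_exp algebra_simps)
      also have "\<dots> = ev (outer F0) s + (ev (outer F0) s * ev ?H s) * ev (z \<delta>) s"
        unfolding exp_LOG[OF ysm] by (simp add: y_def ev_simps algebra_simps)
      finally show "ev (outer (F \<delta>)) s = ev (outer F0 + z \<delta>) s"
        by (simp add: outer_outer_inv ev_simps)
    qed
    have "outer (F \<delta>) - one - hankel (v0 + \<delta>) (outer (F \<delta>) - one)
      = (f0 - hankel v0 f0) + (z \<delta> - hankel v0 (z \<delta>)) - hankel \<delta> f0 - hankel \<delta> (z \<delta>)"
    proof -
      have "outer (F \<delta>) - one = f0 + z \<delta>" by (simp add: oF f0_def)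
      then show ?thesis by (simp add: hankel.add_left hankel.add_right)
    qed
    also have "\<dots> = v0 + \<delta>" by (simp add: f0 zeq)
    finally have "gauge (F \<delta> + cj (F \<delta>)) = v0 + \<delta>"
      by (intro gauge_of_equation hF hardy0_add v0 \<delta>(1))
    then show ?thesis using real0_sum[OF hF] by (simp add: U0F v0_def)
  qed
  with psG r show ?thesis by blast
qed

text \<open>Two logarithms of the same function differ by a constant; the mean identifies it.\<close>

lemma ev_exp_eq_imp:
  assumes "\<And>t. exp (ev a t) = exp (ev b t)" "mean a = mean b"
  shows "a = b"
proof -
  have "exp (ev (a - b) t) = 1" for t
    using assms(1)[of t] by (simp add: ev_simps exp_diff)
  then have "ev (a - b) constant_on UNIV"
    by (rule exp_eq_one_imp_constant[OF ev_cont])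
  then obtain c where "\<And>t. ev (a - b) t = c" by (auto simp: constant_on_def)
  then have "a - b = cs c one" by (intro ev_eqI) (simp add: ev_simps)
  then have ab: "a = b + cs c one" by (metis diff_add_cancel add.commute)
  then have "mean a = mean b + c" by (simp add: mean.add mean_cs mean_one)
  with assms(2) ab show ?thesis by simp
qed

lemma gauge_inj:
  assumes "real0 U1" "real0 U2" "gauge U1 = gauge U2"
  shows "U1 = U2"
proof -
  define F1 F2 where "F1 = P U1" and "F2 = P U2"
  have F: "hardy0 F1" "hardy0 F2" by (simp_all add: F1_def F2_def hardy0_P)
  have U: "U1 = F1 + cj F1" "U2 = F2 + cj F2"
    using assms real0_eq by (simp_all add: F1_def F2_def)
  define v where "v = gauge (F1 + cj F1)"
  have v2: "v = gauge (F2 + cj F2)" using assms(3) U by (simp add: v_def)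
  define d where "d = (outer F1 - one) - (outer F2 - one)"
  have d: "hardy0 d" unfolding d_def by (intro hardy0_diff hardy0_outer F)
  have "hankel v d = hankel v (outer F1 - one) - hankel v (outer F2 - one)"
    by (simp add: hankel_def d_def cj.diff mul.diff_right P.diff)
  moreover have "hankel v (outer F1 - one) = outer F1 - one - v" "hankel v (outer F2 - one) = outer F2 - one - v"
    using gauge_equation[OF F(1)] gauge_equation[OF F(2)]
    by (simp_all add: v_def[symmetric] v2[symmetric] algebra_simps)
  ultimately have "hankel v d = d" by (simp add: d_def)
  then have "d = 0"
    using hankel_fixed_point[OF F(1) d] by (simp add: v_def)
  then have eq: "outer F1 = outer F2" by (simp add: d_def)
  have "exp (ev (cs (- \<i>) F1) t) = exp (ev (cs (- \<i>) F2) t)" for t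
    using arg_cong[OF eq, of "\<lambda>a. ev a t"] by (simp add: ev_outer ev_simps)
  then have "cs (- \<i>) F1 = cs (- \<i>) F2"
    by (rule ev_exp_eq_imp) (simp add: mean_cs hardy0_mean F)
  then have "F1 = F2"
    by (intro ev_eqI) (metis ev_cs mult_cancel_left neg_equal_0_iff_equal complex_i_not_zero)
  then show ?thesis by (simp add: U)
qed

text \<open>The conjugate Hardy part \<open>cnj q\<close> of \<open>exp (- \<i> U)\<close> is orthogonal to \<open>e\<close>, and both functions are
  unimodular, so the mean of \<open>|q|\<^sup>2\<close> vanishes.\<close>

lemma gauge_unimodular:
  assumes U: "real0 U" and e: "hardy0 e" "mul e (cj e) = one" and eq: "gauge U = e"
  shows "EXP (cs (- \<i>) U) = e"
proof -
  define \<phi> where "\<phi> = EXP (cs (- \<i>) U)"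
  define q where "q = cj (\<phi> - e)"
  have "P \<phi> = e" using eq by (simp add: gauge_def \<phi>_def)
  then have q: "hardy q" using e(1) by (simp add: hardy_def q_def cj_cj P.diff hardy0_def)
  have uni: "ev \<phi> t * cnj (ev \<phi> t) = 1" for t
  proof -
    have "cnj (ev U t) = ev U t" using U by (metis real0_def ev_cj)
    then show ?thesis by (simp add: \<phi>_def ev_EXP ev_simps exp_cnj mult_exp_exp)
  qed
  have ee: "ev e t * cnj (ev e t) = 1" for t
    using arg_cong[OF e(2), of "\<lambda>a. ev a t"] by (simp add: ev_simps)
  have "mul q (cj q) = - (mul e q) - cj (mul e q)"
  proof (rule ev_eqI)
    fix t show "ev (mul q (cj q)) t = ev (- (mul e q) - cj (mul e q)) t"
      using uni[of t] ee[of t] by (simp add: q_def ev_simps algebra_simps)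
  qed
  moreover have "mean (mul e q) = 0"
    by (simp add: mean_mul hardy0_hardy e q hardy0_mean)
  ultimately have "mean (mul q (cj q)) = 0"
    by (simp add: mean.diff mean.neg mean_cj)
  then have "q = 0" by (rule mean_definite)
  then have "\<phi> = e" by (metis q_def cj_cj cj.zero eq_iff_diff_eq_0)
  then show ?thesis by (simp add: \<phi>_def)
qed

lemma norm_EXP_remainder:
  assumes "Km * norm a \<le> 1"
  shows "norm (EXP a - one - a) \<le> norm one * (Km * norm a)\<^sup>2"
proof -
  define x where "x = Km * norm a"
  have x: "0 \<le> x" "x \<le> 1" using assms Km(1) by (simp_all add: x_def)
  define c :: "nat \<Rightarrow> real" where "c n = (if n < 2 then 0 else 1 / fact n)" for n
  have eqX: "EXP a - one - a = (\<Sum>n. c n *\<^sub>R pw a n)" and s: "summable (\<lambda>n. norm (c n *\<^sub>R pw a n))"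
  proof -
    have "(\<lambda>n. (1 / fact n) *\<^sub>R pw a n - (if n = 0 then one else 0) - (if n = 1 then a else 0)) sums (EXP a - one - a)"
      unfolding EXP_def by (intro sums_diff pser_sums EXP_summable sums_single)
    moreover have "(\<lambda>n. (1 / fact n) *\<^sub>R pw a n - (if n = 0 then one else 0) - (if n = 1 then a else 0)) = (\<lambda>n. c n *\<^sub>R pw a n)"
    proof
      fix n show "(1 / fact n) *\<^sub>R pw a n - (if n = 0 then one else 0) - (if n = 1 then a else 0) = c n *\<^sub>R pw a n"
        by (cases n; cases "n - 1") (auto simp: c_def mul_one)
    qed
    ultimately show "EXP a - one - a = (\<Sum>n. c n *\<^sub>R pw a n)" by (simp add: sums_iff)
    show "summable (\<lambda>n. norm (c n *\<^sub>R pw a n))"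
      by (rule pser_summable, rule summable_comparison_test'[OF EXP_summable[of "Km * norm a"]])
         (use Km(1) in \<open>auto simp: c_def\<close>)
  qed
  have xs: "(\<lambda>n. c n * x ^ n) sums (exp x - 1 - x)"
  proof -
    have "(\<lambda>n. x ^ n /\<^sub>R fact n - (if n = 0 then 1 else 0) - (if n = 1 then x else 0)) sums (exp x - 1 - x)"
      by (intro sums_diff exp_converges sums_single)
    moreover have "(\<lambda>n. x ^ n /\<^sub>R fact n - (if n = 0 then 1 else 0) - (if n = 1 then x else 0)) = (\<lambda>n. c n * x ^ n)"
    proof
      fix n show "x ^ n /\<^sub>R fact n - (if n = 0 then 1 else 0) - (if n = 1 then x else 0) = c n * x ^ n"
        by (cases n; cases "n - 1") (auto simp: c_def field_simps)
    qed
    ultimately show ?thesis by simp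
  qed
  have "norm (EXP a - one - a) \<le> (\<Sum>n. norm (c n *\<^sub>R pw a n))"
    unfolding eqX by (rule summable_norm[OF s])
  also have "\<dots> \<le> (\<Sum>n. norm one * (c n * x ^ n))"
  proof (rule suminf_le[OF _ s summable_mult[OF sums_summable[OF xs]]])
    fix n
    have "c n \<ge> 0" by (simp add: c_def)
    then show "norm (c n *\<^sub>R pw a n) \<le> norm one * (c n * x ^ n)"
      using mult_left_mono[OF norm_pw[of a n], of "c n"] by (simp add: x_def mult_ac)
  qed
  also have "\<dots> = norm one * (exp x - 1 - x)"
    using sums_mult[OF xs, of "norm one"] by (simp add: sums_iff)
  also have "\<dots> \<le> norm one * x\<^sup>2"
    using exp_bound[OF x] by (intro mult_left_mono) auto
  finally show ?thesis by (simp add: x_def)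
qed

lemma gauge_zero: "gauge 0 = 0"
proof -
  have "EXP (cs (- \<i>) 0) = one" by (rule ev_eqI) (simp add: ev_EXP ev_simps)
  then show ?thesis by (simp add: gauge_def P_one)
qed

lemma gauge_derivative:
  "\<exists>C d. 0 \<le> C \<and> 0 < d \<and> (\<forall>U. norm U \<le> d \<longrightarrow> norm (gauge U + cs \<i> (P U)) \<le> C * (norm U)\<^sup>2)"
proof -
  obtain K where K: "0 < K" "\<And>x. norm (cs (- \<i>) x) \<le> norm x * K"
    using cs.pos_bounded by blast
  obtain L where L: "0 \<le> L" "\<And>x. norm (P x) \<le> norm x * L"
    using P.nonneg_bounded by blast
  have "norm (gauge U + cs \<i> (P U)) \<le> (L * (norm one * (Km * K)\<^sup>2)) * (norm U)\<^sup>2"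
    if U: "norm U \<le> 1 / (Km * K)" for U
  proof -
    let ?a = "cs (- \<i>) U"
    have Ka: "Km * norm ?a \<le> Km * (norm U * K)" using K Km(1) by (intro mult_left_mono) auto
    also have "\<dots> \<le> 1" using U Km(1) K(1) by (simp add: field_simps)
    finally have a1: "Km * norm ?a \<le> 1" .
    have "gauge U + cs \<i> (P U) = P (EXP ?a - one - ?a)"
    proof -
      have "cs (- \<i>) (P U) = - cs \<i> (P U)" by (rule ev_eqI) (simp add: ev_simps)
      then show ?thesis by (simp add: gauge_def P.diff P_one P_cs)
    qed
    then have "norm (gauge U + cs \<i> (P U)) \<le> norm (EXP ?a - one - ?a) * L" using L by simp
    also have "\<dots> \<le> (norm one * (Km * norm ?a)\<^sup>2) * L"
      by (intro mult_right_mono norm_EXP_remainder a1 L(1))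
    also have "\<dots> \<le> (norm one * (Km * (norm U * K))\<^sup>2) * L"
      using Ka Km(1) L(1) by (intro mult_right_mono mult_left_mono power_mono) auto
    finally show ?thesis by (simp add: power_mult_distrib mult_ac)
  qed
  moreover have "0 \<le> L * (norm one * (Km * K)\<^sup>2)" "0 < 1 / (Km * K)"
    using L(1) Km(1) K(1) by simp_all
  ultimately show ?thesis by blast
qed

end

section \<open>Sobolev weights and convolution\<close>

definition wt :: "real \<Rightarrow> int \<Rightarrow> real" where
  "wt p n = (1 + (real_of_int n)\<^sup>2) powr p"

lemma wt_pos [simp]: "0 < wt p n"
  unfolding wt_def by (smt (verit) powr_gt_zero zero_le_power2)

lemma wt_nonneg [simp]: "0 \<le> wt p n"
  by (rule less_imp_le[OF wt_pos])

lemma wt_neq_0 [simp]: "wt p n \<noteq> 0"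
  using wt_pos[of p n] by linarith

lemma wt_0 [simp]: "wt p 0 = 1"
  by (simp add: wt_def)

lemma wt_minus [simp]: "wt p (- n) = wt p n"
  by (simp add: wt_def)

lemma wt_square: "(wt p n)\<^sup>2 = wt (2 * p) n"
  by (simp add: wt_def power2_eq_square powr_add[symmetric])

lemma wt_add: "wt (p + q) n = wt p n * wt q n"
  by (simp add: wt_def powr_add)

lemma wt_ge_1: "0 \<le> p \<Longrightarrow> 1 \<le> wt p n"
  unfolding wt_def by (rule ge_one_powr_ge_zero) auto

lemma wt_1: "wt 1 n = 1 + (real_of_int n)\<^sup>2"
  unfolding wt_def by (smt (verit) powr_one zero_le_power2)

lemma summable_on_int_inverse_square: "(\<lambda>n::int. 1 / (1 + (real_of_int n)\<^sup>2)) summable_on UNIV"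
proof -
  let ?f = "\<lambda>n::int. 1 / (1 + (real_of_int n)\<^sup>2)"
  have nat: "summable (\<lambda>n. 1 / (1 + (real n)\<^sup>2))"
  proof (rule summable_comparison_test_ev[OF _ inverse_power_summable[of 2]])
    show "\<forall>\<^sub>F n in sequentially. norm (1 / (1 + (real n)\<^sup>2)) \<le> inverse (real n ^ 2)"
      using eventually_gt_at_top[of 0]
    proof eventually_elim
      case (elim n)
      then show ?case by (simp add: inverse_eq_divide frac_le)
    qed
  qed simp
  then have "(\<lambda>n. 1 / (1 + (real n)\<^sup>2)) summable_on UNIV"
    by (rule summable_nonneg_imp_summable_on) simp
  then have 1: "?f summable_on (int ` UNIV)" and 2: "?f summable_on ((\<lambda>n. - int n) ` UNIV)"
    by (subst summable_on_reindex; simp add: o_def inj_on_def)+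
  have "(UNIV :: int set) = int ` UNIV \<union> (\<lambda>n. - int n) ` UNIV"
  proof (rule set_eqI)
    fix n :: int
    show "n \<in> UNIV \<longleftrightarrow> n \<in> int ` UNIV \<union> (\<lambda>n. - int n) ` UNIV"
      by (cases n rule: int_cases2) auto
  qed
  then show ?thesis using summable_on_union[OF 1 2] by simp
qed

lemma summable_on_inverse_wt: assumes "1 \<le> p" shows "(\<lambda>n. 1 / wt p n) summable_on UNIV"
proof (rule summable_on_comparison_test[OF summable_on_int_inverse_square])
  fix n
  have "wt 1 n \<le> wt p n"
    unfolding wt_def by (rule powr_mono) (use assms in auto)
  then show "1 / wt p n \<le> 1 / (1 + (real_of_int n)\<^sup>2)"
    unfolding wt_1[symmetric] by (intro divide_left_mono mult_pos_pos) auto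
qed auto

text \<open>This is what makes the weighted space an algebra: the weight at \<open>n\<close> is controlled by the weight
  at \<open>m\<close> or at \<open>n - m\<close>.\<close>

lemma wt_subadditive:
  assumes "0 \<le> p" shows "wt p n \<le> 4 powr p * (wt p m + wt p (n - m))"
proof -
  define y z where "y = 1 + (real_of_int m)\<^sup>2" and "z = 1 + (real_of_int (n - m))\<^sup>2"
  have y: "0 < y" and z: "0 < z"
    unfolding y_def z_def by (auto intro: add_pos_nonneg)
  have "0 \<le> (real_of_int m - real_of_int (n - m))\<^sup>2" by simp
  then have "(real_of_int n)\<^sup>2 \<le> 2 * (real_of_int m)\<^sup>2 + 2 * (real_of_int (n - m))\<^sup>2"
    by (simp add: power2_eq_square algebra_simps)
  then have "1 + (real_of_int n)\<^sup>2 \<le> 2 * (y + z)" by (simp add: y_def z_def)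
  also have "\<dots> \<le> 4 * max y z" by simp
  finally have "wt p n \<le> (4 * max y z) powr p"
    unfolding wt_def by (intro powr_mono2 assms) auto
  also have "\<dots> = 4 powr p * max y z powr p"
    using y z by (intro powr_mult)
  also have "\<dots> \<le> 4 powr p * (y powr p + z powr p)"
    by (intro mult_left_mono) (auto simp: max_def)
  finally show ?thesis by (simp add: wt_def y_def z_def)
qed

lemma infsum_Cauchy_Schwarz:
  fixes x y :: "'a \<Rightarrow> real"
  assumes x: "(\<lambda>n. (x n)\<^sup>2) summable_on A" and y: "(\<lambda>n. (y n)\<^sup>2) summable_on A"
  shows "(\<lambda>n. \<bar>x n * y n\<bar>) summable_on A"
    and "(\<Sum>\<^sub>\<infinity>n\<in>A. \<bar>x n * y n\<bar>) \<le> sqrt (\<Sum>\<^sub>\<infinity>n\<in>A. (x n)\<^sup>2) * sqrt (\<Sum>\<^sub>\<infinity>n\<in>A. (y n)\<^sup>2)"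
proof -
  have fin: "(\<Sum>n\<in>F. \<bar>x n * y n\<bar>) \<le> sqrt (\<Sum>\<^sub>\<infinity>n\<in>A. (x n)\<^sup>2) * sqrt (\<Sum>\<^sub>\<infinity>n\<in>A. (y n)\<^sup>2)"
    if F: "finite F" "F \<subseteq> A" for F
  proof -
    have "(\<Sum>n\<in>F. \<bar>x n * y n\<bar>) \<le> L2_set x F * L2_set y F"
      using L2_set_mult_ineq[of x y F] by (simp add: abs_mult)
    also have "\<dots> \<le> sqrt (\<Sum>\<^sub>\<infinity>n\<in>A. (x n)\<^sup>2) * sqrt (\<Sum>\<^sub>\<infinity>n\<in>A. (y n)\<^sup>2)"
      unfolding L2_set_def
      by (intro mult_mono real_sqrt_le_mono finite_sum_le_infsum x y F)
         (auto intro!: sum_nonneg infsum_nonneg)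
    finally show ?thesis .
  qed
  show s: "(\<lambda>n. \<bar>x n * y n\<bar>) summable_on A"
    by (rule nonneg_bdd_above_summable_on) (auto intro!: bdd_aboveI2 fin)
  show "(\<Sum>\<^sub>\<infinity>n\<in>A. \<bar>x n * y n\<bar>) \<le> sqrt (\<Sum>\<^sub>\<infinity>n\<in>A. (x n)\<^sup>2) * sqrt (\<Sum>\<^sub>\<infinity>n\<in>A. (y n)\<^sup>2)"
    by (rule infsum_le_finite_sums[OF s fin])
qed

lemma norm_fourier_infsum: "norm f = sqrt (\<Sum>\<^sub>\<infinity>n. (cmod (fourier f n))\<^sup>2)"
  using infsumI[OF parseval[of f]] by simp

definition conv :: "(int \<Rightarrow> complex) \<Rightarrow> (int \<Rightarrow> complex) \<Rightarrow> int \<Rightarrow> complex" where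
  "conv c d n = (\<Sum>\<^sub>\<infinity>m. c m * d (n - m))"

lemma bij_conv: "bij_betw (\<lambda>(n::int, m). (m, n - m)) (UNIV \<times> UNIV) (UNIV \<times> UNIV)"
  by (rule bij_betwI[where g = "\<lambda>(m, k). (m + k, m)"]) auto

lemma conv_has_sum:
  assumes c: "c abs_summable_on UNIV" and d: "d abs_summable_on UNIV"
  shows "((\<lambda>m. c m * d (n - m)) has_sum conv c d n) UNIV"
proof -
  define D where "D = (\<Sum>\<^sub>\<infinity>k. cmod (d k))"
  have D: "cmod (d k) \<le> D" for k
    using finite_sum_le_infsum[OF d, of "{k}"] by (simp add: D_def)
  have "(\<lambda>m. c m * d (n - m)) abs_summable_on UNIV"
  proof (rule summable_on_comparison_test)
    show "(\<lambda>m. cmod (c m) * D) summable_on UNIV" by (rule summable_on_cmult_left[OF c])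
    show "norm (c m * d (n - m)) \<le> cmod (c m) * D" for m
      by (simp add: norm_mult D mult_left_mono)
  qed auto
  then show ?thesis
    unfolding conv_def by (rule has_sum_infsum[OF abs_summable_summable])
qed

lemma trig_series_conv:
  assumes c: "c abs_summable_on UNIV" and d: "d abs_summable_on UNIV"
  shows "trig_series (conv c d) x = trig_series c x * trig_series d x"
proof -
  let ?e = "\<lambda>n. cis (of_int n * x)"
  let ?F = "\<lambda>(m, k). (c m * ?e m) * (d k * ?e k)"
  have F: "(?F has_sum (trig_series c x * trig_series d x)) (UNIV \<times> UNIV)"
  proof (rule has_sum_Sigma_abs)
    have "((\<lambda>(m, k). cmod (c m) * cmod (d k)) has_sum ((\<Sum>\<^sub>\<infinity>m. cmod (c m)) * (\<Sum>\<^sub>\<infinity>k. cmod (d k)))) (UNIV \<times> UNIV)"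
      by (rule has_sum_product_real) (use c d in auto)
    then show "?F abs_summable_on UNIV \<times> UNIV"
      by (rule has_sum_comparison) (auto simp: norm_mult)
    show "((\<lambda>k. ?F (m, k)) has_sum (c m * ?e m) * trig_series d x) UNIV" for m
      using has_sum_cmult_right[OF trig_series_has_sum[OF d]] by simp
    show "((\<lambda>m. (c m * ?e m) * trig_series d x) has_sum trig_series c x * trig_series d x) UNIV"
      by (rule has_sum_cmult_left[OF trig_series_has_sum[OF c]])
  qed
  then have "((\<lambda>p. ?F (case p of (n, m) \<Rightarrow> (m, n - m))) has_sum (trig_series c x * trig_series d x)) (UNIV \<times> UNIV)"
    using has_sum_reindex_bij_betw[OF bij_conv, of ?F] by blast
  then have "((\<lambda>n. conv c d n * ?e n) has_sum (trig_series c x * trig_series d x)) UNIV"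
  proof (rule has_sum_SigmaD)
    fix n :: int
    have "((\<lambda>m. c m * d (n - m) * ?e n) has_sum conv c d n * ?e n) UNIV"
      by (rule has_sum_cmult_left[OF conv_has_sum[OF c d]])
    moreover have "?F (case (n, m) of (n, m) \<Rightarrow> (m, n - m)) = c m * d (n - m) * ?e n" for m
    proof -
      have "?e n = ?e m * ?e (n - m)" by (simp add: cis_mult algebra_simps)
      then show ?thesis by (simp add: mult_ac)
    qed
    ultimately show "((\<lambda>m. ?F (case (n, m) of (n, m) \<Rightarrow> (m, n - m))) has_sum conv c d n * ?e n) UNIV"
      by presburger
  qed
  then show ?thesis unfolding trig_series_def by (rule infsumI)
qed

lemma trig_series_inj:
  assumes "c abs_summable_on UNIV" "d abs_summable_on UNIV" "\<And>x. trig_series c x = trig_series d x"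
  shows "c = d"
proof
  fix n
  have "trig_series c = trig_series d" using assms(3) by (rule ext)
  then show "c n = d n" by (metis assms(1,2) fourier_trig_series_fun)
qed

section \<open>The weighted Sobolev space as a Banach algebra\<close>

text \<open>An element \<open>f\<close> of \<open>torus_L2\<close> also serves as a code for the function with Fourier coefficients
  \<open>fourier f n / wt p n\<close>, which ranges over the Sobolev space of order \<open>2 p\<close> with equality of norms.
  In this way one complete type carries the norms of all orders, and only the product depends on
  the order.\<close>

definition wcoef :: "real \<Rightarrow> torus_L2 \<Rightarrow> int \<Rightarrow> complex" where
  "wcoef p f n = fourier f n / of_real (wt p n)"

definition wfun :: "real \<Rightarrow> torus_L2 \<Rightarrow> real \<Rightarrow> complex" where
  "wfun p f = trig_series (wcoef p f)"

definition wmul :: "real \<Rightarrow> torus_L2 \<Rightarrow> torus_L2 \<Rightarrow> torus_L2" where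
  "wmul p f g = l2_of (\<lambda>n. of_real (wt p n) * conv (wcoef p f) (wcoef p g) n)"

definition l2_cnj :: "torus_L2 \<Rightarrow> torus_L2" where
  "l2_cnj f = l2_of (\<lambda>n. cnj (fourier f (- n)))"

definition l2_pos :: "torus_L2 \<Rightarrow> torus_L2" where
  "l2_pos f = l2_of (\<lambda>n. if 0 < n then fourier f n else 0)"

lemma bij_uminus_int: "bij (uminus :: int \<Rightarrow> int)"
  by (rule bij_betwI[where g = uminus]) auto

lemma fourier_cnj: "fourier (l2_cnj f) n = cnj (fourier f (- n))"
  unfolding l2_cnj_def
  by (rule fourier_l2_of, rule multiplier_summable[OF bij_uminus_int, of _ 1 f]) simp

lemma fourier_pos: "fourier (l2_pos f) n = (if 0 < n then fourier f n else 0)"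
  unfolding l2_pos_def
  by (rule fourier_l2_of, rule multiplier_summable[OF bij_id, of _ 1 f]) simp

lemma bounded_linear_cnj: "bounded_linear l2_cnj"
proof (rule bounded_linear_intro[where K = 1])
  show "norm (l2_cnj f) \<le> norm f * 1" for f
    using norm_le_fourier[OF bij_uminus_int, of 1 "l2_cnj f" f] by (simp add: fourier_cnj)
qed (rule fourier_eqI, simp add: fourier_cnj fourier_add fourier_scaleR)+

lemma bounded_linear_pos: "bounded_linear l2_pos"
proof (rule bounded_linear_intro[where K = 1])
  show "norm (l2_pos f) \<le> norm f * 1" for f
    using norm_le_fourier[OF bij_id, of 1 "l2_pos f" f] by (simp add: fourier_pos)
qed (rule fourier_eqI, simp add: fourier_pos fourier_add fourier_scaleR)+

text \<open>The order \<open>2 p\<close> is at least 1, so that the inverse weights are square-summable; then the coefficients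
  are absolutely summable and the coded functions are continuous.\<close>

locale sobolev_weight = fixes p :: real assumes p: "1 \<le> 2 * p"
begin

lemma wsum: "(\<lambda>n. (1 / wt p n)\<^sup>2) summable_on UNIV"
  using summable_on_inverse_wt[OF p] by (simp add: power_divide wt_square)

definition inverse_wt_sum where "inverse_wt_sum = (\<Sum>\<^sub>\<infinity>n. (1 / wt p n)\<^sup>2)"

lemma inverse_wt_sum_nonneg: "0 \<le> inverse_wt_sum" unfolding inverse_wt_sum_def by (rule infsum_nonneg) simp

lemma wcoef_eq: "cmod (wcoef p f n) = \<bar>cmod (fourier f n) * (1 / wt p n)\<bar>"
  by (simp add: wcoef_def norm_divide)

lemma wcoef_abs_summable: "wcoef p f abs_summable_on UNIV"
  unfolding wcoef_eq using infsum_Cauchy_Schwarz(1)[OF fourier_summable wsum] by simp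

lemma wcoef_bound: "(\<Sum>\<^sub>\<infinity>n. cmod (wcoef p f n)) \<le> norm f * sqrt inverse_wt_sum"
  unfolding wcoef_eq inverse_wt_sum_def norm_fourier_infsum[of f] by (rule infsum_Cauchy_Schwarz(2)[OF fourier_summable wsum])

lemma wcoef_add: "wcoef p (f + g) n = wcoef p f n + wcoef p g n"
  by (simp add: wcoef_def fourier_add add_divide_distrib)

lemma wcoef_scaleR: "wcoef p (r *\<^sub>R f) n = r *\<^sub>R wcoef p f n"
  by (simp add: wcoef_def fourier_scaleR scaleR_conv_of_real)

lemma bounded_linear_wfun: "bounded_linear (\<lambda>f. wfun p f t)"
proof (rule bounded_linear_intro)
  fix f g r
  have hs: "((\<lambda>n. wcoef p f n * cis (of_int n * t)) has_sum wfun p f t) UNIV" for f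
    unfolding wfun_def by (rule trig_series_has_sum[OF wcoef_abs_summable])
  have "((\<lambda>n. wcoef p (f + g) n * cis (of_int n * t)) has_sum (wfun p f t + wfun p g t)) UNIV"
    using has_sum_add[OF hs[of f] hs[of g]] by (simp add: wcoef_add distrib_right)
  then show "wfun p (f + g) t = wfun p f t + wfun p g t"
    using hs has_sum_unique by blast
  have "((\<lambda>n. wcoef p (r *\<^sub>R f) n * cis (of_int n * t)) has_sum (r *\<^sub>R wfun p f t)) UNIV"
    using has_sum_scaleR[OF hs[of f], of r] by (simp add: wcoef_scaleR)
  then show "wfun p (r *\<^sub>R f) t = r *\<^sub>R wfun p f t"
    using hs has_sum_unique by blast
  show "norm (wfun p f t) \<le> norm f * sqrt inverse_wt_sum"
    unfolding wfun_def using trig_series_bound[OF wcoef_abs_summable] wcoef_bound order_trans by blast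
qed

lemma wfun_eqI: assumes "\<And>t. wfun p f t = wfun p g t" shows "f = g"
proof (rule fourier_eqI)
  fix n
  have "wcoef p f = wcoef p g"
    by (rule trig_series_inj[OF wcoef_abs_summable wcoef_abs_summable]) (use assms in \<open>simp add: wfun_def\<close>)
  then have "wcoef p f n = wcoef p g n" by simp
  then show "fourier f n = fourier g n" by (simp add: wcoef_def)
qed

definition wmul_bound where "wmul_bound = sqrt (2 * 4 powr (2 * p) * inverse_wt_sum)"

lemma wmul_bound_nonneg: "0 \<le> wmul_bound"
  using inverse_wt_sum_nonneg by (simp add: wmul_bound_def)

text \<open>By the Cauchy-Schwarz inequality, the square of the \<open>n\<close>-th weighted convolution is at most the sum of
  \<open>(wt p n / (wt p m * wt p (n - m)))\<^sup>2\<close> over \<open>m\<close>, bounded uniformly in \<open>n\<close>, times the sum \<open>g n\<close> of the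
  products of squares; and \<open>g\<close> adds up to the product of the squared norms.\<close>

lemma wconv_bound:
  "\<exists>g. (g has_sum (norm a)\<^sup>2 * (norm b)\<^sup>2) UNIV \<and>
     (\<forall>n. (cmod (of_real (wt p n) * conv (wcoef p a) (wcoef p b) n))\<^sup>2 \<le> wmul_bound\<^sup>2 * g n)"
proof -
  define g where "g n = (\<Sum>\<^sub>\<infinity>m. (cmod (fourier a m) * cmod (fourier b (n - m)))\<^sup>2)" for n
  have prod: "((\<lambda>(m, k). (cmod (fourier a m))\<^sup>2 * (cmod (fourier b k))\<^sup>2) has_sum (norm a)\<^sup>2 * (norm b)\<^sup>2) (UNIV \<times> UNIV)"
    by (rule has_sum_product_real[OF parseval parseval]) auto
  have gs: "(\<lambda>m. (cmod (fourier a m) * cmod (fourier b (n - m)))\<^sup>2) summable_on UNIV" for n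
  proof (rule summable_on_comparison_test[OF summable_on_cmult_left[OF fourier_summable]])
    show "(cmod (fourier a m) * cmod (fourier b (n - m)))\<^sup>2 \<le> (cmod (fourier a m))\<^sup>2 * (norm b)\<^sup>2" for m
      by (simp add: power_mult_distrib mult_left_mono power_mono norm_fourier_le)
  qed auto
  have "((\<lambda>q. (\<lambda>(m, k). (cmod (fourier a m))\<^sup>2 * (cmod (fourier b k))\<^sup>2) (case q of (n, m) \<Rightarrow> (m, n - m)))
      has_sum (norm a)\<^sup>2 * (norm b)\<^sup>2) (UNIV \<times> UNIV)"
    using has_sum_reindex_bij_betw[OF bij_conv, of "\<lambda>(m, k). (cmod (fourier a m))\<^sup>2 * (cmod (fourier b k))\<^sup>2"] prod by blast
  then have "(g has_sum (norm a)\<^sup>2 * (norm b)\<^sup>2) UNIV"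
    by (rule has_sum_SigmaD) (use has_sum_infsum[OF gs] in \<open>simp add: g_def power_mult_distrib\<close>)
  moreover have "(cmod (of_real (wt p n) * conv (wcoef p a) (wcoef p b) n))\<^sup>2 \<le> wmul_bound\<^sup>2 * g n" for n
  proof -
    define k where "k m = wt p n / (wt p m * wt p (n - m))" for m
    have kle: "(k m)\<^sup>2 \<le> 4 powr (2 * p) * ((1 / wt p (n - m))\<^sup>2 + (1 / wt p m)\<^sup>2)" for m
    proof -
      have "(k m)\<^sup>2 = wt (2 * p) n / (wt (2 * p) m * wt (2 * p) (n - m))"
        by (simp add: k_def power_divide power_mult_distrib wt_square)
      also have "\<dots> \<le> (4 powr (2 * p) * (wt (2 * p) m + wt (2 * p) (n - m))) / (wt (2 * p) m * wt (2 * p) (n - m))"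
        by (intro divide_right_mono wt_subadditive) (use p in auto)
      also have "\<dots> = 4 powr (2 * p) * (1 / wt (2 * p) (n - m) + 1 / wt (2 * p) m)"
        by (simp add: field_simps)
      finally show ?thesis by (simp add: power_divide wt_square)
    qed
    have shift: "bij (\<lambda>m. n - m)" by (rule bij_betwI[where g = "\<lambda>m. n - m"]) auto
    have S1: "((\<lambda>m. (1 / wt p m)\<^sup>2) has_sum inverse_wt_sum) UNIV"
      unfolding inverse_wt_sum_def by (rule has_sum_infsum[OF wsum])
    have S2: "((\<lambda>m. (1 / wt p (n - m))\<^sup>2) has_sum inverse_wt_sum) UNIV"
      using has_sum_reindex_bij_betw[OF shift, of "\<lambda>m. (1 / wt p m)\<^sup>2" inverse_wt_sum] S1 by blast
    have "((\<lambda>m. 4 powr (2 * p) * ((1 / wt p (n - m))\<^sup>2 + (1 / wt p m)\<^sup>2)) has_sum 4 powr (2 * p) * (inverse_wt_sum + inverse_wt_sum)) UNIV"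
      by (intro has_sum_cmult_right has_sum_add S1 S2)
    then have bound: "((\<lambda>m. 4 powr (2 * p) * ((1 / wt p (n - m))\<^sup>2 + (1 / wt p m)\<^sup>2)) has_sum wmul_bound\<^sup>2) UNIV"
      using inverse_wt_sum_nonneg by (simp add: wmul_bound_def mult_ac)
    have ks: "(\<lambda>m. (k m)\<^sup>2) summable_on UNIV"
      by (rule summable_on_comparison_test[OF has_sum_imp_summable[OF bound] kle]) auto
    have kC: "(\<Sum>\<^sub>\<infinity>m. (k m)\<^sup>2) \<le> wmul_bound\<^sup>2"
      by (rule has_sum_mono[OF has_sum_infsum[OF ks] bound kle])
    let ?t = "\<lambda>m. k m * (cmod (fourier a m) * cmod (fourier b (n - m)))"
    have "((\<lambda>m. of_real (wt p n) * (wcoef p a m * wcoef p b (n - m))) has_sum of_real (wt p n) * conv (wcoef p a) (wcoef p b) n) UNIV"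
      by (intro has_sum_cmult_right conv_has_sum wcoef_abs_summable)
    moreover have "((\<lambda>m. \<bar>?t m\<bar>) has_sum (\<Sum>\<^sub>\<infinity>m. \<bar>?t m\<bar>)) UNIV"
      by (intro has_sum_infsum infsum_Cauchy_Schwarz(1) ks gs)
    ultimately have "cmod (of_real (wt p n) * conv (wcoef p a) (wcoef p b) n) \<le> (\<Sum>\<^sub>\<infinity>m. \<bar>?t m\<bar>)"
      by (rule norm_infsum_le) (simp add: wcoef_def k_def norm_mult norm_divide)
    also have "\<dots> \<le> sqrt (\<Sum>\<^sub>\<infinity>m. (k m)\<^sup>2) * sqrt (g n)"
      unfolding g_def by (rule infsum_Cauchy_Schwarz(2)[OF ks gs])
    also have "\<dots> \<le> wmul_bound * sqrt (g n)"
    proof (rule mult_right_mono)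
      show "sqrt (\<Sum>\<^sub>\<infinity>m. (k m)\<^sup>2) \<le> wmul_bound"
        using real_sqrt_le_mono[OF kC] wmul_bound_nonneg by simp
      show "0 \<le> sqrt (g n)" by (simp add: g_def infsum_nonneg)
    qed
    finally have "(cmod (of_real (wt p n) * conv (wcoef p a) (wcoef p b) n))\<^sup>2 \<le> (wmul_bound * sqrt (g n))\<^sup>2"
      by (intro power_mono) auto
    then show ?thesis by (simp add: power_mult_distrib g_def infsum_nonneg)
  qed
  ultimately show ?thesis by blast
qed

lemma fourier_wmul: "fourier (wmul p a b) n = of_real (wt p n) * conv (wcoef p a) (wcoef p b) n"
  unfolding wmul_def
proof (rule fourier_l2_of)
  obtain g where g: "(g has_sum (norm a)\<^sup>2 * (norm b)\<^sup>2) UNIV"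
    "\<And>n. (cmod (of_real (wt p n) * conv (wcoef p a) (wcoef p b) n))\<^sup>2 \<le> wmul_bound\<^sup>2 * g n"
    using wconv_bound by blast
  show "(\<lambda>n. (cmod (of_real (wt p n) * conv (wcoef p a) (wcoef p b) n))\<^sup>2) summable_on UNIV"
    by (rule summable_on_comparison_test[OF has_sum_imp_summable[OF has_sum_cmult_right[OF g(1)]] g(2)]) auto
qed

lemma wcoef_wmul: "wcoef p (wmul p a b) = conv (wcoef p a) (wcoef p b)"
  by (rule ext) (simp add: wcoef_def[of p "wmul p a b"] fourier_wmul)

lemma wfun_wmul: "wfun p (wmul p a b) t = wfun p a t * wfun p b t"
  unfolding wfun_def wcoef_wmul by (rule trig_series_conv[OF wcoef_abs_summable wcoef_abs_summable])

lemma norm_wmul: "norm (wmul p a b) \<le> norm a * norm b * wmul_bound"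
proof (rule power2_le_imp_le)
  obtain g where g: "(g has_sum (norm a)\<^sup>2 * (norm b)\<^sup>2) UNIV"
    "\<And>n. (cmod (of_real (wt p n) * conv (wcoef p a) (wcoef p b) n))\<^sup>2 \<le> wmul_bound\<^sup>2 * g n"
    using wconv_bound by blast
  have "(norm (wmul p a b))\<^sup>2 \<le> wmul_bound\<^sup>2 * ((norm a)\<^sup>2 * (norm b)\<^sup>2)"
    by (rule has_sum_mono[OF parseval has_sum_cmult_right[OF g(1)]]) (use g(2) in \<open>simp add: fourier_wmul\<close>)
  then show "(norm (wmul p a b))\<^sup>2 \<le> (norm a * norm b * wmul_bound)\<^sup>2"
    by (simp add: power_mult_distrib mult_ac)
qed (use wmul_bound_nonneg in auto)

lemma bounded_bilinear_wmul: "bounded_bilinear (wmul p)"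
proof
  interpret w: bounded_linear "\<lambda>f. wfun p f t" for t by (rule bounded_linear_wfun)
  show "wmul p (a + a') b = wmul p a b + wmul p a' b" for a a' b
    by (rule wfun_eqI) (simp add: wfun_wmul w.add distrib_right)
  show "wmul p a (b + b') = wmul p a b + wmul p a b'" for a b b'
    by (rule wfun_eqI) (simp add: wfun_wmul w.add distrib_left)
  show "wmul p (r *\<^sub>R a) b = r *\<^sub>R wmul p a b" for r a b
    by (rule wfun_eqI) (simp add: wfun_wmul w.scaleR)
  show "wmul p a (r *\<^sub>R b) = r *\<^sub>R wmul p a b" for r a b
    by (rule wfun_eqI) (simp add: wfun_wmul w.scaleR)
  show "\<exists>K. \<forall>a b. norm (wmul p a b) \<le> norm a * norm b * K"
    using norm_wmul by blast
qed

lemma wfun_has_sum: "((\<lambda>n. wcoef p f n * cis (of_int n * t)) has_sum wfun p f t) UNIV"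
  unfolding wfun_def by (rule trig_series_has_sum[OF wcoef_abs_summable])

lemma wfun_exp_0: "wfun p (L2_exp 0) t = 1"
proof (rule has_sum_unique[OF wfun_has_sum])
  show "((\<lambda>n. wcoef p (L2_exp 0) n * cis (of_int n * t)) has_sum 1) UNIV"
    by (rule has_sum_finite_neutralI[where B = "{0}"]) (auto simp: wcoef_def fourier_exp)
qed

lemma wfun_scale: "wfun p (L2_scale c f) t = c * wfun p f t"
proof (rule has_sum_unique[OF wfun_has_sum])
  have "wcoef p (L2_scale c f) n * cis (of_int n * t) = c * (wcoef p f n * cis (of_int n * t))" for n
    by (simp add: wcoef_def fourier_scale)
  then show "((\<lambda>n. wcoef p (L2_scale c f) n * cis (of_int n * t)) has_sum c * wfun p f t) UNIV"
    using has_sum_cmult_right[OF wfun_has_sum[of f t], of c] by presburger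
qed

lemma wfun_cnj: "wfun p (l2_cnj f) t = cnj (wfun p f t)"
proof (rule has_sum_unique[OF wfun_has_sum])
  have "((\<lambda>n. cnj (wcoef p f n * cis (of_int n * t))) has_sum cnj (wfun p f t)) UNIV"
    using wfun_has_sum[of f t] by (simp only: has_sum_cnj_iff)
  then have "((\<lambda>n. cnj (wcoef p f (- n) * cis (of_int (- n) * t))) has_sum cnj (wfun p f t)) UNIV"
    using has_sum_reindex_bij_betw[OF bij_uminus_int, of "\<lambda>n. cnj (wcoef p f n * cis (of_int n * t))"] by simp
  moreover have "wcoef p (l2_cnj f) n * cis (of_int n * t) = cnj (wcoef p f (- n) * cis (of_int (- n) * t))" for n
    by (simp add: wcoef_def fourier_cnj cis_cnj)
  ultimately show "((\<lambda>n. wcoef p (l2_cnj f) n * cis (of_int n * t)) has_sum cnj (wfun p f t)) UNIV"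
    by presburger
qed

text \<open>The mean of \<open>|a|\<^sup>2\<close> is the sum of the squared moduli of the coefficients.\<close>

lemma wmul_cnj_definite:
  assumes "fourier (wmul p a (l2_cnj a)) 0 = 0" shows "a = 0"
proof (rule fourier_eq_zero_imp)
  fix n
  have "((\<lambda>m. wcoef p a m * wcoef p (l2_cnj a) (0 - m)) has_sum 0) UNIV"
    using conv_has_sum[OF wcoef_abs_summable wcoef_abs_summable, of a "l2_cnj a" 0] assms
    by (simp add: fourier_wmul)
  moreover have "wcoef p a m * wcoef p (l2_cnj a) (0 - m) = of_real ((cmod (wcoef p a m))\<^sup>2)" for m
  proof -
    have "wcoef p (l2_cnj a) (0 - m) = cnj (wcoef p a m)" by (simp add: wcoef_def fourier_cnj)
    then show ?thesis by (simp only: complex_norm_square)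
  qed
  ultimately have "((\<lambda>m. complex_of_real ((cmod (wcoef p a m))\<^sup>2)) has_sum of_real 0) UNIV"
    by simp
  then have "((\<lambda>m. (cmod (wcoef p a m))\<^sup>2) has_sum 0) UNIV"
    by (simp only: has_sum_of_real_iff)
  then have "(cmod (wcoef p a n))\<^sup>2 = 0"
    by (rule nonneg_has_sum_le_0D) auto
  then show "fourier a n = 0" by (simp add: wcoef_def)
qed

lemma pos_wmul_pos: "l2_pos (wmul p (l2_pos a) (l2_pos b)) = wmul p (l2_pos a) (l2_pos b)"
proof (rule fourier_eqI)
  fix n :: int
  have "conv (wcoef p (l2_pos a)) (wcoef p (l2_pos b)) n = 0" if "n \<le> 0"
    unfolding conv_def by (rule infsum_0) (use that in \<open>auto simp: wcoef_def fourier_pos\<close>)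
  then show "fourier (l2_pos (wmul p (l2_pos a) (l2_pos b))) n = fourier (wmul p (l2_pos a) (l2_pos b)) n"
    by (auto simp: fourier_pos fourier_wmul)
qed

end

section \<open>Conjugation and the Hardy structure\<close>

lemma torus_L2_fun_cnj:
  assumes f: "torus_L2_fun f" shows "torus_L2_fun (\<lambda>x. cnj (f x))"
  using f borel_measurable_cnj_comp[OF torus_L2_fun_measurable[OF f]] by (simp add: torus_L2_fun_def)

lemma fourier_abs: "torus_L2_fun f \<Longrightarrow> fourier (abs_torus_L2 f) n = torus_inner f (\<lambda>x. cis (of_int n * x))"
  by (simp add: fourier_def L2_exp_abs L2_cinner.abs_eq torus_eq_refl_iff torus_L2_fun_cis)

lemma l2_cnj_abs:
  assumes f: "torus_L2_fun f" shows "l2_cnj (abs_torus_L2 f) = abs_torus_L2 (\<lambda>x. cnj (f x))"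
proof (rule fourier_eqI)
  fix n
  have "(LINT x:{0..2 * pi}|lborel. cnj (f x) * cnj (cis (of_int n * x)))
      = (LINT x|lborel. cnj (indicator {0..2 * pi} x *\<^sub>R (f x * cnj (cis (of_int (- n) * x)))))"
    unfolding set_lebesgue_integral_def
    by (rule Bochner_Integration.integral_cong) (simp_all add: cis_cnj)
  also have "\<dots> = cnj (LINT x:{0..2 * pi}|lborel. f x * cnj (cis (of_int (- n) * x)))"
    unfolding set_lebesgue_integral_def by (rule Bochner_Integration.integral_cnj)
  finally have "torus_inner (\<lambda>x. cnj (f x)) (\<lambda>x. cis (of_int n * x)) = cnj (torus_inner f (\<lambda>x. cis (of_int (- n) * x)))"
    by (simp add: torus_inner_def)
  then show "fourier (l2_cnj (abs_torus_L2 f)) n = fourier (abs_torus_L2 (\<lambda>x. cnj (f x))) n"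
    using f by (simp add: fourier_cnj fourier_abs torus_L2_fun_cnj)
qed

text \<open>Uniqueness of Fourier coefficients identifies the two conjugations, on coefficients and pointwise.\<close>

lemma L2_real_valued_iff: "L2_real_valued u \<longleftrightarrow> l2_cnj u = u"
proof -
  define f where "f = rep_torus_L2 u"
  have f: "torus_L2_fun f" unfolding f_def by (rule torus_L2_fun_rep)
  have u: "u = abs_torus_L2 f" by (simp add: f_def abs_rep_torus_L2)
  have "L2_real_valued u \<longleftrightarrow> (AE x in lborel. x \<in> {0..2 * pi} \<longrightarrow> f x \<in> \<real>)"
    using f by (simp add: u L2_real_valued.abs_eq torus_eq_refl_iff)
  also have "\<dots> \<longleftrightarrow> (AE x in lborel. x \<in> {0..2 * pi} \<longrightarrow> cnj (f x) = f x)"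
    by (simp add: Reals_cnj_iff)
  also have "\<dots> \<longleftrightarrow> torus_eq (\<lambda>x. cnj (f x)) f"
    using f torus_L2_fun_cnj[OF f] by (simp add: torus_eq_def)
  also have "\<dots> \<longleftrightarrow> abs_torus_L2 (\<lambda>x. cnj (f x)) = abs_torus_L2 f"
    using Quotient3_rel[OF Quotient3_torus_L2, of "\<lambda>x. cnj (f x)" f] f torus_L2_fun_cnj[OF f]
    by (simp add: torus_eq_refl_iff)
  finally show ?thesis using l2_cnj_abs[OF f] by (simp add: u)
qed

context sobolev_weight
begin

sublocale hardy_algebra "wfun p" "wmul p" "L2_exp 0" L2_scale l2_cnj "\<lambda>f. fourier f 0" l2_pos
proof (rule hardy_algebra.intro)
  show "a = b" if "\<And>t. wfun p a t = wfun p b t" for a b using that by (rule wfun_eqI)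
  show "bounded_linear (\<lambda>a. wfun p a t)" for t by (rule bounded_linear_wfun)
  show "continuous_on UNIV (wfun p a)" for a
    unfolding wfun_def by (rule trig_series_continuous[OF wcoef_abs_summable])
  show "bounded_bilinear (wmul p)" by (rule bounded_bilinear_wmul)
  show "wfun p (wmul p a b) t = wfun p a t * wfun p b t" for a b t by (rule wfun_wmul)
  show "wfun p (L2_exp 0) t = 1" for t by (rule wfun_exp_0)
  show "bounded_linear (L2_scale c)" for c by (rule bounded_linear_L2_scale)
  show "wfun p (L2_scale c a) t = c * wfun p a t" for c a t by (rule wfun_scale)
  show "bounded_linear l2_cnj" by (rule bounded_linear_cnj)
  show "wfun p (l2_cnj a) t = cnj (wfun p a t)" for a t by (rule wfun_cnj)
  show "bounded_linear (\<lambda>f. fourier f 0)" by (rule bounded_linear_fourier)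
  show "fourier (L2_exp 0) 0 = 1" by (simp add: fourier_exp)
  show "fourier (L2_scale c a) 0 = c * fourier a 0" for c a by (rule fourier_scale)
  show "fourier (l2_cnj a) 0 = cnj (fourier a 0)" for a by (simp add: fourier_cnj)
  show "a = 0" if "fourier (wmul p a (l2_cnj a)) 0 = 0" for a using that by (rule wmul_cnj_definite)
  show "bounded_linear l2_pos" by (rule bounded_linear_pos)
  show "l2_pos (l2_pos a) = l2_pos a" for a by (rule fourier_eqI) (simp add: fourier_pos)
  show "l2_pos (L2_scale c a) = L2_scale c (l2_pos a)" for c a
    by (rule fourier_eqI) (simp add: fourier_pos fourier_scale)
  show "l2_pos (L2_exp 0) = 0" by (rule fourier_eqI) (simp add: fourier_pos fourier_exp)
  show "fourier (l2_pos a) 0 = 0" for a by (simp add: fourier_pos)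
  show "l2_pos (l2_cnj (l2_pos a)) = 0" for a by (rule fourier_eqI) (simp add: fourier_pos fourier_cnj)
  show "a = l2_pos a + L2_scale (fourier a 0) (L2_exp 0) + l2_cnj (l2_pos (l2_cnj a))" for a
    by (rule fourier_eqI) (auto simp: fourier_add fourier_pos fourier_cnj fourier_scale fourier_exp)
  show "l2_pos (wmul p (l2_pos a) (l2_pos b)) = wmul p (l2_pos a) (l2_pos b)" for a b by (rule pos_wmul_pos)
qed

end

lemma norm_l2_pos: "norm (l2_pos f) \<le> norm f"
  using norm_le_fourier[OF bij_id, of 1 "l2_pos f" f] by (simp add: fourier_pos)

lemma norm_l2_cnj: "norm (l2_cnj f) \<le> norm f"
  using norm_le_fourier[OF bij_uminus_int, of 1 "l2_cnj f" f] by (simp add: fourier_cnj)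

section \<open>Sobolev spaces on the torus\<close>

lemma sobolev_iff: "f \<in> sobolev s \<longleftrightarrow> (\<lambda>n. (cmod (of_real (wt (s / 2) n) * fourier f n))\<^sup>2) summable_on UNIV"
  by (simp add: sobolev_def norm_mult power_mult_distrib wt_square) (simp add: wt_def)

text \<open>The Bessel potential of order \<open>s\<close>, an isometry of the Sobolev space of order \<open>s\<close> onto \<open>torus_L2\<close>.\<close>

definition bessel :: "real \<Rightarrow> torus_L2 \<Rightarrow> torus_L2" where
  "bessel s f = l2_of (\<lambda>n. of_real (wt (s / 2) n) * fourier f n)"

lemma fourier_bessel: "f \<in> sobolev s \<Longrightarrow> fourier (bessel s f) n = of_real (wt (s / 2) n) * fourier f n"
  unfolding bessel_def by (rule fourier_l2_of) (simp add: sobolev_iff)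

lemma sobolev_norm_eq: "f \<in> sobolev s \<Longrightarrow> sobolev_norm s f = norm (bessel s f)"
  by (simp add: norm_fourier_infsum fourier_bessel sobolev_norm_def norm_mult power_mult_distrib wt_square)
     (simp add: wt_def)

lemma sobolevI:
  assumes "\<And>n. of_real (wt (s / 2) n) * fourier f n = fourier g n"
  shows "f \<in> sobolev s \<and> bessel s f = g"
proof -
  have "f \<in> sobolev s" by (simp add: sobolev_iff assms fourier_summable)
  moreover have "bessel s f = g"
    by (rule fourier_eqI) (simp add: fourier_bessel calculation assms)
  ultimately show ?thesis ..
qed

lemma sobolev_lincomb:
  assumes "f \<in> sobolev s" "g \<in> sobolev s"
  shows "a *\<^sub>R f + b *\<^sub>R g \<in> sobolev s \<and> bessel s (a *\<^sub>R f + b *\<^sub>R g) = a *\<^sub>R bessel s f + b *\<^sub>R bessel s g"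
  by (rule sobolevI) (simp add: fourier_add fourier_scaleR fourier_bessel assms algebra_simps)

lemma sobolev_diff:
  assumes "f \<in> sobolev s" "g \<in> sobolev s"
  shows "f - g \<in> sobolev s" "bessel s (f - g) = bessel s f - bessel s g"
  using sobolev_lincomb[OF assms, of 1 "-1"] by simp_all

lemma bessel_inj: "f \<in> sobolev s \<Longrightarrow> bessel s f = 0 \<Longrightarrow> f = 0"
  by (rule fourier_eq_zero_imp) (metis fourier_bessel fourier_zero mult_eq_0_iff of_real_eq_0_iff wt_neq_0)

lemma sobolev_norm_nonneg: "0 \<le> sobolev_norm s f"
  unfolding sobolev_norm_def by (intro real_sqrt_ge_zero infsum_nonneg) auto

lemma Metric_space_sobolev:
  assumes X: "X \<subseteq> sobolev s"
  shows "Metric_space X (\<lambda>x y. sobolev_norm s (x - y))"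
proof
  show "0 \<le> sobolev_norm s (x - y)" for x y by (rule sobolev_norm_nonneg)
  show "sobolev_norm s (x - y) = sobolev_norm s (y - x)" for x y
    by (simp add: sobolev_norm_def fourier_diff norm_minus_commute)
  show "sobolev_norm s (x - y) = 0 \<longleftrightarrow> x = y" if "x \<in> X" "y \<in> X" for x y
  proof -
    have d: "x - y \<in> sobolev s" using that X by (intro sobolev_diff) auto
    have "bessel s 0 = 0"
      by (rule fourier_eqI) (simp add: bessel_def l2_of_def)
    then show ?thesis using bessel_inj[OF d] sobolev_norm_eq[OF d] by auto
  qed
  show "sobolev_norm s (x - z) \<le> sobolev_norm s (x - y) + sobolev_norm s (y - z)"
    if "x \<in> X" "y \<in> X" "z \<in> X" for x y z
  proof -
    have xyz: "x \<in> sobolev s" "y \<in> sobolev s" "z \<in> sobolev s" using that X by auto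
    then show ?thesis
      using norm_triangle_ineq[of "bessel s x - bessel s y" "bessel s y - bessel s z"]
      by (simp add: sobolev_norm_eq sobolev_diff)
  qed
qed

lemma openin_norm_topology_sobolev:
  assumes X: "X \<subseteq> sobolev s" and U: "U \<subseteq> X"
    and "\<And>x. x \<in> U \<Longrightarrow> \<exists>r>0. \<forall>y\<in>X. sobolev_norm s (y - x) < r \<longrightarrow> y \<in> U"
  shows "openin (norm_topology X (sobolev_norm s)) U"
proof -
  interpret Metric_space X "\<lambda>x y. sobolev_norm s (x - y)" by (rule Metric_space_sobolev[OF X])
  show ?thesis
    unfolding norm_topology_def openin_mtopology
  proof (intro conjI allI impI U)
    fix x assume "x \<in> U"
    then obtain r where r: "r > 0" "\<And>y. y \<in> X \<Longrightarrow> sobolev_norm s (y - x) < r \<Longrightarrow> y \<in> U"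
      using assms(3) by blast
    then have "mball x r \<subseteq> U" using commute by auto
    with r(1) show "\<exists>r>0. mball x r \<subseteq> U" by blast
  qed
qed

section \<open>Tao's gauge transform\<close>

locale tao_setting = fixes s :: real assumes s: "0 \<le> s"
begin

abbreviation p where "p \<equiv> (s + 1) / 2"

sublocale sobolev_weight "(s + 1) / 2"
  by unfold_locales (use s in simp)

abbreviation E where "E \<equiv> sobolev_r0 s"
abbreviation F where "F \<equiv> sobolev_plus0 s"
abbreviation N where "N \<equiv> sobolev_norm s"

lemma wt_p: "wt p n = wt (s / 2) n * wt (1 / 2) n"
  using wt_add[of "s / 2" "1 / 2" n] by (simp add: add_divide_distrib)

lemma wt_half: "wt (1 / 2) n = sqrt (1 + (real_of_int n)\<^sup>2)"
  unfolding wt_def by (rule powr_half_sqrt) auto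

lemma int_le_wt_half: "\<bar>real_of_int n\<bar> \<le> wt (1 / 2) n"
  unfolding wt_half by (rule real_le_rsqrt) simp

lemma wt_half_le: assumes "n \<noteq> 0" shows "wt (1 / 2) n \<le> 2 * \<bar>real_of_int n\<bar>"
  unfolding wt_half
proof (rule real_le_lsqrt)
  have "1 \<le> \<bar>real_of_int n\<bar>" using assms by linarith
  then have "1 \<le> (real_of_int n)\<^sup>2" using one_le_power[of "\<bar>real_of_int n\<bar>" 2] by simp
  then show "1 + (real_of_int n)\<^sup>2 \<le> (2 * \<bar>real_of_int n\<bar>)\<^sup>2" by (simp add: power_mult_distrib)
qed auto

text \<open>The mean-zero primitive, as a code in the algebra of order \<open>s + 1\<close>.\<close>

definition J :: "torus_L2 \<Rightarrow> torus_L2" where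
  "J u = l2_of (\<lambda>n. if n = 0 then 0 else of_real (wt p n) / (\<i> * of_int n) * fourier u n)"

text \<open>The derivative of the function coded by \<open>a\<close>.\<close>

definition D :: "torus_L2 \<Rightarrow> torus_L2" where
  "D a = l2_of (\<lambda>n. \<i> * of_int n / of_real (wt p n) * fourier a n)"

lemma J_bound:
  assumes u: "u \<in> sobolev s"
  shows "cmod (if n = 0 then 0 else of_real (wt p n) / (\<i> * of_int n) * fourier u n) \<le> 2 * cmod (fourier (bessel s u) n)"
proof (cases "n = 0")
  case False
  have "cmod (of_real (wt p n) / (\<i> * of_int n) * fourier u n) = wt (s / 2) n * cmod (fourier u n) * (wt (1 / 2) n / \<bar>real_of_int n\<bar>)"
    by (simp add: norm_mult norm_divide wt_p)
  also have "\<dots> \<le> wt (s / 2) n * cmod (fourier u n) * 2"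
    using wt_half_le[OF False] False by (intro mult_left_mono) (auto simp: field_simps)
  finally show ?thesis using False by (simp add: fourier_bessel[OF u] norm_mult)
qed simp

lemma fourier_J: "u \<in> sobolev s \<Longrightarrow> fourier (J u) n = (if n = 0 then 0 else of_real (wt p n) / (\<i> * of_int n) * fourier u n)"
  unfolding J_def by (rule fourier_l2_of, rule multiplier_summable[OF bij_id, of _ 2 "bessel s u"]) (simp add: J_bound)

lemma norm_J: "u \<in> sobolev s \<Longrightarrow> norm (J u) \<le> 2 * N u"
  unfolding sobolev_norm_eq by (rule norm_le_fourier[OF bij_id]) (use J_bound in \<open>auto simp: fourier_J\<close>)

lemma D_bound: "cmod (of_real (wt (s / 2) n) * (\<i> * of_int n / of_real (wt p n) * fourier a n)) \<le> 1 * cmod (fourier a n)"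
proof -
  have "cmod (of_real (wt (s / 2) n) * (\<i> * of_int n / of_real (wt p n) * fourier a n)) = \<bar>real_of_int n\<bar> / wt (1 / 2) n * cmod (fourier a n)"
    by (simp add: norm_mult norm_divide wt_p)
  also have "\<dots> \<le> 1 * cmod (fourier a n)"
    using int_le_wt_half[of n] by (intro mult_right_mono) (auto simp: divide_le_eq)
  finally show ?thesis .
qed

lemma fourier_D: "fourier (D a) n = \<i> * of_int n / of_real (wt p n) * fourier a n"
  unfolding D_def
proof (rule fourier_l2_of, rule multiplier_summable[OF bij_id, of _ 1 a])
  fix n
  have "1 * cmod (\<i> * of_int n / of_real (wt p n) * fourier a n) \<le> wt (s / 2) n * cmod (\<i> * of_int n / of_real (wt p n) * fourier a n)"
    using s by (intro mult_right_mono wt_ge_1) auto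
  also have "\<dots> \<le> 1 * cmod (fourier a n)"
    using D_bound[of n a] unfolding norm_mult by simp
  finally show "cmod (\<i> * of_int n / of_real (wt p n) * fourier a n) \<le> 1 * cmod (fourier a (id n))" by simp
qed

lemma D_sobolev: "D a \<in> sobolev s" and norm_D: "N (D a) \<le> norm a"
proof -
  have "(\<lambda>n. (cmod (of_real (wt (s / 2) n) * fourier (D a) n))\<^sup>2) summable_on UNIV"
    unfolding fourier_D by (rule multiplier_summable[OF bij_id, of _ 1 a]) (use D_bound in simp)
  then show DS: "D a \<in> sobolev s" by (simp add: sobolev_iff)
  have "norm (bessel s (D a)) \<le> 1 * norm a"
    by (rule norm_le_fourier[OF bij_id]) (use D_bound in \<open>auto simp: fourier_bessel[OF DS] fourier_D\<close>)
  then show "N (D a) \<le> norm a" by (simp add: sobolev_norm_eq[OF DS])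
qed

lemma D_lincomb: "D (a *\<^sub>R x + b *\<^sub>R y) = a *\<^sub>R D x + b *\<^sub>R D y"
  by (rule fourier_eqI) (simp add: fourier_D fourier_add fourier_scaleR algebra_simps add_divide_distrib diff_divide_distrib)

lemma D_diff: "D (x - y) = D x - D y"
  by (rule fourier_eqI) (simp add: fourier_D fourier_diff algebra_simps add_divide_distrib diff_divide_distrib)

lemma D_add: "D (x + y) = D x + D y"
  by (rule fourier_eqI) (simp add: fourier_D fourier_add algebra_simps add_divide_distrib diff_divide_distrib)

lemma J_lincomb: "x \<in> sobolev s \<Longrightarrow> y \<in> sobolev s \<Longrightarrow> J (a *\<^sub>R x + b *\<^sub>R y) = a *\<^sub>R J x + b *\<^sub>R J y"
  by (rule fourier_eqI) (auto simp: fourier_J sobolev_lincomb fourier_add fourier_scaleR algebra_simps add_divide_distrib diff_divide_distrib)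

lemma J_add: "x \<in> sobolev s \<Longrightarrow> y \<in> sobolev s \<Longrightarrow> J (x + y) = J x + J y"
  using J_lincomb[of x y 1 1] by simp

lemma D_J: "u \<in> sobolev s \<Longrightarrow> fourier u 0 = 0 \<Longrightarrow> D (J u) = u"
  by (rule fourier_eqI) (auto simp: fourier_D fourier_J)

lemma J_D: "fourier a 0 = 0 \<Longrightarrow> J (D a) = a"
  by (rule fourier_eqI) (auto simp: fourier_D fourier_J D_sobolev)

lemma E_iff: "u \<in> E \<longleftrightarrow> u \<in> sobolev s \<and> l2_cnj u = u \<and> fourier u 0 = 0"
  by (auto simp: sobolev_r0_def L2_real_valued_iff fourier_def)

lemma F_iff: "v \<in> F \<longleftrightarrow> v \<in> sobolev s \<and> (\<forall>n\<le>0. fourier v n = 0)"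
  by (auto simp: sobolev_plus0_def sobolev_plus_def fourier_def[of v 0, symmetric] le_less)

lemma hardy0_iff: "hardy0 a \<longleftrightarrow> (\<forall>n\<le>0. fourier a n = 0)"
  unfolding hardy0_def
proof
  show "\<forall>n\<le>0. fourier a n = 0" if "l2_pos a = a"
    using that fourier_pos[of a] by (metis not_le)
  show "l2_pos a = a" if "\<forall>n\<le>0. fourier a n = 0"
    by (rule fourier_eqI) (use that in \<open>auto simp: fourier_pos\<close>)
qed

lemma real0_J: assumes u: "u \<in> E" shows "real0 (J u)"
proof -
  have us: "u \<in> sobolev s" and "l2_cnj u = u" using u by (auto simp: E_iff)
  then have c: "cnj (fourier u (- n)) = fourier u n" for n by (metis fourier_cnj)
  have "l2_cnj (J u) = J u"
    by (rule fourier_eqI) (simp add: fourier_cnj fourier_J[OF us] c)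
  then show ?thesis by (simp add: real0_def fourier_J[OF us])
qed

lemma D_E: assumes a: "real0 a" shows "D a \<in> E"
proof -
  have "l2_cnj a = a" using a by (simp add: real0_def)
  then have c: "cnj (fourier a (- n)) = fourier a n" for n by (metis fourier_cnj)
  have "l2_cnj (D a) = D a"
    by (rule fourier_eqI) (simp add: fourier_cnj fourier_D c)
  then show ?thesis by (simp add: E_iff D_sobolev fourier_D)
qed

lemma hardy0_J: "v \<in> F \<Longrightarrow> hardy0 (J v)"
  by (auto simp: hardy0_iff F_iff fourier_J)

lemma D_F: "hardy0 a \<Longrightarrow> D a \<in> F"
  by (auto simp: hardy0_iff F_iff fourier_D D_sobolev)

lemma E_subset: "E \<subseteq> sobolev s" and F_subset: "F \<subseteq> sobolev s"
  by (auto simp: E_iff F_iff)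

lemma D_J_E: "u \<in> E \<Longrightarrow> D (J u) = u" and D_J_F: "v \<in> F \<Longrightarrow> D (J v) = v"
  by (auto simp: E_iff F_iff D_J)

lemma E_lincomb: assumes "x \<in> E" "y \<in> E" shows "a *\<^sub>R x + b *\<^sub>R y \<in> E"
  using assms by (simp add: E_iff sobolev_lincomb fourier_add fourier_scaleR cj.add cj.scaleR)

lemma F_lincomb: "x \<in> F \<Longrightarrow> y \<in> F \<Longrightarrow> a *\<^sub>R x + b *\<^sub>R y \<in> F"
  by (simp add: F_iff sobolev_lincomb fourier_add fourier_scaleR)

lemma abs_wfun: "fourier (abs_torus_L2 (wfun p a)) n = wcoef p a n" "torus_L2_fun (wfun p a)"
  unfolding wfun_def by (rule fourier_trig_series_fun[OF wcoef_abs_summable])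
    (rule torus_L2_fun_trig_series[OF wcoef_abs_summable])

lemma antideriv_eq:
  assumes u: "u \<in> E" shows "L2_antideriv u = abs_torus_L2 (wfun p (J u))"
proof (rule fourier_eqI)
  fix n
  have us: "u \<in> sobolev s" using u by (simp add: E_iff)
  have "(\<lambda>n. (cmod (1 / (\<i> * of_int n) * fourier u n))\<^sup>2) summable_on UNIV"
  proof (rule multiplier_summable[OF bij_id, of _ 1 u])
    fix n :: int
    have "1 / \<bar>real_of_int n\<bar> \<le> 1"
    proof (cases "n = 0")
      case False
      then have "1 \<le> \<bar>real_of_int n\<bar>" by linarith
      then show ?thesis by simp
    qed simp
    then show "cmod (1 / (\<i> * of_int n) * fourier u n) \<le> 1 * cmod (fourier u (id n))"
      using mult_right_mono[of "1 / \<bar>real_of_int n\<bar>" 1 "cmod (fourier u n)"] by (simp add: norm_mult norm_divide)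
  qed
  then have "(\<lambda>n. (cmod (1 / (\<i> * of_int n) * fourier u n))\<^sup>2) summable_on (- {0})"
    by (rule summable_on_subset) simp
  from fourier_trig_series[OF this]
  show "fourier (L2_antideriv u) n = fourier (abs_torus_L2 (wfun p (J u))) n"
    by (simp add: L2_antideriv_def abs_wfun wcoef_def fourier_J[OF us])
qed

lemma exp_antideriv:
  assumes u: "u \<in> E"
  shows "L2_exp_mi (L2_antideriv u) = abs_torus_L2 (wfun p (EXP (L2_scale (- \<i>) (J u))))"
proof -
  have r: "wfun p (J u) x \<in> \<real>" for x
    using real0_J[OF u] ev_cj[of "J u" x] by (simp add: real0_def Reals_cnj_iff)
  have "L2_exp_mi (L2_antideriv u) = abs_torus_L2 (\<lambda>x. exp (- \<i> * wfun p (J u) x))"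
    unfolding antideriv_eq[OF u] by (rule L2_exp_mi_abs(2)[OF abs_wfun(2)]) (use r in simp)
  moreover have "(\<lambda>x. exp (- \<i> * wfun p (J u) x)) = wfun p (EXP (L2_scale (- \<i>) (J u)))"
    by (rule ext) (simp add: ev_EXP ev_cs)
  ultimately show ?thesis by simp
qed

lemma fourier_szego: "fourier (szego f) n = (if 0 \<le> n then fourier f n else 0)"
  unfolding szego_def by (subst fourier_trig_series[OF fourier_summable]) simp

text \<open>The gauge transform is conjugate to the gauge of the algebra.  The term of frequency 0, which the
  projection \<open>szego\<close> keeps and \<open>gauge\<close> drops, is killed by the derivative.\<close>

lemma tao_gauge_eq:
  assumes u: "u \<in> E" shows "tao_gauge u = D (gauge (J u))"
proof -
  define a where "a = EXP (L2_scale (- \<i>) (J u))"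
  define g where "g = szego (L2_exp_mi (L2_antideriv u))"
  have g: "fourier g n = (if 0 \<le> n then wcoef p a n else 0)" for n
    by (simp add: g_def fourier_szego exp_antideriv[OF u] abs_wfun a_def)
  have eq: "\<i> * of_int n * fourier g n = fourier (D (gauge (J u))) n" for n
    by (auto simp: g fourier_D gauge_def a_def[symmetric] fourier_pos wcoef_def)
  have "tao_gauge u = l2_of (fourier (D (gauge (J u))))"
    unfolding tao_gauge_def L2_deriv_def l2_of_def g_def[symmetric] eq ..
  then show ?thesis by (simp add: l2_of_fourier)
qed

lemma hardy0_gauge: "hardy0 (gauge U)"
  unfolding gauge_def by (rule hardy0_P)

lemma J_tao_gauge: "u \<in> E \<Longrightarrow> J (tao_gauge u) = gauge (J u)"
  by (simp add: tao_gauge_eq J_D hardy0_mean[OF hardy0_gauge])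

lemma tao_gauge_F: "u \<in> E \<Longrightarrow> tao_gauge u \<in> F"
  by (simp add: tao_gauge_eq D_F hardy0_gauge)

lemma inj_tao_gauge: "inj_on tao_gauge E"
proof (rule inj_onI)
  fix u1 u2 assume u: "u1 \<in> E" "u2 \<in> E" and eq: "tao_gauge u1 = tao_gauge u2"
  have "gauge (J u1) = gauge (J u2)" using u eq by (metis J_tao_gauge)
  then have "J u1 = J u2" by (rule gauge_inj[OF real0_J[OF u(1)] real0_J[OF u(2)]])
  then show "u1 = u2" using u by (metis D_J_E)
qed

lemma tao_gauge_local_inverse:
  assumes u: "u \<in> E"
  shows "\<exists>r>0. \<exists>M G. ps_on r M G \<and> (\<forall>h\<in>F. norm (J h) < r \<longrightarrow>
     D (G (J h)) \<in> E \<and> tao_gauge (D (G (J h))) = tao_gauge u + h \<and> real0 (G (J h)))"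
proof -
  obtain r M G where r: "0 < r" and G: "ps_on r M G"
    and inv: "\<And>\<delta>. hardy0 \<delta> \<Longrightarrow> norm \<delta> < r \<Longrightarrow> real0 (G \<delta>) \<and> gauge (G \<delta>) = gauge (J u) + \<delta>"
    using gauge_local_inverse[OF real0_J[OF u]] by blast
  have "D (G (J h)) \<in> E \<and> tao_gauge (D (G (J h))) = tao_gauge u + h \<and> real0 (G (J h))"
    if h: "h \<in> F" "norm (J h) < r" for h
  proof -
    have g: "real0 (G (J h))" "gauge (G (J h)) = gauge (J u) + J h"
      using inv[OF hardy0_J[OF h(1)] h(2)] by auto
    have DE: "D (G (J h)) \<in> E" by (rule D_E[OF g(1)])
    have "J (D (G (J h))) = G (J h)" using g(1) by (intro J_D) (simp add: real0_def)
    then have "tao_gauge (D (G (J h))) = D (gauge (J u) + J h)"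
      using tao_gauge_eq[OF DE] g(2) by simp
    also have "\<dots> = tao_gauge u + h"
      using tao_gauge_eq[OF u] D_J_F[OF h(1)] by (simp add: D_add)
    finally show ?thesis using DE g(1) by blast
  qed
  with r G show ?thesis by blast
qed

lemma open_image: "openin (norm_topology F N) (tao_gauge ` E)"
proof (rule openin_norm_topology_sobolev[OF F_subset])
  show "tao_gauge ` E \<subseteq> F" using tao_gauge_F by blast
  fix v assume "v \<in> tao_gauge ` E"
  then obtain u where u: "u \<in> E" "v = tao_gauge u" by blast
  obtain r M G where r: "0 < r"
    and inv: "\<And>h. h \<in> F \<Longrightarrow> norm (J h) < r \<Longrightarrow> D (G (J h)) \<in> E \<and> tao_gauge (D (G (J h))) = tao_gauge u + h"
    using tao_gauge_local_inverse[OF u(1)] by blast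
  have "y \<in> tao_gauge ` E" if y: "y \<in> F" "N (y - v) < r / 2" for y
  proof -
    have d: "y - v \<in> F" using F_lincomb[OF y(1) tao_gauge_F[OF u(1)], of 1 "-1"] u(2) by simp
    have "norm (J (y - v)) < r" using norm_J[of "y - v"] d y(2) F_subset by fastforce
    from inv[OF d this] have "y = tao_gauge (D (G (J (y - v))))" "D (G (J (y - v))) \<in> E"
      using u(2) by simp_all
    then show ?thesis by blast
  qed
  with r show "\<exists>r>0. \<forall>y\<in>F. N (y - v) < r \<longrightarrow> y \<in> tao_gauge ` E"
    by (intro exI[of _ "r / 2"]) auto
qed

lemma open_E: "openin (norm_topology E N) E"
  by (rule openin_norm_topology_sobolev[OF E_subset]) (auto intro: exI[of _ 1])

lemma analytic_forward: "real_analytic_map E N F N E tao_gauge"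
proof (rule real_analytic_mapI[where J = J and c = 2 and D = "\<lambda>a. D (l2_pos a)" and K = 1])
  show "openin (norm_topology E N) E" by (rule open_E)
  show "tao_gauge ` E \<subseteq> F" using tao_gauge_F by blast
  show "J (a *\<^sub>R x + b *\<^sub>R y) = a *\<^sub>R J x + b *\<^sub>R J y" if "x \<in> E" "y \<in> E" for x y a b
    using that E_subset by (intro J_lincomb) auto
  show "norm (J x) \<le> 2 * N x" if "x \<in> E" for x using that E_subset by (intro norm_J) auto
  show "D (l2_pos (a *\<^sub>R x + b *\<^sub>R y)) = a *\<^sub>R D (l2_pos x) + b *\<^sub>R D (l2_pos y)" for x y a b
    by (simp add: P.add P.scaleR D_lincomb)
  show "D (l2_pos x) \<in> F" for x by (rule D_F[OF hardy0_P])
  show "N (D (l2_pos x)) \<le> 1 * norm x" for x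
    using norm_D[of "l2_pos x"] norm_l2_pos[of x] by simp
  show "0 \<le> N y" for y by (rule sobolev_norm_nonneg)
  fix u assume u: "u \<in> E"
  obtain M g where g: "ps_on 1 M g" "\<And>\<delta>. gauge (J u + \<delta>) = g \<delta>"
    using gauge_ps_on by blast
  have "u + h \<in> E \<and> tao_gauge (u + h) = D (l2_pos (g (J h)))" if h: "h \<in> E" for h
  proof -
    have uh: "u + h \<in> E" using E_lincomb[OF u h, of 1 1] by simp
    have "J (u + h) = J u + J h" using u h E_subset by (intro J_add) auto
    then have "tao_gauge (u + h) = D (g (J h))" using tao_gauge_eq[OF uh] g(2) by simp
    moreover have "l2_pos (g (J h)) = g (J h)"
      using hardy0_gauge[of "J u + J h"] by (simp add: g(2) hardy0_def)
    ultimately show ?thesis using uh by simp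
  qed
  with g(1) show "\<exists>r>0. \<exists>M g. ps_on r M g \<and>
     (\<forall>h\<in>E. norm (J h) < r \<longrightarrow> u + h \<in> E \<and> tao_gauge (u + h) = D (l2_pos (g (J h))))"
    by (intro exI[of _ 1] conjI exI[of _ M] exI[of _ g]) auto
qed auto

text \<open>The decoding map here first projects onto real functions of mean zero, so that the forms in the
  expansion take values in the right space; on the values of the inverse it changes nothing.\<close>

lemma analytic_inverse:
  "real_analytic_map F N E N (tao_gauge ` E) (inv_into E tao_gauge)"
proof (rule real_analytic_mapI[where J = J and c = 2 and D = "\<lambda>a. D (l2_pos a + l2_cnj (l2_pos a))" and K = 2])
  let ?I = "inv_into E tao_gauge"
  show "openin (norm_topology F N) (tao_gauge ` E)" by (rule open_image)
  show "?I ` tao_gauge ` E \<subseteq> E" by (auto intro: inv_into_into)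
  show "J (a *\<^sub>R x + b *\<^sub>R y) = a *\<^sub>R J x + b *\<^sub>R J y" if "x \<in> F" "y \<in> F" for x y a b
    using that F_subset by (intro J_lincomb) auto
  show "norm (J x) \<le> 2 * N x" if "x \<in> F" for x using that F_subset by (intro norm_J) auto
  show "D (l2_pos (a *\<^sub>R x + b *\<^sub>R y) + l2_cnj (l2_pos (a *\<^sub>R x + b *\<^sub>R y)))
     = a *\<^sub>R D (l2_pos x + l2_cnj (l2_pos x)) + b *\<^sub>R D (l2_pos y + l2_cnj (l2_pos y))" for x y a b
    by (simp add: P.add P.scaleR cj.add cj.scaleR D_lincomb[symmetric] scaleR_add_right add_ac)
  show "D (l2_pos x + l2_cnj (l2_pos x)) \<in> E" for x by (intro D_E real0_sum hardy0_P)
  show "N (D (l2_pos x + l2_cnj (l2_pos x))) \<le> 2 * norm x" for x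
    using norm_D[of "l2_pos x + l2_cnj (l2_pos x)"] norm_triangle_ineq[of "l2_pos x" "l2_cnj (l2_pos x)"]
      norm_l2_pos[of x] norm_l2_cnj[of "l2_pos x"] by linarith
  show "0 \<le> N y" for y by (rule sobolev_norm_nonneg)
  fix v assume "v \<in> tao_gauge ` E"
  then obtain u where u: "u \<in> E" "v = tao_gauge u" by blast
  obtain r M G where r: "0 < r" and G: "ps_on r M G"
    and inv: "\<And>h. h \<in> F \<Longrightarrow> norm (J h) < r \<Longrightarrow>
      D (G (J h)) \<in> E \<and> tao_gauge (D (G (J h))) = tao_gauge u + h \<and> real0 (G (J h))"
    using tao_gauge_local_inverse[OF u(1)] by blast
  have "v + h \<in> tao_gauge ` E \<and> ?I (v + h) = D (l2_pos (G (J h)) + l2_cnj (l2_pos (G (J h))))"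
    if h: "h \<in> F" "norm (J h) < r" for h
  proof -
    have eq: "v + h = tao_gauge (D (G (J h)))" and DE: "D (G (J h)) \<in> E" and re: "real0 (G (J h))"
      using inv[OF h] u(2) by auto
    have "?I (v + h) = D (G (J h))" unfolding eq by (rule inv_into_f_f[OF inj_tao_gauge DE])
    then show ?thesis using eq DE real0_eq[OF re] by auto
  qed
  with r G show "\<exists>r>0. \<exists>M g. ps_on r M g \<and> (\<forall>h\<in>F. norm (J h) < r \<longrightarrow>
     v + h \<in> tao_gauge ` E \<and> ?I (v + h) = D (l2_pos (g (J h)) + l2_cnj (l2_pos (g (J h)))))"
    by blast
qed auto

lemma monomial_in_F:
  assumes "n \<ge> 1" shows "L2_scale (\<i> * of_int n) (L2_exp n) \<in> F"
proof -
  define b where "b = L2_scale (of_real (wt p n)) (L2_exp n)"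
  have "hardy0 b" using assms by (auto simp: hardy0_iff b_def fourier_scale fourier_exp)
  moreover have "L2_scale (\<i> * of_int n) (L2_exp n) = D b"
    by (rule fourier_eqI) (simp add: b_def fourier_D fourier_scale fourier_exp)
  ultimately show ?thesis using D_F by simp
qed

text \<open>A preimage would have a primitive \<open>U\<close> with \<open>U + n x\<close> constant, contradicting periodicity.\<close>

lemma monomial_not_in_image:
  assumes n: "n \<ge> 1" shows "L2_scale (\<i> * of_int n) (L2_exp n) \<notin> tao_gauge ` E"
proof
  assume "L2_scale (\<i> * of_int n) (L2_exp n) \<in> tao_gauge ` E"
  then obtain u where u: "u \<in> E" "L2_scale (\<i> * of_int n) (L2_exp n) = tao_gauge u" by blast
  define b where "b = L2_scale (of_real (wt p n)) (L2_exp n)"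
  have hb: "hardy0 b" using n by (auto simp: hardy0_iff b_def fourier_scale fourier_exp)
  have "D b = tao_gauge u"
    unfolding u(2)[symmetric] by (rule fourier_eqI) (simp add: b_def fourier_D fourier_scale fourier_exp)
  then have gb: "gauge (J u) = b" using J_tao_gauge[OF u(1)] J_D[OF hardy0_mean[OF hb]] by simp
  have evb: "wfun p b t = cis (of_int n * t)" for t
  proof (rule has_sum_unique[OF wfun_has_sum])
    show "((\<lambda>m. wcoef p b m * cis (of_int m * t)) has_sum cis (of_int n * t)) UNIV"
      by (rule has_sum_finite_neutralI[where B = "{n}"]) (auto simp: b_def wcoef_def fourier_scale fourier_exp)
  qed
  have "wmul p b (l2_cnj b) = L2_exp 0"
    by (rule ev_eqI) (simp add: ev_simps evb cis_cnj cis_mult)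
  from gauge_unimodular[OF real0_J[OF u(1)] hb this gb]
  have ex: "exp (- \<i> * wfun p (J u) t) = cis (of_int n * t)" for t
    using arg_cong[of _ _ "\<lambda>a. wfun p a t"] by (metis ev_EXP ev_cs evb)
  define f where "f t = - \<i> * wfun p (J u) t - \<i> * of_real (of_int n * t)" for t
  have "f constant_on UNIV"
  proof (rule exp_eq_one_imp_constant)
    show "continuous_on UNIV f"
      unfolding f_def by (intro continuous_intros ev_cont)
    show "exp (f t) = 1" for t
      using ex[of t] by (simp add: f_def exp_diff cis_conv_exp)
  qed
  then have "f 0 = f (0 + 2 * pi)" by (metis constant_on_def UNIV_I)
  moreover have "wfun p (J u) (0 + 2 * pi) = wfun p (J u) 0"
    unfolding wfun_def by (rule trig_series_periodic)
  ultimately show False using n by (simp add: f_def)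
qed

lemma szego_eq_D: assumes h: "h \<in> E" shows "L2_scale (- \<i>) (szego h) = D (L2_scale (- \<i>) (l2_pos (J h)))"
  using h by (intro fourier_eqI) (auto simp: fourier_scale fourier_D fourier_pos fourier_szego fourier_J E_iff)

lemma differential_zero:
  "has_differential_at E N F N tao_gauge (\<lambda>h. L2_scale (- \<i>) (szego h)) 0"
  unfolding has_differential_at_def
proof (intro conjI ballI allI impI)
  show "(\<lambda>h. L2_scale (- \<i>) (szego h)) ` E \<subseteq> F"
    using D_F[OF hardy0_cs[OF hardy0_P]] by (auto simp: szego_eq_D)
  fix x y :: torus_L2 and a b :: real assume xy: "x \<in> E" "y \<in> E"
  show "L2_scale (- \<i>) (szego (a *\<^sub>R x + b *\<^sub>R y)) = a *\<^sub>R L2_scale (- \<i>) (szego x) + b *\<^sub>R L2_scale (- \<i>) (szego y)"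
    by (rule fourier_eqI) (simp add: fourier_scale fourier_szego fourier_add fourier_scaleR algebra_simps)
next
  have "N (L2_scale (- \<i>) (szego x)) \<le> 2 * N x" if x: "x \<in> E" for x
  proof -
    have "N (L2_scale (- \<i>) (szego x)) \<le> norm (L2_scale (- \<i>) (l2_pos (J x)))"
      unfolding szego_eq_D[OF x] by (rule norm_D)
    also have "\<dots> \<le> norm (J x)"
      using norm_l2_pos[of "J x"] by (simp add: norm_L2_scale)
    also have "\<dots> \<le> 2 * N x" using x E_subset by (intro norm_J) auto
    finally show ?thesis .
  qed
  then show "\<exists>C. \<forall>x\<in>E. N (L2_scale (- \<i>) (szego x)) \<le> C * N x" by blast
next
  fix \<epsilon> :: real assume \<epsilon>: "0 < \<epsilon>"
  obtain C d where C: "0 \<le> C" and d: "0 < d"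
    and rem: "\<And>U. norm U \<le> d \<Longrightarrow> norm (gauge U + L2_scale \<i> (l2_pos U)) \<le> C * (norm U)\<^sup>2"
    using gauge_derivative by blast
  \<comment> \<open>The code of \<open>h\<close> has norm at most \<open>2 * N h\<close>, so the quadratic remainder is at most
    \<open>4 * C * (N h)\<^sup>2\<close>.\<close>
  define \<delta> where "\<delta> = min (d / 2) (\<epsilon> / (4 * C + 1))"
  have "N (tao_gauge (0 + h) - tao_gauge 0 - L2_scale (- \<i>) (szego h)) \<le> \<epsilon> * N h" if h: "h \<in> E" "N h < \<delta>" for h
  proof -
    have zE: "0 \<in> E" using E_lincomb[OF h(1) h(1), of 0 0] by simp
    have "J 0 = 0" using J_lincomb[of h h 0 0] h(1) E_subset by auto
    then have t0: "tao_gauge 0 = 0" by (simp add: tao_gauge_eq[OF zE] gauge_zero) (rule fourier_eqI, simp add: fourier_D)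
    have Jh: "norm (J h) \<le> 2 * N h" using h(1) E_subset by (intro norm_J) auto
    then have "norm (J h) \<le> d" using h(2) by (simp add: \<delta>_def)
    from rem[OF this] have r: "norm (gauge (J h) + L2_scale \<i> (l2_pos (J h))) \<le> C * (norm (J h))\<^sup>2" .
    have "L2_scale (- \<i>) (l2_pos (J h)) = - L2_scale \<i> (l2_pos (J h))"
      by (rule fourier_eqI) (simp add: fourier_scale fourier_minus)
    then have "tao_gauge (0 + h) - tao_gauge 0 - L2_scale (- \<i>) (szego h) = D (gauge (J h) + L2_scale \<i> (l2_pos (J h)))"
      by (simp add: t0 tao_gauge_eq[OF h(1)] szego_eq_D[OF h(1)] D_diff[symmetric])
    then have "N (tao_gauge (0 + h) - tao_gauge 0 - L2_scale (- \<i>) (szego h)) \<le> norm (gauge (J h) + L2_scale \<i> (l2_pos (J h)))"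
      using norm_D by simp
    also have "\<dots> \<le> C * (2 * N h)\<^sup>2"
      using r mult_left_mono[OF power_mono[OF Jh norm_ge_zero, of 2] C] by linarith
    also have "\<dots> = (4 * C * N h) * N h" by (simp add: power2_eq_square)
    also have "\<dots> \<le> \<epsilon> * N h"
    proof (rule mult_right_mono)
      have "4 * C * N h \<le> (4 * C + 1) * N h"
        using sobolev_norm_nonneg[of s h] by (simp add: distrib_right)
      also have "\<dots> \<le> (4 * C + 1) * (\<epsilon> / (4 * C + 1))"
        using h(2) C by (intro mult_left_mono) (auto simp: \<delta>_def)
      also have "\<dots> = \<epsilon>" using C by (simp add: add_nonneg_eq_0_iff)
      finally show "4 * C * N h \<le> \<epsilon>" .
    qed (rule sobolev_norm_nonneg)
    finally show ?thesis .
  qed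
  moreover have "0 < \<delta>" using d \<epsilon> C by (simp add: \<delta>_def add_nonneg_pos)
  ultimately show "\<exists>\<delta>>0. \<forall>h\<in>E. N h < \<delta> \<longrightarrow> N (tao_gauge (0 + h) - tao_gauge 0 - L2_scale (- \<i>) (szego h)) \<le> \<epsilon> * N h"
    by blast
qed

end

theorem theorem5:
  fixes s :: real
  assumes "s \<ge> 0"
  shows "tao_gauge ` sobolev_r0 s \<subseteq> sobolev_plus0 s
    \<and> openin (norm_topology (sobolev_plus0 s) (sobolev_norm s)) (tao_gauge ` sobolev_r0 s)
    \<and> real_analytic_diffeo (sobolev_r0 s) (sobolev_norm s) (sobolev_plus0 s) (sobolev_norm s)
         (sobolev_r0 s) (tao_gauge ` sobolev_r0 s) tao_gauge
    \<and> tao_gauge ` sobolev_r0 s \<noteq> sobolev_plus0 s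
    \<and> (\<forall>n::int. n \<ge> 1 \<longrightarrow>
         L2_scale (\<i> * of_int n) (L2_exp n) \<in> sobolev_plus0 s - tao_gauge ` sobolev_r0 s)
    \<and> has_differential_at (sobolev_r0 s) (sobolev_norm s) (sobolev_plus0 s) (sobolev_norm s)
         tao_gauge (\<lambda>h. L2_scale (- \<i>) (szego h)) 0"
proof -
  interpret tao_setting s by unfold_locales (rule assms)
  have mono: "\<forall>n::int. n \<ge> 1 \<longrightarrow> L2_scale (\<i> * of_int n) (L2_exp n) \<in> F - tao_gauge ` E"
    using monomial_in_F monomial_not_in_image by blast
  moreover have "real_analytic_diffeo E N F N E (tao_gauge ` E) tao_gauge"
    unfolding real_analytic_diffeo_def
    using inj_on_imp_bij_betw[OF inj_tao_gauge] analytic_forward analytic_inverse by blast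
  moreover have "tao_gauge ` E \<noteq> F" using mono[rule_format, of 1] by blast
  moreover have "tao_gauge ` E \<subseteq> F" using tao_gauge_F by blast
  ultimately show ?thesis using open_image differential_zero by blast
qed

end
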